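(* Let $w:[0,1]^2\to[-1,1]$ be a symmetric measurable function, let $h\in L^2([0,1])$, and let $A(h)=c(h)+c(h)^*$, where $c(h)$ is the creation operator on the Fock space equipped with the $T_w$-twisted inner product $\langle\cdot,\cdot\rangle_{T_w}$ and $c(h)^*$ is its adjoint with respect to $\langle\cdot,\cdot\rangle_{T_w}$. Then the moments of $A(h)$ with respect to the vector state $\tau:=\langle\,\cdot\,\Omega,\Omega\rangle_{T_w}$ coincide with those of $\mu_{w,h}$; that is, for every integer $p\ge1$, $$\langle A(h)^p\,\Omega,\Omega\rangle_{T_w}=\sum_{\pi\in P_2(p)}\int_{[0,1]^{V(f_\pi)}}\prod_{u\in V(f_\pi)}|h(x_u)|^2\prod_{(u,v)\in E(f_\pi)}w(x_u,x_v)\,\mathrm dx .$$ In particular, $\mu_w=\mu_{w,1}$ is the law of $A(1)$ with respect to $\tau$.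
   Context: Twisted Fock space. Let $H=L^2([0,1])$ (complex valued) and identify $H^{\otimes n}$ with $L^2([0,1]^n)$. Define $T_w\in B(H\otimes H)$ by $(T_wf)(x,y)=w(x,y)f(y,x)$; it is a self-adjoint contraction satisfying the Yang–Baxter (braid) relation. For $i\ge1$ let $T_i=\mathrm{id}_H^{\otimes(i-1)}\otimes T_w$ on $H^{\otimes(i+1)}$, extended to $H^{\otimes n}$ for $n\ge i+1$ by tensoring with the identity on the right. For the symmetric group $S_n$ with adjacent transpositions $\sigma_i=(i\ i{+}1)$, let $\varphi_n:S_n\to B(H^{\otimes n})$ be given by $\varphi_n(\sigma)=T_{i_1}\cdots T_{i_k}$ for any reduced word $\sigma=\sigma_{i_1}\cdots\sigma_{i_k}$ (well defined by the braid relations). Put $P^{(n)}=\sum_{\sigma\in S_n}\varphi_n(\sigma)$, which is a positive operator on $H^{\otimes n}$. On $\mathcal F=\bigoplus_{n\ge0}H^{\otimes n}$ (finite sums, $H^{\otimes0}=\mathbb C\Omega$, $\|\Omega\|=1$) define the positive semidefinite form $\langle\xi,\eta\rangle_{T_w}=\delta_{nm}\langle\xi,P^{(n)}\eta\rangle$ for $\xi\in H^{\otimes n}$, $\eta\in H^{\otimes m}$. The Fock space $\mathcal F_{T_w}$ is the completion of $\mathcal F$ for this form, after quotienting by its kernel if it is degenerate; the operators below are considered on (the image of) $\mathcal F$. For $h\in H$, the creation operator is $c(h)g=h\otimes g\in H^{\otimes(n+1)}$ for $g\in H^{\otimes n}$ (and $c(h)\Omega=h$), and $c(h)^*$ is its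 adjoint with respect to $\langle\cdot,\cdot\rangle_{T_w}$. Measures. $P_2(p)$ is the set of pair partitions of $[p]$ (sums over $P_2(p)$ are $0$ for $p$ odd). Two blocks of a partition cross if there are $i<k<j<l$ with $\{i,j\}$ contained in one of them and $\{k,l\}$ in the other. The intersection graph $f_\pi=(V(f_\pi),E(f_\pi))$ has the blocks of $\pi$ as vertices, with an edge between two distinct blocks iff they cross (each edge counted once in products). $\mu_{w,h}$ denotes the probability measure on $\mathbb R$ whose $p$-th moment is the right-hand side of the displayed formula of the claim, for every $p\ge1$, and $\mu_w:=\mu_{w,1}$ with $1$ the constant function. *)

theory Defs
  imports "HOL-Probability.Probability"
    "HOL-Combinatorics.Permutations"
begin

section \<open>The Lebesgue cube and its L2 space\<close>

(* [0,1]^I with Lebesgue measure; the completion makes the measurable sets the Lebesgue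
   measurable ones (for finite I), so that kernels w that are only Lebesgue measurable on the
   unit square are covered. *)
definition cube :: "'i set \<Rightarrow> ('i \<Rightarrow> real) measure" where
  "cube I = completion (Pi\<^sub>M I (\<lambda>_. lebesgue_on {0..1}))"

definition twist_kernel :: "(real \<Rightarrow> real \<Rightarrow> real) \<Rightarrow> bool" where
  "twist_kernel w \<longleftrightarrow>
     (\<lambda>(x, y). w x y) \<in> borel_measurable (lebesgue_on ({0..1} \<times> {0..1})) \<and>
     (\<forall>x\<in>{0..1}. \<forall>y\<in>{0..1}. w x y = w y x \<and> w x y \<in> {-1..1})"

definition L2_unit :: "(real \<Rightarrow> complex) set" where
  "L2_unit = {h \<in> borel_measurable (lebesgue_on {0..1}).
     integrable (lebesgue_on {0..1}) (\<lambda>x. (cmod (h x))\<^sup>2)}"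

(* Representatives of the elements of the n-fold tensor power of L2([0,1]), identified with
   L2([0,1]^n).  Coordinates are numbered from 0.  For n = 0 the cube is a one-point probability
   space, so this is the complex line. *)
definition L2_cube :: "nat \<Rightarrow> ((nat \<Rightarrow> real) \<Rightarrow> complex) set" where
  "L2_cube n = {f \<in> borel_measurable (cube {..<n}).
     integrable (cube {..<n}) (\<lambda>x. (cmod (f x))\<^sup>2)}"

definition L2_inner :: "nat \<Rightarrow> ((nat \<Rightarrow> real) \<Rightarrow> complex) \<Rightarrow> ((nat \<Rightarrow> real) \<Rightarrow> complex) \<Rightarrow> complex" where
  "L2_inner n f g = (LINT x|cube {..<n}. f x * cnj (g x))"

section \<open>The twisted symmetrizer\<close>

definition twist :: "(real \<Rightarrow> real \<Rightarrow> real) \<Rightarrow> (real \<Rightarrow> real \<Rightarrow> complex) \<Rightarrow> real \<Rightarrow> real \<Rightarrow> complex" where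
  "twist w f x y = complex_of_real (w x y) * f y x"

(* The twist applied in the coordinates i and i + 1 with all other coordinates frozen, i.e.
   id tensor ... tensor id tensor T_w tensor id tensor ... tensor id. *)
definition twist_at ::
  "(real \<Rightarrow> real \<Rightarrow> real) \<Rightarrow> nat \<Rightarrow> ((nat \<Rightarrow> real) \<Rightarrow> complex) \<Rightarrow> (nat \<Rightarrow> real) \<Rightarrow> complex" where
  "twist_at w i f x = twist w (\<lambda>s t. f (x(i := s, Suc i := t))) (x i) (x (Suc i))"

definition word_perm :: "nat list \<Rightarrow> nat \<Rightarrow> nat" where
  "word_perm is = foldr (\<lambda>i p. Transposition.transpose i (Suc i) \<circ> p) is id"

definition is_word :: "nat \<Rightarrow> (nat \<Rightarrow> nat) \<Rightarrow> nat list \<Rightarrow> bool" where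
  "is_word n \<sigma> is \<longleftrightarrow> (\<forall>i\<in>set is. Suc i < n) \<and> word_perm is = \<sigma>"

definition reduced_word :: "nat \<Rightarrow> (nat \<Rightarrow> nat) \<Rightarrow> nat list \<Rightarrow> bool" where
  "reduced_word n \<sigma> is \<longleftrightarrow>
     is_word n \<sigma> is \<and> (\<forall>js. is_word n \<sigma> js \<longrightarrow> length is \<le> length js)"

(* By the braid relations the choice of the reduced word is immaterial on the cube. *)
definition twist_perm :: "(real \<Rightarrow> real \<Rightarrow> real) \<Rightarrow> nat \<Rightarrow> (nat \<Rightarrow> nat) \<Rightarrow>
    ((nat \<Rightarrow> real) \<Rightarrow> complex) \<Rightarrow> (nat \<Rightarrow> real) \<Rightarrow> complex" where
  "twist_perm w n \<sigma> = foldr (twist_at w) (SOME is. reduced_word n \<sigma> is)"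

definition twist_sum ::
  "(real \<Rightarrow> real \<Rightarrow> real) \<Rightarrow> nat \<Rightarrow> ((nat \<Rightarrow> real) \<Rightarrow> complex) \<Rightarrow> (nat \<Rightarrow> real) \<Rightarrow> complex" where
  "twist_sum w n f x = (\<Sum>\<sigma> | \<sigma> permutes {..<n}. twist_perm w n \<sigma> f x)"

section \<open>The twisted Fock space\<close>

type_synonym fock_vec = "nat \<Rightarrow> (nat \<Rightarrow> real) \<Rightarrow> complex"

definition fock_alg :: "fock_vec set" where
  "fock_alg = {\<xi>. (\<forall>n. \<xi> n \<in> L2_cube n) \<and> finite {n. \<xi> n \<noteq> (\<lambda>_. 0)}}"

definition fock_vacuum :: fock_vec where
  "fock_vacuum = (\<lambda>n x. if n = 0 then 1 else 0)"

definition fock_creation :: "(real \<Rightarrow> complex) \<Rightarrow> fock_vec \<Rightarrow> fock_vec" where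
  "fock_creation h \<xi> n x =
     (case n of 0 \<Rightarrow> 0 | Suc m \<Rightarrow> h (x 0) * \<xi> m (\<lambda>i\<in>{..<m}. x (Suc i)))"

(* Linear in the first argument. *)
definition fock_form :: "(real \<Rightarrow> real \<Rightarrow> real) \<Rightarrow> fock_vec \<Rightarrow> fock_vec \<Rightarrow> complex" where
  "fock_form w \<xi> \<eta> = (\<Sum>n | \<xi> n \<noteq> (\<lambda>_. 0). L2_inner n (\<xi> n) (twist_sum w n (\<eta> n)))"

definition fock_kernel :: "(real \<Rightarrow> real \<Rightarrow> real) \<Rightarrow> fock_vec set" where
  "fock_kernel w = {\<xi> \<in> fock_alg. \<forall>\<eta>\<in>fock_alg. fock_form w \<xi> \<eta> = 0}"

definition fock_rel :: "(real \<Rightarrow> real \<Rightarrow> real) \<Rightarrow> (fock_vec \<times> fock_vec) set" where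
  "fock_rel w = {(\<xi>, \<eta>). \<xi> \<in> fock_alg \<and> \<eta> \<in> fock_alg \<and> (\<lambda>n x. \<xi> n x - \<eta> n x) \<in> fock_kernel w}"

(* The image of the algebraic Fock space in its completion for the twisted form.  This quotient
   also identifies representatives that agree almost everywhere. *)
definition fock_space :: "(real \<Rightarrow> real \<Rightarrow> real) \<Rightarrow> fock_vec set set" where
  "fock_space w = fock_alg // fock_rel w"

definition fock_inner :: "(real \<Rightarrow> real \<Rightarrow> real) \<Rightarrow> fock_vec set \<Rightarrow> fock_vec set \<Rightarrow> complex" where
  "fock_inner w X Y = the_elem (\<Union>\<xi>\<in>X. \<Union>\<eta>\<in>Y. {fock_form w \<xi> \<eta>})"

definition fock_add ::
  "(real \<Rightarrow> real \<Rightarrow> real) \<Rightarrow> fock_vec set \<Rightarrow> fock_vec set \<Rightarrow> fock_vec set" where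
  "fock_add w X Y = (\<Union>\<xi>\<in>X. \<Union>\<eta>\<in>Y. fock_rel w `` {\<lambda>n x. \<xi> n x + \<eta> n x})"

definition vacuum :: "(real \<Rightarrow> real \<Rightarrow> real) \<Rightarrow> fock_vec set" where
  "vacuum w = fock_rel w `` {fock_vacuum}"

definition creation ::
  "(real \<Rightarrow> real \<Rightarrow> real) \<Rightarrow> (real \<Rightarrow> complex) \<Rightarrow> fock_vec set \<Rightarrow> fock_vec set" where
  "creation w h X = (\<Union>\<xi>\<in>X. fock_rel w `` {fock_creation h \<xi>})"

(* At most one map satisfies this description, since the form is nondegenerate on the quotient. *)
definition fock_adjoint :: "(real \<Rightarrow> real \<Rightarrow> real) \<Rightarrow>
    (fock_vec set \<Rightarrow> fock_vec set) \<Rightarrow> fock_vec set \<Rightarrow> fock_vec set" where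
  "fock_adjoint w C = (THE S. S \<in> fock_space w \<rightarrow>\<^sub>E fock_space w \<and>
     (\<forall>X\<in>fock_space w. \<forall>Y\<in>fock_space w. fock_inner w (C X) Y = fock_inner w X (S Y)))"

definition field_op ::
  "(real \<Rightarrow> real \<Rightarrow> real) \<Rightarrow> (real \<Rightarrow> complex) \<Rightarrow> fock_vec set \<Rightarrow> fock_vec set" where
  "field_op w h X = fock_add w (creation w h X) (fock_adjoint w (creation w h) X)"

definition vacuum_state ::
  "(real \<Rightarrow> real \<Rightarrow> real) \<Rightarrow> (fock_vec set \<Rightarrow> fock_vec set) \<Rightarrow> complex" where
  "vacuum_state w B = fock_inner w (B (vacuum w)) (vacuum w)"

section \<open>Pair partitions and the measures\<close>

definition pair_partitions :: "nat \<Rightarrow> nat set set set" where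
  "pair_partitions p = {\<pi>. partition_on {1..p} \<pi> \<and> (\<forall>B\<in>\<pi>. card B = 2)}"

definition crossing :: "nat set \<Rightarrow> nat set \<Rightarrow> bool" where
  "crossing B C \<longleftrightarrow> (\<exists>i k j l. i < k \<and> k < j \<and> j < l \<and>
     ({i, j} \<subseteq> B \<and> {k, l} \<subseteq> C \<or> {i, j} \<subseteq> C \<and> {k, l} \<subseteq> B))"

definition crossing_edges :: "nat set set \<Rightarrow> nat set set set" where
  "crossing_edges \<pi> = {{u, v} | u v. u \<in> \<pi> \<and> v \<in> \<pi> \<and> u \<noteq> v \<and> crossing u v}"

(* The value w (x u) (x v) of an unordered edge {u, v}; both orderings give the same number
   when w is symmetric. *)
definition edge_weight ::
  "(real \<Rightarrow> real \<Rightarrow> real) \<Rightarrow> (nat set \<Rightarrow> real) \<Rightarrow> nat set set \<Rightarrow> real" where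
  "edge_weight w x e = the_elem {w (x u) (x v) | u v. e = {u, v}}"

definition pairing_moment :: "(real \<Rightarrow> real \<Rightarrow> real) \<Rightarrow> (real \<Rightarrow> complex) \<Rightarrow> nat \<Rightarrow> real" where
  "pairing_moment w h p = (\<Sum>\<pi>\<in>pair_partitions p.
     (LINT x|cube \<pi>. (\<Prod>u\<in>\<pi>. (cmod (h (x u)))\<^sup>2) * (\<Prod>e\<in>crossing_edges \<pi>. edge_weight w x e)))"

(* M is the measure mu_{w,h}. *)
definition is_mu :: "(real \<Rightarrow> real \<Rightarrow> real) \<Rightarrow> (real \<Rightarrow> complex) \<Rightarrow> real measure \<Rightarrow> bool" where
  "is_mu w h M \<longleftrightarrow> real_distribution M \<and>
     (\<forall>p\<ge>1. integrable M (\<lambda>t. t ^ p) \<and> (LINT t|M. t ^ p) = pairing_moment w h p)"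

(* M is a law of the possibly unbounded operator B in the sense of noncommutative probability:
   the moments of M are those of B in the vacuum state. *)
definition has_law ::
  "(real \<Rightarrow> real \<Rightarrow> real) \<Rightarrow> (fock_vec set \<Rightarrow> fock_vec set) \<Rightarrow> real measure \<Rightarrow> bool" where
  "has_law w B M \<longleftrightarrow> real_distribution M \<and>
     (\<forall>p. integrable M (\<lambda>t. t ^ p) \<and>
          vacuum_state w (B ^^ p) = complex_of_real (LINT t|M. t ^ p))"

end

theory Submission
  imports Defs
begin

text \<open>
  For a reduced word of \<sigma>, the operator \<phi>(\<sigma>) multiplies f(x \<circ> \<sigma>) by the product of w over the
  inversions of \<sigma>. Sorting the permutations of n + 1 points by the position of the point 0 gives
  P(n+1) = (1 \<otimes> P(n)) R with R = 1 + T(1) + T(1)T(2) + ... + T(1)...T(n), so the adjoint of the creation operator is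
  R followed by contraction of the first coordinate with h.

  Hence A(h)^q \<Omega> is a sum over partial matchings of {1..q}: at each time a new particle is created in
  front, or one of the existing particles is annihilated and picks up a factor w for each particle
  in front of it. These particles were created later and are annihilated later, so the factors are
  those of the crossings. The sum is controlled by induction on q, integrating the n-particle component
  against the conjugate of h \<otimes> ... \<otimes> h times a bounded function.
\<close>

section \<open>Inversions and reduced words\<close>

text \<open>The induction on q closes because one class of test functions, the conjugate of h
  tensored n times multiplied by a bounded function g, is preserved when either half of the field
  operator is transposed onto it. Transposed creation meets one conjugate factor with its own h and
  integrates the front coordinate of g against |h|^2. Transposed annihilation at position k inserts
  a coordinate: the contraction brings the conjugate h that the larger product needs, and k kernel
  factors of modulus at most 1 are absorbed in g. Thus every particle, annihilated or not, weighs
  |h|^2, and pointwise formulas for the components are avoided.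

  The measure-theoretic obstacle is that w and the vectors are only Lebesgue measurable, while
  Fubini is used on uncompleted products. All integrals are therefore computed with versions of the
  kernel and of the vectors. Kernels equal almost everywhere on the square may differ on the whole
  diagonal, so the transfer relies on evaluating them only at pairs of different coordinates, as is
  the case for inversions and for crossings of distinct blocks.\<close>

definition invs :: "nat \<Rightarrow> (nat \<Rightarrow> nat) \<Rightarrow> (nat \<times> nat) set" where
  "invs n \<sigma> = {(j, k). j < k \<and> k < n \<and> \<sigma> k < \<sigma> j}"

lemma finite_invs [simp]: "finite (invs n \<sigma>)"
  by (rule finite_subset[of _ "{..<n} \<times> {..<n}"]) (auto simp: invs_def)

lemma invs_id [simp]: "invs n id = {}" "invs n (\<lambda>i. i) = {}"
  by (auto simp: invs_def)

text \<open>The kernel is a parameter: the formula is matched with reduced words for the original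
  kernel, and integrated for a measurable version of it.\<close>

definition perm_op :: "(real \<Rightarrow> real \<Rightarrow> real) \<Rightarrow> nat \<Rightarrow> (nat \<Rightarrow> nat) \<Rightarrow>
    ((nat \<Rightarrow> real) \<Rightarrow> complex) \<Rightarrow> (nat \<Rightarrow> real) \<Rightarrow> complex" where
  "perm_op v n \<sigma> f x = (\<Prod>(j, k)\<in>invs n \<sigma>. complex_of_real (v (x (\<sigma> j)) (x (\<sigma> k)))) * f (x \<circ> \<sigma>)"

lemma word_perm_Nil: "word_perm [] = id"
  and word_perm_Cons: "word_perm (i # is) = Transposition.transpose i (Suc i) \<circ> word_perm is"
  by (simp_all add: word_perm_def)

lemma word_perm_permutes:
  "\<forall>i\<in>set is. Suc i < n \<Longrightarrow> word_perm is permutes {..<n}"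
  by (induction "is") (auto simp: word_perm_Nil word_perm_Cons permutes_id intro!: permutes_compose permutes_swap_id)

text \<open>The transposition exchanges the values \<open>i\<close> and \<open>Suc i\<close>, and no
  value lies strictly between them, so the comparison at the pair \<open>(j0, k0)\<close> is the
  only one that changes.\<close>

lemma invs_transpose:
  assumes "\<sigma> permutes {..<n}" "Suc i < n" "\<sigma> j0 = i" "\<sigma> k0 = Suc i" "j0 < k0"
  shows "invs n (Transposition.transpose i (Suc i) \<circ> \<sigma>) = insert (j0, k0) (invs n \<sigma>)"
    and "(j0, k0) \<notin> invs n \<sigma>"
proof -
  have inj: "\<sigma> a = \<sigma> b \<longleftrightarrow> a = b" for a b
    using permutes_inj[OF assms(1)] by (auto simp: inj_def)
  have k0: "k0 < n"
    using assms(1,2,4) permutes_in_image[OF assms(1), of k0] by auto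
  have i: "\<sigma> a = i \<longleftrightarrow> a = j0" "\<sigma> a = Suc i \<longleftrightarrow> a = k0" for a
    using inj[of a j0] inj[of a k0] assms by auto
  have t: "Transposition.transpose i (Suc i) u < Transposition.transpose i (Suc i) v \<longleftrightarrow>
      \<not> (u = i \<and> v = Suc i) \<and> (u < v \<or> u = Suc i \<and> v = i)" for u v
    by (auto simp: Transposition.transpose_def)
  have "(a, b) \<in> invs n (Transposition.transpose i (Suc i) \<circ> \<sigma>) \<longleftrightarrow>
      (a, b) \<in> insert (j0, k0) (invs n \<sigma>)" for a b
  proof -
    have "\<sigma> b < \<sigma> a \<and> b = j0 \<longrightarrow> a \<noteq> k0 \<or> \<not> a < b"
      using assms(5) by auto
    then show ?thesis
      using assms(5) k0 by (auto simp: invs_def t i)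
  qed
  then show "invs n (Transposition.transpose i (Suc i) \<circ> \<sigma>) = insert (j0, k0) (invs n \<sigma>)"
    by auto
  show "(j0, k0) \<notin> invs n \<sigma>"
    using assms by (auto simp: invs_def)
qed

text \<open>The values \<open>i\<close> and \<open>Suc i\<close> occur in one of two orders. The
  transposition is an involution, so the second order is the first one for the transposed
  permutation; this is why \<open>down\<close> describes the inversions of \<open>\<sigma>\<close>
  through those of the composite.\<close>

lemma invs_transpose_cases:
  assumes "\<sigma> permutes {..<n}" "Suc i < n"
  obtains (up) j0 k0 where "j0 < k0" "\<sigma> j0 = i" "\<sigma> k0 = Suc i"
      "invs n (Transposition.transpose i (Suc i) \<circ> \<sigma>) = insert (j0, k0) (invs n \<sigma>)"
      "(j0, k0) \<notin> invs n \<sigma>"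
    | (down) j0 k0 where "j0 < k0" "\<sigma> j0 = Suc i" "\<sigma> k0 = i"
      "invs n \<sigma> = insert (j0, k0) (invs n (Transposition.transpose i (Suc i) \<circ> \<sigma>))"
      "(j0, k0) \<notin> invs n (Transposition.transpose i (Suc i) \<circ> \<sigma>)"
proof -
  obtain a b where ab: "\<sigma> a = i" "\<sigma> b = Suc i"
    using permutes_surj[OF assms(1)] by (metis surjD)
  show ?thesis
  proof (cases "a < b")
    case True
    then show ?thesis
      using up[of a b] ab invs_transpose[OF assms ab True] by auto
  next
    case False
    with ab have "b < a"
      by (cases "a = b") auto
    have p: "Transposition.transpose i (Suc i) \<circ> \<sigma> permutes {..<n}"
      using assms by (intro permutes_compose permutes_swap_id) auto
    have "Transposition.transpose i (Suc i) \<circ> (Transposition.transpose i (Suc i) \<circ> \<sigma>) = \<sigma>"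
      by (auto simp: fun_eq_iff)
    with \<open>b < a\<close> show ?thesis
      using down[of b a] ab invs_transpose[OF p assms(2), of b a] by auto
  qed
qed

text \<open>A letter adds or removes one inversion, so no word is shorter than the number of
  inversions. With \<open>ex_word\<close>, the reduced words of a permutation are exactly its words
  of that length.\<close>

lemma card_invs_word_perm:
  "\<forall>i\<in>set is. Suc i < n \<Longrightarrow> card (invs n (word_perm is)) \<le> length is"
proof (induction "is")
  case (Cons i "is")
  then have IH: "card (invs n (word_perm is)) \<le> length is" and "Suc i < n"
    by auto
  have p: "word_perm is permutes {..<n}"
    using Cons by (intro word_perm_permutes) auto
  have "length (i # is) = Suc (length is)" by simp
  note IH = IH this
  from p \<open>Suc i < n\<close> show ?case
  proof (cases rule: invs_transpose_cases)
    case (up j0 k0)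
    then have "card (invs n (word_perm (i # is))) = Suc (card (invs n (word_perm is)))"
      unfolding word_perm_Cons up(4) by (subst card_insert_disjoint) auto
    then show ?thesis using IH by linarith
  next
    case (down j0 k0)
    then have "card (invs n (word_perm (i # is))) \<le> card (invs n (word_perm is))"
      unfolding word_perm_Cons down(4) by (intro card_mono) auto
    then show ?thesis using IH by linarith
  qed
qed (simp add: word_perm_Nil)

lemma permutes_mono_id:
  fixes n :: nat
  assumes p: "\<sigma> permutes {..<n}"
    and mono: "\<And>j. Suc j < n \<Longrightarrow> \<sigma> j < \<sigma> (Suc j)"
  shows "\<sigma> = id"
proof -
  have ge: "j < n \<Longrightarrow> j \<le> \<sigma> j" for j
  proof (induction j)
    case (Suc j)
    then show ?case using mono[of j] by simp
  qed simp
  \<comment> \<open>Downward induction from the last position, with \<open>n - Suc j\<close> running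
    through the positions.\<close>
  have *: "j < n \<Longrightarrow> \<sigma> (n - Suc j) \<le> n - Suc j" for j
  proof (induction j)
    case 0
    then show ?case using permutes_in_image[OF p, of "n - 1"] by auto
  next
    case (Suc j)
    then have "Suc (n - Suc (Suc j)) = n - Suc j" by simp
    with Suc mono[of "n - Suc (Suc j)"] show ?case by simp
  qed
  have "\<sigma> j \<le> j" if "j < n" for j
    using *[of "n - Suc j"] that by (simp add: Suc_diff_Suc)
  with ge have "\<sigma> j = j" if "j < n" for j
    using that by (simp add: order_antisym)
  moreover have "\<sigma> j = j" if "\<not> j < n" for j
    using permutes_not_in[OF p] that by simp
  ultimately show ?thesis by (metis eq_id_iff)
qed

text \<open>Bubble sort: each step strips off an adjacent transposition that accounts for one
  inversion.\<close>

lemma ex_word: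
  assumes "\<sigma> permutes {..<n}"
  shows "\<exists>is. is_word n \<sigma> is \<and> length is = card (invs n \<sigma>)"
  using assms
proof (induction "card (invs n \<sigma>)" arbitrary: \<sigma>)
  case (0 \<sigma>)
  then have e: "invs n \<sigma> = {}" by simp
  have "\<sigma> = id"
  proof (rule permutes_mono_id[OF 0(2)])
    fix j assume "Suc j < n"
    moreover have "\<sigma> j \<noteq> \<sigma> (Suc j)"
      using permutes_inj[OF 0(2)] by (metis injD n_not_Suc_n)
    moreover have "(j, Suc j) \<notin> invs n \<sigma>" using e by simp
    ultimately show "\<sigma> j < \<sigma> (Suc j)" by (auto simp: invs_def)
  qed
  then show ?case
    using e by (intro exI[of _ "[]"]) (simp add: is_word_def word_perm_Nil id_def \<open>\<sigma> = id\<close>)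
next
  case (Suc m \<sigma>)
  \<comment> \<open>The descent is one of the inverse because the transpositions act from the left,
    on values: the value \<open>Suc i\<close> has to stand to the left of the value
    \<open>i\<close>.\<close>
  have "\<exists>i. Suc i < n \<and> inv \<sigma> (Suc i) < inv \<sigma> i"
  proof (rule ccontr)
    assume *: "\<not> ?thesis"
    have p: "inv \<sigma> permutes {..<n}" by (rule permutes_inv[OF Suc.prems])
    have "inv \<sigma> = id"
    proof (rule permutes_mono_id[OF p])
      fix j assume "Suc j < n"
      moreover have "inv \<sigma> j \<noteq> inv \<sigma> (Suc j)"
        using permutes_inj[OF p] by (metis injD n_not_Suc_n)
      ultimately show "inv \<sigma> j < inv \<sigma> (Suc j)" using * by (metis linorder_neqE_nat)
    qed
    then have "\<sigma> = id"
      using permutes_inv_inv[OF Suc.prems] by simp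
    then show False using Suc.hyps(2) by simp
  qed
  then obtain i where i: "Suc i < n" "inv \<sigma> (Suc i) < inv \<sigma> i" by auto
  let ?t = "Transposition.transpose i (Suc i) \<circ> \<sigma>"
  have t: "?t permutes {..<n}"
    using i Suc.prems by (intro permutes_compose permutes_swap_id) auto
  from Suc.prems i(1) have "m = card (invs n ?t)"
  proof (cases rule: invs_transpose_cases)
    case (up j0 k0)
    have "inv \<sigma> i = j0" "inv \<sigma> (Suc i) = k0"
      using permutes_inv_eq[OF Suc.prems] up(2,3) by metis+
    then show ?thesis using up(1) i(2) by simp
  next
    case down
    then show ?thesis using Suc.hyps(2) by simp
  qed
  from Suc.hyps(1)[OF this t] obtain "is" where "is": "is_word n ?t is" "length is = card (invs n ?t)"
    by blast
  have "Transposition.transpose i (Suc i) \<circ> ?t = \<sigma>" by (auto simp: fun_eq_iff)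
  with "is" i have "is_word n \<sigma> (i # is)"
    by (simp add: is_word_def word_perm_Cons)
  moreover have "length (i # is) = card (invs n \<sigma>)"
    using "is" \<open>m = card (invs n ?t)\<close> Suc.hyps(2) by simp
  ultimately show ?case by blast
qed

text \<open>The length condition makes the word reduced, so every letter creates exactly one
  inversion and each kernel factor is produced once. \<open>x\<close> is generalised because a twist
  evaluates the rest of the word at transposed coordinates.\<close>

lemma fold_twist_at:
  assumes sym: "\<And>a b. a \<in> {0..1} \<Longrightarrow> b \<in> {0..1} \<Longrightarrow> w a b = w b a"
  shows "\<forall>i\<in>set is. Suc i < n \<Longrightarrow> length is = card (invs n (word_perm is)) \<Longrightarrow>
    \<forall>i<n. x i \<in> {0..1} \<Longrightarrow> foldr (twist_at w) is f x = perm_op w n (word_perm is) f x"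
proof (induction "is" arbitrary: x)
  case Nil
  then show ?case by (simp add: perm_op_def word_perm_Nil id_def comp_def)
next
  case (Cons i "is")
  let ?t = "Transposition.transpose i (Suc i)" and ?s = "word_perm is"
  have w: "\<forall>i\<in>set is. Suc i < n" and i: "Suc i < n"
    using Cons.prems by auto
  have p: "?s permutes {..<n}"
    using w by (intro word_perm_permutes) auto
  have le: "card (invs n ?s) \<le> length is"
    using w by (rule card_invs_word_perm)
  from p i show ?case
  proof (cases rule: invs_transpose_cases)
    case (up j0 k0)
    then have len: "length is = card (invs n ?s)"
      using Cons.prems(2) up(5) unfolding word_perm_Cons up(4) by simp
    have eq: "x(i := x (Suc i), Suc i := x i) = x \<circ> ?t"
      by (auto simp: fun_eq_iff Transposition.transpose_def)
    have "(x \<circ> ?t) j \<in> {0..1}" if "j < n" for j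
      using Cons.prems(3) that i unfolding comp_def Transposition.transpose_def
      by (metis Suc_lessD)
    then have IH: "foldr (twist_at w) is f (x \<circ> ?t) = perm_op w n ?s f (x \<circ> ?t)"
      using Cons.IH[OF w len] by blast
    have "foldr (twist_at w) (i # is) f x = complex_of_real (w (x i) (x (Suc i))) * perm_op w n ?s f (x \<circ> ?t)"
      using IH by (simp add: twist_at_def twist_def eq)
    \<comment> \<open>The new inversion lists the two coordinates in the order opposite to that of
      the twist, hence the appeal to symmetry, which is known on the unit interval only.\<close>
    also have "\<dots> = perm_op w n (?t \<circ> ?s) f x"
      using up sym[of "x i" "x (Suc i)"] Cons.prems(3) i
      by (simp add: perm_op_def o_assoc prod.insert)
    finally show ?thesis unfolding word_perm_Cons .
  next
    case (down j0 k0)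
    \<comment> \<open>A letter that removes an inversion would leave fewer inversions than
      letters.\<close>
    then have "card (invs n ?s) = Suc (card (invs n (?t \<circ> ?s)))" by simp
    then show ?thesis
      using le Cons.prems(2) unfolding word_perm_Cons list.size by linarith
  qed
qed

text \<open>By \<open>card_invs_word_perm\<close> and \<open>ex_word\<close> the chosen word has as
  many letters as there are inversions, so the choice of a word is eliminated here, pointwise and
  without null sets.\<close>

lemma twist_perm_eq_perm_op:
  assumes sym: "\<And>a b. a \<in> {0..1} \<Longrightarrow> b \<in> {0..1} \<Longrightarrow> w a b = w b a"
    and p: "\<sigma> permutes {..<n}" and x: "\<forall>i<n. x i \<in> {0..1}"
  shows "twist_perm w n \<sigma> f x = perm_op w n \<sigma> f x"
proof -
  obtain js where js: "is_word n \<sigma> js" "length js = card (invs n \<sigma>)"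
    using ex_word[OF p] by auto
  have len: "card (invs n \<sigma>) \<le> length is" if "is_word n \<sigma> is" for "is"
    using card_invs_word_perm that by (auto simp: is_word_def)
  define ks where "ks = (SOME is. reduced_word n \<sigma> is)"
  have "reduced_word n \<sigma> js"
    using js len by (auto simp: reduced_word_def)
  then have ks: "reduced_word n \<sigma> ks"
    unfolding ks_def by (rule someI)
  then have "is_word n \<sigma> ks" "length ks = card (invs n \<sigma>)"
    using js len[of ks] by (auto simp: reduced_word_def intro: order_antisym)
  then show ?thesis
    using fold_twist_at[of w ks n x f, OF sym] x
    by (simp add: twist_perm_def ks_def[symmetric] is_word_def)
qed

section \<open>Inserting a coordinate\<close>

definition ins :: "nat \<Rightarrow> 'a \<Rightarrow> (nat \<Rightarrow> 'a) \<Rightarrow> nat \<Rightarrow> 'a" where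
  "ins k y z = (\<lambda>j. if j < k then z j else if j = k then y else z (j - 1))"

text \<open>The restriction keeps the result extensional, hence a point of the n-dimensional
  cube.\<close>

definition del :: "nat \<Rightarrow> nat \<Rightarrow> (nat \<Rightarrow> 'a) \<Rightarrow> nat \<Rightarrow> 'a" where
  "del n k x = (\<lambda>j\<in>{..<n}. x (if j < k then j else Suc j))"

lemma ins_same [simp]: "ins k y z k = y"
  by (simp add: ins_def)

lemma ins_less [simp]: "j < k \<Longrightarrow> ins k y z j = z j"
  by (simp add: ins_def)

lemma comp_ins: "x \<circ> ins k y z = ins k (x y) (x \<circ> z)"
  by (auto simp: ins_def)

lemma del_ins [simp]: "z \<in> extensional {..<n} \<Longrightarrow> del n k (ins k y z) = z"
  by (auto simp: del_def ins_def fun_eq_iff extensional_def)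

text \<open>The permutations that send position \<open>k\<close> to 0. With S_n acting on the values
  1, ..., n, the cycles \<open>perm_ext k id\<close> are the coset representatives behind R.\<close>

definition perm_ext :: "nat \<Rightarrow> (nat \<Rightarrow> nat) \<Rightarrow> nat \<Rightarrow> nat" where
  "perm_ext k \<tau> = ins k 0 (Suc \<circ> \<tau>)"

lemma perm_ext_up: "perm_ext k \<tau> (if j < k then j else Suc j) = Suc (\<tau> j)"
  by (simp add: perm_ext_def ins_def)

lemma perm_ext_permutes:
  assumes "\<tau> permutes {..<n}" "k \<le> n"
  shows "perm_ext k \<tau> permutes {..<Suc n}"
proof (rule bij_imp_permutes)
  have lt: "\<tau> j < n \<longleftrightarrow> j < n" for j
    using permutes_in_image[OF assms(1), of j] by simp
  have inj: "\<tau> a = \<tau> b \<longleftrightarrow> a = b" for a b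
    using permutes_inj[OF assms(1)] by (auto simp: inj_def)
  have "inj_on (perm_ext k \<tau>) {..<Suc n}"
    by (auto simp: inj_on_def perm_ext_def ins_def inj split: if_splits)
  moreover have "perm_ext k \<tau> ` {..<Suc n} \<subseteq> {..<Suc n}"
    using assms(2) by (auto simp: perm_ext_def ins_def lt)
  ultimately show "bij_betw (perm_ext k \<tau>) {..<Suc n} {..<Suc n}"
    by (simp add: bij_betw_def endo_inj_surj)
  show "perm_ext k \<tau> x = x" if "x \<notin> {..<Suc n}" for x
    using that assms permutes_not_in[OF assms(1), of "x - 1"] by (auto simp: perm_ext_def ins_def)
qed

text \<open>The position of the value 0 recovers \<open>k\<close>, and the other values recover
  \<open>\<tau>\<close>. Surjectivity is by counting, (n + 1) n! = (n + 1)!.\<close>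

lemma bij_betw_perm_ext:
  "bij_betw (\<lambda>(\<tau>, k). perm_ext k \<tau>) ({\<tau>. \<tau> permutes {..<n}} \<times> {..n}) {\<sigma>. \<sigma> permutes {..<Suc n}}"
proof -
  let ?A = "{\<tau>. \<tau> permutes {..<n}} \<times> {..n}" and ?B = "{\<sigma>. \<sigma> permutes {..<Suc n}}"
    and ?f = "\<lambda>(\<tau>, k). perm_ext k \<tau>"
  have z: "perm_ext k \<tau> j = 0 \<longleftrightarrow> j = k" for k \<tau> j
    by (auto simp: perm_ext_def ins_def)
  have "inj_on ?f ?A"
  proof (rule inj_onI)
    fix a b assume "?f a = ?f b"
    moreover obtain \<tau> k \<tau>' k' where ab: "a = (\<tau>, k)" "b = (\<tau>', k')" by fastforce
    ultimately have e: "perm_ext k \<tau> = perm_ext k' \<tau>'" by simp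
    then have k: "k = k'" using z by metis
    have "\<tau> j = \<tau>' j" for j
      using fun_cong[OF e, of "if j < k then j else Suc j"] unfolding k perm_ext_up by simp
    with k ab show "a = b" by auto
  qed
  moreover have "?f ` ?A \<subseteq> ?B"
    by (auto simp: perm_ext_permutes)
  moreover have "card ?A = card ?B"
    by (simp add: card_cartesian_product card_permutations[OF refl])
  moreover have "finite ?B"
    by (simp add: finite_permutations)
  ultimately show ?thesis
    unfolding bij_betw_def by (metis card_image card_subset_eq)
qed

text \<open>The least value 0 at position \<open>k\<close> is inverted with the \<open>k\<close>
  positions before it and with none after it; all other pairs compare as under
  \<open>\<tau>\<close>, after skipping position \<open>k\<close>.\<close>

lemma invs_perm_ext:
  assumes "k \<le> n"
  shows "invs (Suc n) (perm_ext k \<tau>) = (\<lambda>j. (j, k)) ` {..<k} \<union>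
      map_prod (\<lambda>j. if j < k then j else Suc j) (\<lambda>j. if j < k then j else Suc j) ` invs n \<tau>"
    (is "_ = ?A \<union> ?m ` _")
proof -
  let ?u = "\<lambda>j. if j < k then j else Suc j"
  have "(a, b) \<in> ?A \<union> ?m ` invs n \<tau>" if ab: "(a, b) \<in> invs (Suc n) (perm_ext k \<tau>)" for a b
  proof (cases "b = k")
    case False
    have "a \<noteq> k" using ab by (auto simp: invs_def perm_ext_def)
    define a' b' where "a' = (if a < k then a else a - 1)" and "b' = (if b < k then b else b - 1)"
    have a': "a = ?u a'" and b': "b = ?u b'"
      using \<open>a \<noteq> k\<close> False by (auto simp: a'_def b'_def)
    have "(a', b') \<in> invs n \<tau>"
      using ab assms unfolding a' b' invs_def by (auto simp: perm_ext_up split: if_splits)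
    then show ?thesis using a' b' by (intro UnI2 image_eqI[of _ _ "(a', b')"]) auto
  next
    case True
    then show ?thesis using ab by (auto simp: invs_def)
  qed
  moreover have "?A \<subseteq> invs (Suc n) (perm_ext k \<tau>)"
    using assms by (auto simp: invs_def perm_ext_def)
  moreover have "?m ` invs n \<tau> \<subseteq> invs (Suc n) (perm_ext k \<tau>)"
    by (auto simp: invs_def perm_ext_def ins_def split: if_splits)
  ultimately show ?thesis by auto
qed

text \<open>This is T(1)...T(k) f at the point with first coordinate \<open>y\<close> followed by
  \<open>z\<close>: the twists carry \<open>y\<close> to position \<open>k\<close>, past
  \<open>k\<close> coordinates.\<close>

definition front_op :: "(real \<Rightarrow> real \<Rightarrow> real) \<Rightarrow> nat \<Rightarrow> real \<Rightarrow>
    ((nat \<Rightarrow> real) \<Rightarrow> complex) \<Rightarrow> (nat \<Rightarrow> real) \<Rightarrow> complex" where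
  "front_op v k y f z = (\<Prod>j<k. complex_of_real (v (z j) y)) * f (ins k y z)"

text \<open>The pointwise form of \<phi>(perm_ext k \<tau>) = (1 \<otimes> \<phi>(\<tau>))
  T(1)...T(k); the two kinds of inversions in \<open>invs_perm_ext\<close> give the two
  operators.\<close>

lemma perm_op_perm_ext:
  assumes \<tau>: "\<tau> permutes {..<n}" and "k \<le> n" and x: "x \<in> extensional {..<Suc n}"
  shows "perm_op v (Suc n) (perm_ext k \<tau>) f x = perm_op v n \<tau> (front_op v k (x 0) f) (del n 0 x)"
proof -
  let ?u = "\<lambda>j. if j < k then j else Suc j" and ?z = "del n 0 x"
  let ?g = "\<lambda>(j, l). complex_of_real (v (x (perm_ext k \<tau> j)) (x (perm_ext k \<tau> l)))"
  have z: "?z (\<tau> j) = x (Suc (\<tau> j))" for j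
    using permutes_in_image[OF \<tau>, of j] permutes_not_in[OF \<tau>, of j] x
    by (cases "j < n") (auto simp: del_def extensional_def)
  have "prod ?g (invs (Suc n) (perm_ext k \<tau>)) =
      prod ?g ((\<lambda>j. (j, k)) ` {..<k}) * prod ?g (map_prod ?u ?u ` invs n \<tau>)"
    unfolding invs_perm_ext[OF \<open>k \<le> n\<close>]
    by (rule prod.union_disjoint) (auto split: if_splits)
  also have "prod ?g ((\<lambda>j. (j, k)) ` {..<k}) = (\<Prod>j<k. complex_of_real (v (?z (\<tau> j)) (x 0)))"
    by (subst prod.reindex) (auto simp: inj_on_def z perm_ext_def)
  also have "prod ?g (map_prod ?u ?u ` invs n \<tau>) =
      (\<Prod>(j, l)\<in>invs n \<tau>. complex_of_real (v (?z (\<tau> j)) (?z (\<tau> l))))"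
    by (subst prod.reindex) (auto simp: inj_on_def z perm_ext_def ins_def intro!: prod.cong split: if_splits)
  moreover have "x \<circ> perm_ext k \<tau> = ins k (x 0) (?z \<circ> \<tau>)"
    unfolding perm_ext_def comp_ins by (rule arg_cong[where f="ins k (x 0)"]) (auto simp: z)
  ultimately show ?thesis
    by (simp add: perm_op_def front_op_def)
qed

section \<open>Lebesgue measure on the cube\<close>

abbreviation U :: "real measure" where "U \<equiv> lebesgue_on {0..1}"

abbreviation prod_cube :: "nat \<Rightarrow> (nat \<Rightarrow> real) measure" where
  "prod_cube n \<equiv> Pi\<^sub>M {..<n} (\<lambda>_. U)"

lemma prob_space_U [simp]: "prob_space U"
  by (rule prob_spaceI) (simp add: emeasure_restrict_space)

interpretation U: prob_space U
  by (rule prob_space_U)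

interpretation PU: product_prob_space "\<lambda>_. U" I for I :: "'i set"
  by unfold_locales

lemma measurable_comp_perm:
  assumes "\<sigma> permutes {..<n}"
  shows "(\<lambda>x. x \<circ> \<sigma>) \<in> prod_cube n \<rightarrow>\<^sub>M prod_cube n"
proof (rule measurable_PiM_single')
  have lt: "\<sigma> j < n \<longleftrightarrow> j < n" for j
    using permutes_in_image[OF assms, of j] by simp
  show "(\<lambda>x. (x \<circ> \<sigma>) i) \<in> prod_cube n \<rightarrow>\<^sub>M U" if "i \<in> {..<n}" for i
    using that lt by simp
  show "(\<lambda>x. x \<circ> \<sigma>) \<in> space (prod_cube n) \<rightarrow> {..<n} \<rightarrow>\<^sub>E space U"
    using lt permutes_not_in[OF assms] by (fastforce simp: space_PiM PiE_iff extensional_def)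
qed

lemma distr_comp_perm:
  assumes "\<sigma> permutes {..<n}"
  shows "distr (prod_cube n) (prod_cube n) (\<lambda>x. x \<circ> \<sigma>) = prod_cube n"
proof -
  have "distr (prod_cube n) (prod_cube n) (\<lambda>x. x \<circ> \<sigma>) =
      distr (prod_cube n) (prod_cube n) (\<lambda>x. \<lambda>j\<in>{..<n}. x (\<sigma> j))"
  proof (rule distr_cong)
    show "x \<circ> \<sigma> = (\<lambda>j\<in>{..<n}. x (\<sigma> j))" if "x \<in> space (prod_cube n)" for x
      using that permutes_not_in[OF assms]
      by (auto simp: fun_eq_iff space_PiM PiE_iff extensional_def)
  qed auto
  also have "\<dots> = prod_cube n"
    using permutes_inj_on[OF assms] permutes_in_image[OF assms]
    by (intro distr_PiM_reindex) auto
  finally show ?thesis .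
qed

lemma integral_comp_perm:
  fixes f :: "(nat \<Rightarrow> real) \<Rightarrow> complex"
  assumes "\<sigma> permutes {..<n}" "f \<in> borel_measurable (prod_cube n)"
  shows "(LINT x|prod_cube n. f (x \<circ> \<sigma>)) = (LINT x|prod_cube n. f x)"
  using integral_distr[OF measurable_comp_perm[OF assms(1)] assms(2)] distr_comp_perm[OF assms(1)]
  by simp

lemma AE_comp_perm:
  assumes "\<sigma> permutes {..<n}" "AE x in prod_cube n. P x"
  shows "AE x in prod_cube n. P (x \<circ> \<sigma>)"
proof (rule AE_distrD[OF measurable_comp_perm[OF assms(1)]])
  show "AE x in distr (prod_cube n) (prod_cube n) (\<lambda>x. x \<circ> \<sigma>). P x"
    unfolding distr_comp_perm[OF assms(1)] by (rule assms(2))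
qed

lemma measurable_ins:
  assumes "k \<le> n"
  shows "(\<lambda>(z, y). ins k y z) \<in> prod_cube n \<Otimes>\<^sub>M U \<rightarrow>\<^sub>M prod_cube (Suc n)"
proof (rule measurable_PiM_single')
  show "(\<lambda>x. (case x of (z, y) \<Rightarrow> ins k y z) i) \<in> prod_cube n \<Otimes>\<^sub>M U \<rightarrow>\<^sub>M U" if "i \<in> {..<Suc n}" for i
  proof -
    have *: "(\<lambda>p. fst p j) \<in> prod_cube n \<Otimes>\<^sub>M U \<rightarrow>\<^sub>M U" if "j < n" for j
      using that by (intro measurable_compose[OF measurable_fst measurable_component_singleton]) simp
    consider "i < k" | "i = k" | "k < i" by linarith
    then show ?thesis
    proof cases
      case 1
      then show ?thesis using *[of i] assms by (simp add: case_prod_unfold ins_def)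
    next
      case 3
      then show ?thesis using *[of "i - 1"] that by (simp add: case_prod_unfold ins_def)
    qed (simp add: case_prod_unfold ins_def)
  qed
  have "ins k y z \<in> {..<Suc n} \<rightarrow>\<^sub>E space U" if "z \<in> {..<n} \<rightarrow>\<^sub>E space U" "y \<in> space U" for y z
  proof (rule PiE_I)
    show "ins k y z i \<in> space U" if "i \<in> {..<Suc n}" for i
      using PiE_mem[OF \<open>z \<in> _\<close>, of i] PiE_mem[OF \<open>z \<in> _\<close>, of "i - 1"] \<open>y \<in> _\<close> that assms
      unfolding ins_def by (cases "i < k"; cases "i = k") auto
    show "ins k y z i = undefined" if "i \<notin> {..<Suc n}" for i
      using PiE_arb[OF \<open>z \<in> _\<close>, of "i - 1"] that assms by (simp add: ins_def)
  qed
  then show "(\<lambda>(z, y). ins k y z) \<in> space (prod_cube n \<Otimes>\<^sub>M U) \<rightarrow> {..<Suc n} \<rightarrow>\<^sub>E space U"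
    unfolding space_pair_measure space_PiM by (intro funcsetI) (simp only: case_prod_unfold mem_Times_iff)
qed

text \<open>Reduces insertion at any position to the last one: the product measure disintegrates
  along \<open>z(n := y)\<close> and is invariant under permutations of coordinates, which together
  give \<open>distr_ins\<close>.\<close>

lemma ins_eq_upd_comp:
  assumes "k \<le> n"
  obtains \<rho> where "\<rho> permutes {..<Suc n}"
    "\<And>(y :: 'a) z. z \<in> extensional {..<n} \<Longrightarrow> ins k y z = z(n := y) \<circ> \<rho>"
proof -
  define \<rho> where "\<rho> j = (if j \<le> n then ins k n id j else j)" for j
  have "inj_on \<rho> {..<Suc n}"
    by (auto simp: inj_on_def \<rho>_def ins_def split: if_splits)
  moreover have "\<rho> ` {..<Suc n} \<subseteq> {..<Suc n}"
    using assms by (auto simp: \<rho>_def ins_def)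
  ultimately have "bij_betw \<rho> {..<Suc n} {..<Suc n}"
    unfolding bij_betw_def using endo_inj_surj[OF finite_lessThan] by metis
  then have "\<rho> permutes {..<Suc n}"
    by (rule bij_imp_permutes) (simp add: \<rho>_def)
  moreover have "ins k y z = z(n := y) \<circ> \<rho>" if "z \<in> extensional {..<n}" for y and z :: "nat \<Rightarrow> 'a"
  proof (rule ext)
    fix j
    \<comment> \<open>Beyond the cube the shift by one is harmless, because all these values are
      \<open>undefined\<close>.\<close>
    have "z i = undefined" if "n \<le> i" for i
      using \<open>z \<in> extensional {..<n}\<close> that by (simp add: extensional_def)
    then show "ins k y z j = (z(n := y) \<circ> \<rho>) j"
      using assms by (simp add: \<rho>_def ins_def) arith
  qed
  ultimately show ?thesis by (rule that)
qed

lemma distr_ins: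
  assumes "k \<le> n"
  shows "distr (prod_cube n \<Otimes>\<^sub>M U) (prod_cube (Suc n)) (\<lambda>(z, y). ins k y z) = prod_cube (Suc n)"
    (is "distr ?P ?C ?f = _")
proof (rule measure_eqI)
  fix A assume "A \<in> sets (distr ?P ?C ?f)"
  then have A: "A \<in> sets ?C" by simp
  obtain \<rho> where \<rho>: "\<rho> permutes {..<Suc n}"
    "\<And>(y :: real) z. z \<in> extensional {..<n} \<Longrightarrow> ins k y z = z(n := y) \<circ> \<rho>"
    using that by (rule ins_eq_upd_comp[OF assms])
  have "emeasure (distr ?P ?C ?f) A = (\<integral>\<^sup>+p. indicator A (?f p) \<partial>?P)"
    using A measurable_ins[OF assms] by (simp add: nn_integral_distr flip: nn_integral_indicator)
  also have "\<dots> = (\<integral>\<^sup>+z. \<integral>\<^sup>+y. indicator A (ins k y z) \<partial>U \<partial>prod_cube n)"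
    using A measurable_ins[OF assms]
    by (subst U.nn_integral_fst[symmetric]) (auto intro!: measurable_compose[OF _ borel_measurable_indicator])
  also have "\<dots> = (\<integral>\<^sup>+z. \<integral>\<^sup>+y. indicator A (z(n := y) \<circ> \<rho>) \<partial>U \<partial>prod_cube n)"
    by (intro nn_integral_cong) (simp add: \<rho>(2) space_PiM PiE_iff del: space_lebesgue_on)
  also have "\<dots> = (\<integral>\<^sup>+x. indicator A (x \<circ> \<rho>) \<partial>prod_cube (Suc n))"
    using A measurable_comp_perm[OF \<rho>(1)] unfolding lessThan_Suc
    by (subst PU.product_nn_integral_insert) (auto simp: lessThan_Suc intro!: measurable_compose[OF _ borel_measurable_indicator])
  also have "\<dots> = emeasure (distr ?C ?C (\<lambda>x. x \<circ> \<rho>)) A"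
    using A measurable_comp_perm[OF \<rho>(1)] by (simp add: nn_integral_distr flip: nn_integral_indicator)
  finally show "emeasure (distr ?P ?C ?f) A = emeasure ?C A"
    by (simp add: distr_comp_perm[OF \<rho>(1)])
qed simp

lemma nn_integral_ins:
  assumes "k \<le> n" "f \<in> borel_measurable (prod_cube (Suc n))"
  shows "(\<integral>\<^sup>+x. f x \<partial>prod_cube (Suc n)) = (\<integral>\<^sup>+z. \<integral>\<^sup>+y. f (ins k y z) \<partial>U \<partial>prod_cube n)"
proof -
  have "(\<integral>\<^sup>+x. f x \<partial>prod_cube (Suc n)) = (\<integral>\<^sup>+p. f (case p of (z, y) \<Rightarrow> ins k y z) \<partial>(prod_cube n \<Otimes>\<^sub>M U))"
    using nn_integral_distr[OF measurable_ins[OF assms(1)], of f] assms(2) by (simp add: distr_ins[OF assms(1)])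
  also have "\<dots> = (\<integral>\<^sup>+z. \<integral>\<^sup>+y. f (ins k y z) \<partial>U \<partial>prod_cube n)"
    by (subst U.nn_integral_fst[symmetric]) (auto intro!: measurable_compose[OF measurable_ins[OF assms(1)] assms(2)])
  finally show ?thesis .
qed

lemma integral_ins:
  fixes f :: "(nat \<Rightarrow> real) \<Rightarrow> complex"
  assumes k: "k \<le> n" and f: "integrable (prod_cube (Suc n)) f"
  shows "(LINT x|prod_cube (Suc n). f x) = (LINT z|prod_cube n. LINT y|U. f (ins k y z))"
proof -
  interpret pair_sigma_finite "prod_cube n" U
    by (intro pair_sigma_finite.intro prob_space_imp_sigma_finite prob_space_PiM) auto
  have i: "integrable (prod_cube n \<Otimes>\<^sub>M U) (\<lambda>(z, y). f (ins k y z))"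
    using integrable_distr[OF measurable_ins[OF k], of f] f
    unfolding distr_ins[OF k] by (simp add: case_prod_unfold)
  have "(LINT x|prod_cube (Suc n). f x) = (LINT p|(prod_cube n \<Otimes>\<^sub>M U). f (case p of (z, y) \<Rightarrow> ins k y z))"
    using integral_distr[OF measurable_ins[OF k], of f] f by (simp add: distr_ins[OF k])
  also have "\<dots> = (LINT z|prod_cube n. LINT y|U. f (ins k y z))"
    using integral_fst[OF i] by (simp add: case_prod_unfold)
  finally show ?thesis .
qed

lemma measurable_del:
  "del n k \<in> prod_cube (Suc n) \<rightarrow>\<^sub>M prod_cube n"
  unfolding del_def by (rule measurable_restrict) auto

section \<open>Square integrable functions\<close>

definition sqint :: "'a measure \<Rightarrow> ('a \<Rightarrow> complex) set" where
  "sqint M = {f \<in> borel_measurable M. integrable M (\<lambda>x. (cmod (f x))\<^sup>2)}"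

lemma sqintD: "f \<in> sqint M \<Longrightarrow> f \<in> borel_measurable M"
  by (simp add: sqint_def)

lemma sqint_iff_nn:
  "f \<in> sqint M \<longleftrightarrow> f \<in> borel_measurable M \<and> (\<integral>\<^sup>+x. ennreal ((cmod (f x))\<^sup>2) \<partial>M) < \<infinity>"
proof -
  have "(\<lambda>x. (cmod (f x))\<^sup>2) \<in> borel_measurable M" if "f \<in> borel_measurable M"
    using that by measurable
  then show ?thesis
    by (simp add: sqint_def integrable_iff_bounded conj_commute cong: conj_cong)
qed

lemma sqint_mult_integrable:
  assumes "f \<in> sqint M" "g \<in> sqint M"
  shows "integrable M (\<lambda>x. f x * g x)"
proof (rule Bochner_Integration.integrable_bound)
  show "integrable M (\<lambda>x. (cmod (f x))\<^sup>2 + (cmod (g x))\<^sup>2)"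
    using assms by (simp add: sqint_def)
  have "cmod (f x) * cmod (g x) \<le> (cmod (f x))\<^sup>2 + (cmod (g x))\<^sup>2" for x
    using sum_squares_bound[of "cmod (f x)" "cmod (g x)"] mult_nonneg_nonneg[OF norm_ge_zero norm_ge_zero, of "f x" "g x"]
    by linarith
  then show "AE x in M. norm (f x * g x) \<le> norm ((cmod (f x))\<^sup>2 + (cmod (g x))\<^sup>2)"
    by (intro AE_I2) (simp add: norm_mult)
  show "(\<lambda>x. f x * g x) \<in> borel_measurable M"
    using assms by (intro borel_measurable_times) (simp_all add: sqint_def)
qed

lemma sqint_dominated:
  assumes "g \<in> sqint M" "f \<in> borel_measurable M" "\<And>x. x \<in> space M \<Longrightarrow> cmod (f x) \<le> cmod (g x)"
  shows "f \<in> sqint M"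
proof -
  have "integrable M (\<lambda>x. (cmod (f x))\<^sup>2)"
  proof (rule Bochner_Integration.integrable_bound)
    show "integrable M (\<lambda>x. (cmod (g x))\<^sup>2)"
      using assms(1) by (simp add: sqint_def)
    show "(\<lambda>x. (cmod (f x))\<^sup>2) \<in> borel_measurable M"
      using assms(2) by measurable
    show "AE x in M. norm ((cmod (f x))\<^sup>2) \<le> norm ((cmod (g x))\<^sup>2)"
      using assms(3) by (intro AE_I2) (simp add: power_mono)
  qed
  then show ?thesis using assms(2) by (simp add: sqint_def)
qed

lemma borel_measurable_cnj [measurable]:
  assumes "f \<in> borel_measurable M"
  shows "(\<lambda>x. cnj (f x)) \<in> borel_measurable M"
  by (rule borel_measurable_continuous_on[OF _ assms]) (rule continuous_on_cnj[OF continuous_on_id])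

lemma sqint_cnj: "f \<in> sqint M \<Longrightarrow> (\<lambda>x. cnj (f x)) \<in> sqint M"
  by (rule sqint_dominated[of f]) (simp_all add: sqint_def borel_measurable_cnj)

lemma sqint_bounded_mult:
  assumes "f \<in> sqint M" "b \<in> borel_measurable M" "\<And>x. x \<in> space M \<Longrightarrow> cmod (b x) \<le> 1"
  shows "(\<lambda>x. b x * f x) \<in> sqint M"
proof (rule sqint_dominated[OF assms(1)])
  show "(\<lambda>x. b x * f x) \<in> borel_measurable M"
    using assms(1,2) by (intro borel_measurable_times) (simp_all add: sqint_def)
  show "cmod (b x * f x) \<le> cmod (f x)" if "x \<in> space M" for x
    using assms(3)[OF that] by (simp add: norm_mult mult_left_le_one_le)
qed

lemma sqint_zero [simp]: "(\<lambda>x. 0) \<in> sqint M"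
  by (simp add: sqint_def)

lemma sqint_add:
  assumes "f \<in> sqint M" "g \<in> sqint M"
  shows "(\<lambda>x. f x + g x) \<in> sqint M"
proof -
  have "integrable M (\<lambda>x. (cmod (f x + g x))\<^sup>2)"
  proof (rule Bochner_Integration.integrable_bound)
    show "integrable M (\<lambda>x. 2 * (cmod (f x))\<^sup>2 + 2 * (cmod (g x))\<^sup>2)"
      using assms by (simp add: sqint_def)
    have "(cmod (f x + g x))\<^sup>2 \<le> 2 * (cmod (f x))\<^sup>2 + 2 * (cmod (g x))\<^sup>2" for x
    proof -
      have "(cmod (f x + g x))\<^sup>2 \<le> (cmod (f x) + cmod (g x))\<^sup>2"
        by (intro power_mono norm_triangle_ineq) auto
      also have "\<dots> \<le> 2 * (cmod (f x))\<^sup>2 + 2 * (cmod (g x))\<^sup>2"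
        using sum_squares_bound[of "cmod (f x)" "cmod (g x)"] by (simp add: power2_sum)
      finally show ?thesis .
    qed
    then show "AE x in M. norm ((cmod (f x + g x))\<^sup>2) \<le> norm (2 * (cmod (f x))\<^sup>2 + 2 * (cmod (g x))\<^sup>2)"
      by (intro AE_I2) simp
    show "(\<lambda>x. (cmod (f x + g x))\<^sup>2) \<in> borel_measurable M"
      using borel_measurable_add[OF sqintD[OF assms(1)] sqintD[OF assms(2)]] by measurable
  qed
  then show ?thesis
    using borel_measurable_add[OF sqintD[OF assms(1)] sqintD[OF assms(2)]] by (simp add: sqint_def)
qed

lemma sqint_sum: "(\<And>i. i \<in> I \<Longrightarrow> f i \<in> sqint M) \<Longrightarrow> (\<lambda>x. \<Sum>i\<in>I. f i x) \<in> sqint M"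
  by (induction I rule: infinite_finite_induct) (auto intro: sqint_add)

lemma sqint_minus: "f \<in> sqint M \<Longrightarrow> g \<in> sqint M \<Longrightarrow> (\<lambda>x. f x - g x) \<in> sqint M"
  using sqint_add[of f M "\<lambda>x. - g x"] sqint_dominated[of g M "\<lambda>x. - g x"] by (simp add: sqint_def)

lemma sqint_comp_perm:
  assumes "\<sigma> permutes {..<n}" "f \<in> sqint (prod_cube n)"
  shows "(\<lambda>x. f (x \<circ> \<sigma>)) \<in> sqint (prod_cube n)"
  using integrable_distr_eq[OF measurable_comp_perm[OF assms(1)], of "\<lambda>x. (cmod (f x))\<^sup>2"]
    distr_comp_perm[OF assms(1)] assms(2) measurable_compose[OF measurable_comp_perm[OF assms(1)], of f borel]
  by (auto simp: sqint_def)

text \<open>Stated in \<open>ennreal\<close> with measurability alone, so that it applies to every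
  section of a square integrable function, including sections of infinite norm. A nonintegrable
  product has Bochner integral 0.\<close>

lemma Cauchy_Schwarz_integral:
  assumes [measurable]: "f \<in> borel_measurable M" "g \<in> borel_measurable M"
  shows "ennreal ((cmod (LINT x|M. f x * g x))\<^sup>2) \<le>
    (\<integral>\<^sup>+x. ennreal ((cmod (f x))\<^sup>2) \<partial>M) * (\<integral>\<^sup>+x. ennreal ((cmod (g x))\<^sup>2) \<partial>M)"
proof -
  have "ennreal (cmod (LINT x|M. f x * g x)) \<le> (\<integral>\<^sup>+x. ennreal (cmod (f x)) * ennreal (cmod (g x)) \<partial>M)"
    using integral_norm_bound_ennreal[of M "\<lambda>x. f x * g x"]
    by (cases "integrable M (\<lambda>x. f x * g x)")
      (auto simp: norm_mult ennreal_mult' not_integrable_integral_eq)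
  then have "ennreal ((cmod (LINT x|M. f x * g x))\<^sup>2) \<le> (\<integral>\<^sup>+x. ennreal (cmod (f x)) * ennreal (cmod (g x)) \<partial>M)\<^sup>2"
    by (simp add: power_mono flip: ennreal_power)
  also have "\<dots> \<le> (\<integral>\<^sup>+x. (ennreal (cmod (f x)))\<^sup>2 \<partial>M) * (\<integral>\<^sup>+x. (ennreal (cmod (g x)))\<^sup>2 \<partial>M)"
    by (rule Cauchy_Schwarz_nn_integral) auto
  finally show ?thesis by (simp add: ennreal_power)
qed

lemma sqint_tensor:
  assumes "k \<le> n" and h: "h \<in> sqint U" and g: "g \<in> sqint (prod_cube n)"
  shows "(\<lambda>x. h (x k) * g (del n k x)) \<in> sqint (prod_cube (Suc n))"
proof -
  note [measurable] = sqintD[OF h] sqintD[OF g] measurable_del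
  have k[measurable]: "(\<lambda>x. x k) \<in> prod_cube (Suc n) \<rightarrow>\<^sub>M U"
    using assms by (intro measurable_component_singleton) auto
  have "(\<integral>\<^sup>+x. ennreal ((cmod (h (x k) * g (del n k x)))\<^sup>2) \<partial>prod_cube (Suc n)) =
     (\<integral>\<^sup>+z. \<integral>\<^sup>+y. ennreal ((cmod (h y))\<^sup>2) * ennreal ((cmod (g z))\<^sup>2) \<partial>U \<partial>prod_cube n)"
    by (subst nn_integral_ins[OF assms(1)], measurable)
       (auto intro!: nn_integral_cong simp: space_PiM PiE_iff norm_mult power_mult_distrib ennreal_mult')
  also have "\<dots> = (\<integral>\<^sup>+y. ennreal ((cmod (h y))\<^sup>2) \<partial>U) * (\<integral>\<^sup>+z. ennreal ((cmod (g z))\<^sup>2) \<partial>prod_cube n)"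
    by (simp add: nn_integral_multc nn_integral_cmult)
  also have "\<dots> < \<infinity>"
    using h g by (simp add: sqint_iff_nn ennreal_mult_less_top)
  finally show ?thesis
    by (simp add: sqint_iff_nn)
qed

section \<open>Measurable versions\<close>

text \<open>Distinct coordinates are independent and uniform. The index set is arbitrary because the
  fact serves both for particle positions and for blocks of a partition.\<close>

lemma distr_two_components:
  fixes I :: "'i set"
  assumes "i \<in> I" "j \<in> I" "i \<noteq> j"
  shows "distr (Pi\<^sub>M I (\<lambda>_. U)) (U \<Otimes>\<^sub>M U) (\<lambda>x. (x i, x j)) = U \<Otimes>\<^sub>M U"
proof (rule pair_measure_eqI[symmetric])
  have m: "(\<lambda>x. (x i, x j)) \<in> Pi\<^sub>M I (\<lambda>_. U) \<rightarrow>\<^sub>M U \<Otimes>\<^sub>M U"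
    using assms by (intro measurable_Pair measurable_component_singleton)
  fix A B assume AB: "A \<in> sets U" "B \<in> sets U"
  have "emeasure (distr (Pi\<^sub>M I (\<lambda>_. U)) (U \<Otimes>\<^sub>M U) (\<lambda>x. (x i, x j))) (A \<times> B) =
      emeasure (Pi\<^sub>M I (\<lambda>_. U)) {x \<in> space (Pi\<^sub>M I (\<lambda>_. U)). \<forall>l\<in>{i, j}. x l \<in> (if l = i then A else B)}"
    using AB assms(3) by (subst emeasure_distr[OF m]) (auto intro!: arg_cong2[where f=emeasure])
  also have "\<dots> = (\<Prod>l\<in>{i, j}. emeasure U (if l = i then A else B))"
    using AB assms by (intro PU.emeasure_PiM_Collect) auto
  also have "\<dots> = emeasure U A * emeasure U B"
    using assms(3) by simp
  finally show "emeasure U A * emeasure U B =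
      emeasure (distr (Pi\<^sub>M I (\<lambda>_. U)) (U \<Otimes>\<^sub>M U) (\<lambda>x. (x i, x j))) (A \<times> B)" by simp
qed (simp_all add: prob_space_imp_sigma_finite)

lemma AE_two_components:
  fixes I :: "'i set"
  assumes "AE p in U \<Otimes>\<^sub>M U. P (fst p) (snd p)" "i \<in> I" "j \<in> I" "i \<noteq> j"
  shows "AE x in Pi\<^sub>M I (\<lambda>_. U). P (x i) (x j)"
proof -
  have m: "(\<lambda>x. (x i, x j)) \<in> Pi\<^sub>M I (\<lambda>_. U) \<rightarrow>\<^sub>M U \<Otimes>\<^sub>M U"
    using assms by (intro measurable_Pair measurable_component_singleton)
  have "AE x in Pi\<^sub>M I (\<lambda>_. U). P (fst (x i, x j)) (snd (x i, x j))"
  proof (rule AE_distrD[OF m])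
    show "AE p in distr (Pi\<^sub>M I (\<lambda>_. U)) (U \<Otimes>\<^sub>M U) (\<lambda>x. (x i, x j)). P (fst p) (snd p)"
      unfolding distr_two_components[OF assms(2-4)] by (rule assms(1))
  qed
  then show ?thesis by simp
qed

lemma measurable_U_borel: "(\<lambda>x. x) \<in> U \<rightarrow>\<^sub>M borel"
  by (intro measurable_restrict_space1 measurable_completion) simp

lemma AE_lborel_imp_U:
  assumes "AE x in lborel. P x"
  shows "AE x in U. P x"
proof -
  have "AE x in lebesgue. P x"
    using assms by (rule AE_completion)
  then show ?thesis
    by (subst AE_restrict_space_iff) auto
qed

text \<open>A null set of the plane need not be measurable for \<open>U \<Otimes>\<^sub>M U\<close>,
  so it is first enlarged to a Borel null set \<open>N\<close>. Almost all sections of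
  \<open>N\<close> are null for \<open>lborel\<close>, hence for \<open>U\<close>, and Fubini leads
  back to the square. Both orders are recorded in order to symmetrise a version of the
  kernel.\<close>

lemma AE_lborel_pair_imp_U:
  fixes P :: "real \<Rightarrow> real \<Rightarrow> bool"
  assumes "AE p in lborel. P (fst p) (snd p)"
  shows "AE p in U \<Otimes>\<^sub>M U. P (fst p) (snd p) \<and> P (snd p) (fst p)"
proof -
  interpret UU: pair_sigma_finite U U ..
  obtain N where N: "N \<in> sets lborel" "emeasure lborel N = 0" and sub: "{p. \<not> P (fst p) (snd p)} \<subseteq> N"
    using assms by (auto elim!: AE_E)
  have Nb: "N \<in> sets (borel \<Otimes>\<^sub>M borel)"
    using N(1) unfolding borel_prod by simp
  have mU: "(\<lambda>p. (fst p, snd p)) \<in> U \<Otimes>\<^sub>M U \<rightarrow>\<^sub>M borel \<Otimes>\<^sub>M borel"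
    by (intro measurable_Pair measurable_compose[OF measurable_fst measurable_U_borel]
        measurable_compose[OF measurable_snd measurable_U_borel])
  have mem: "{p \<in> space (U \<Otimes>\<^sub>M U). (fst p, snd p) \<notin> N} \<in> sets (U \<Otimes>\<^sub>M U)"
  proof -
    have "{p \<in> space (U \<Otimes>\<^sub>M U). (fst p, snd p) \<notin> N} =
        space (U \<Otimes>\<^sub>M U) - ((\<lambda>p. (fst p, snd p)) -` N \<inter> space (U \<Otimes>\<^sub>M U))" by auto
    also have "\<dots> \<in> sets (U \<Otimes>\<^sub>M U)"
      using measurable_sets[OF mU Nb] by blast
    finally show ?thesis .
  qed
  have "AE p in lborel \<Otimes>\<^sub>M lborel. p \<notin> N"
    unfolding lborel_prod using N by (intro AE_not_in) (simp add: null_sets_def)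
  then have "AE x in lborel. AE y in lborel. (x, y) \<notin> N"
    by (rule lborel_pair.AE_pair)
  then have "AE x in lborel. AE y in U. (x, y) \<notin> N"
    by (rule eventually_mono) (rule AE_lborel_imp_U)
  then have ae: "AE x in U. AE y in U. (x, y) \<notin> N"
    by (rule AE_lborel_imp_U)
  have 1: "AE p in U \<Otimes>\<^sub>M U. (fst p, snd p) \<notin> N"
    by (rule UU.AE_pair_measure[OF mem]) (simp add: ae)
  have "AE y in U. AE x in U. (x, y) \<notin> N"
    using ae UU.AE_commute[of "\<lambda>x y. (x, y) \<notin> N"] mem by simp
  then have "AE x in U. AE y in U. (y, x) \<notin> N" .
  moreover have "{p \<in> space (U \<Otimes>\<^sub>M U). (snd p, fst p) \<notin> N} \<in> sets (U \<Otimes>\<^sub>M U)"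
  proof -
    have "(\<lambda>p. (snd p, fst p)) \<in> U \<Otimes>\<^sub>M U \<rightarrow>\<^sub>M borel \<Otimes>\<^sub>M borel"
      by (intro measurable_Pair measurable_compose[OF measurable_fst measurable_U_borel]
          measurable_compose[OF measurable_snd measurable_U_borel])
    from measurable_sets[OF this Nb]
    have "space (U \<Otimes>\<^sub>M U) - ((\<lambda>p. (snd p, fst p)) -` N \<inter> space (U \<Otimes>\<^sub>M U)) \<in> sets (U \<Otimes>\<^sub>M U)"
      by blast
    moreover have "{p \<in> space (U \<Otimes>\<^sub>M U). (snd p, fst p) \<notin> N} =
        space (U \<Otimes>\<^sub>M U) - ((\<lambda>p. (snd p, fst p)) -` N \<inter> space (U \<Otimes>\<^sub>M U))" by auto
    ultimately show ?thesis by simp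
  qed
  ultimately have 2: "AE p in U \<Otimes>\<^sub>M U. (snd p, fst p) \<notin> N"
    by (intro UU.AE_pair_measure) simp_all
  have P: "P a b" if "(a, b) \<notin> N" for a b
  proof (rule ccontr)
    assume "\<not> P a b"
    then have "(a, b) \<in> {p. \<not> P (fst p) (snd p)}" by simp
    with sub that show False by blast
  qed
  show ?thesis
    using 1 2 by (rule eventually_elim2) (intro conjI P)
qed

text \<open>Bound and symmetry hold for all reals, so that pointwise computations need no membership
  in the unit interval.\<close>

locale bounded_kernel =
  fixes v :: "real \<Rightarrow> real \<Rightarrow> real"
  assumes v_measurable: "(\<lambda>p. v (fst p) (snd p)) \<in> borel_measurable (U \<Otimes>\<^sub>M U)"
    and v_bound: "\<And>x y. \<bar>v x y\<bar> \<le> 1"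
    and v_sym: "\<And>x y. v x y = v y x"

text \<open>A twist kernel is only Lebesgue measurable on the square, so that its sections need not be
  measurable. It is replaced by an almost everywhere equal kernel that is measurable for the
  uncompleted product.\<close>

lemma twist_kernel_version:
  assumes "twist_kernel w"
  obtains v where "bounded_kernel v" "AE p in U \<Otimes>\<^sub>M U. w (fst p) (snd p) = v (fst p) (snd p)"
proof -
  let ?Q = "{0..1} \<times> {0..1} :: (real \<times> real) set"
  have "?Q \<in> sets borel"
    by (intro borel_closed closed_Times) auto
  then have Q: "?Q \<in> sets lebesgue" by simp
  have "(\<lambda>p. w (fst p) (snd p)) \<in> borel_measurable (lebesgue_on ?Q)"
    using assms by (simp add: twist_kernel_def case_prod_unfold)
  then have "(\<lambda>p. if p \<in> ?Q then w (fst p) (snd p) else 0) \<in> borel_measurable lebesgue"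
    using Q by (subst borel_measurable_if)
  from completion_ex_borel_measurable_real[OF this]
  obtain g where g: "g \<in> borel_measurable lborel"
    and ae: "AE p in lborel. (if p \<in> ?Q then w (fst p) (snd p) else 0) = g p" by auto
  \<comment> \<open>Symmetrising and truncating enforce the locale assumptions everywhere, and
    change nothing where \<open>g\<close> agrees with the symmetric kernel of modulus at most 1 at
    both \<open>(x, y)\<close> and \<open>(y, x)\<close>.\<close>
  define v where "v x y = max (-1) (min 1 ((g (x, y) + g (y, x)) / 2))" for x y
  have gb: "g \<in> borel_measurable (borel \<Otimes>\<^sub>M borel)"
    using g by (simp add: borel_prod)
  have "(\<lambda>p. g (fst p, snd p)) \<in> borel_measurable (U \<Otimes>\<^sub>M U)"
    by (intro measurable_compose[OF _ gb] measurable_Pair measurable_compose[OF measurable_fst measurable_U_borel]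
        measurable_compose[OF measurable_snd measurable_U_borel])
  moreover have "(\<lambda>p. g (snd p, fst p)) \<in> borel_measurable (U \<Otimes>\<^sub>M U)"
    by (intro measurable_compose[OF _ gb] measurable_Pair measurable_compose[OF measurable_fst measurable_U_borel]
        measurable_compose[OF measurable_snd measurable_U_borel])
  ultimately have "(\<lambda>p. v (fst p) (snd p)) \<in> borel_measurable (U \<Otimes>\<^sub>M U)"
    unfolding v_def by measurable
  then have "bounded_kernel v"
    by unfold_locales (auto simp: v_def add.commute)
  have "AE p in lborel. (\<lambda>x y. (if (x, y) \<in> ?Q then w x y else 0) = g (x, y)) (fst p) (snd p)"
    using ae by simp
  from AE_lborel_pair_imp_U[OF this]
  have "AE p in U \<Otimes>\<^sub>M U. w (fst p) (snd p) = v (fst p) (snd p)"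
  proof (rule AE_mp, intro AE_I2 impI)
    fix p assume "p \<in> space (U \<Otimes>\<^sub>M U)"
    then have p: "fst p \<in> {0..1}" "snd p \<in> {0..1}"
      by (auto simp: space_pair_measure)
    assume "(if (fst p, snd p) \<in> ?Q then w (fst p) (snd p) else 0) = g (fst p, snd p) \<and>
        (if (snd p, fst p) \<in> ?Q then w (snd p) (fst p) else 0) = g (snd p, fst p)"
    then have "g (fst p, snd p) = w (fst p) (snd p)" "g (snd p, fst p) = w (snd p) (fst p)"
      using p by (simp_all del: prod.collapse)
    moreover have "w (fst p) (snd p) = w (snd p) (fst p)" "w (fst p) (snd p) \<in> {-1..1}"
      using assms p unfolding twist_kernel_def by blast+
    ultimately show "w (fst p) (snd p) = v (fst p) (snd p)"
      by (simp add: v_def)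
  qed
  with \<open>bounded_kernel v\<close> show ?thesis by (rule that)
qed

lemma sqint_completion_version:
  assumes "f \<in> sqint (completion M)"
  obtains f' where "f' \<in> sqint M" "AE x in M. f x = f' x"
proof -
  have m: "f \<in> borel_measurable (completion M)"
    using assms by (simp add: sqint_def)
  have "(\<lambda>x. Re (f x)) \<in> borel_measurable (completion M)" "(\<lambda>x. Im (f x)) \<in> borel_measurable (completion M)"
    using m by measurable
  from this[THEN completion_ex_borel_measurable_real]
  obtain r i where [measurable]: "r \<in> borel_measurable M" "i \<in> borel_measurable M"
    and ae: "AE x in M. Re (f x) = r x" "AE x in M. Im (f x) = i x" by blast
  define f' where "f' x = Complex (r x) (i x)" for x
  have f': "f' \<in> borel_measurable M"
    unfolding f'_def Complex_eq by measurable
  have eq: "AE x in M. f x = f' x"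
    using ae by (rule eventually_elim2) (simp add: f'_def complex_eq_iff)
  have "(\<integral>\<^sup>+x. ennreal ((cmod (f' x))\<^sup>2) \<partial>M) = (\<integral>\<^sup>+x. ennreal ((cmod (f x))\<^sup>2) \<partial>M)"
    by (rule nn_integral_cong_AE) (use eq in \<open>rule eventually_mono\<close>, simp)
  then have "f' \<in> sqint M"
    using assms f' by (simp add: sqint_iff_nn nn_integral_completion)
  with eq show ?thesis by (intro that)
qed

lemma measurable_completion_AE:
  assumes "f' \<in> M \<rightarrow>\<^sub>M N" "AE x in M. f x = f' x" "\<And>x. x \<in> space M \<Longrightarrow> f x \<in> space N"
  shows "f \<in> completion M \<rightarrow>\<^sub>M N"
proof (rule measurableI)
  fix A assume A: "A \<in> sets N"
  have "AE x in completion M. x \<in> f' -` A \<inter> space M \<longleftrightarrow> x \<in> f -` A \<inter> space (completion M)"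
    using AE_completion[OF assms(2)] by (rule eventually_mono) auto
  moreover have "f' -` A \<inter> space M \<in> sets (completion M)"
    using measurable_sets[OF assms(1) A] by (intro sets_completionI_sets)
  ultimately show "f -` A \<inter> space (completion M) \<in> sets (completion M)"
    by (rule completion.in_sets_AE) simp
qed (simp add: assms(3))

lemma integral_completion_AE:
  fixes f f' :: "'a \<Rightarrow> 'b :: {banach, second_countable_topology}"
  assumes "f' \<in> borel_measurable M" "AE x in M. f x = f' x"
  shows "(LINT x|completion M. f x) = (LINT x|M. f' x)"
proof -
  have "(LINT x|completion M. f x) = (LINT x|completion M. f' x)"
    using assms by (intro integral_cong_AE measurable_completion_AE[OF assms] measurable_completion AE_completion) auto
  then show ?thesis using assms by (simp add: integral_completion)
qed

lemma sqint_completionI: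
  assumes "f' \<in> sqint M" "AE x in M. f x = f' x"
  shows "f \<in> sqint (completion M)"
proof -
  have "f \<in> borel_measurable (completion M)"
    by (rule measurable_completion_AE[OF sqintD[OF assms(1)] assms(2)]) simp
  moreover have "(\<integral>\<^sup>+x. ennreal ((cmod (f x))\<^sup>2) \<partial>M) = (\<integral>\<^sup>+x. ennreal ((cmod (f' x))\<^sup>2) \<partial>M)"
    by (rule nn_integral_cong_AE) (use assms(2) in \<open>rule eventually_mono\<close>, simp)
  ultimately show ?thesis
    using assms(1) by (simp add: sqint_iff_nn nn_integral_completion)
qed

section \<open>The symmetrized inner product\<close>

lemma space_prod_cube_ext: "x \<in> space (prod_cube n) \<Longrightarrow> x \<in> extensional {..<n}"
  by (simp add: space_PiM PiE_iff)

context bounded_kernel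
begin

lemma measurable_v:
  assumes "f \<in> M \<rightarrow>\<^sub>M U" "g \<in> M \<rightarrow>\<^sub>M U"
  shows "(\<lambda>x. v (f x) (g x)) \<in> borel_measurable M"
  using measurable_compose[OF measurable_Pair[OF assms] v_measurable] by simp

lemma norm_prod_v_le: "cmod (\<Prod>i\<in>I. complex_of_real (v (f i) (g i))) \<le> 1"
  unfolding prod_norm[symmetric] by (rule prod_le_1) (simp_all add: v_bound)

lemma perm_op_sqint:
  assumes "\<sigma> permutes {..<n}" "f \<in> sqint (prod_cube n)"
  shows "perm_op v n \<sigma> f \<in> sqint (prod_cube n)"
proof -
  have lt: "\<sigma> j < n" if "j < n" for j
    using permutes_in_image[OF assms(1), of j] that by simp
  have "(\<lambda>x. v (x (\<sigma> (fst p))) (x (\<sigma> (snd p)))) \<in> borel_measurable (prod_cube n)" if "p \<in> invs n \<sigma>" for p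
    using that by (intro measurable_v measurable_component_singleton) (auto simp: invs_def lt)
  then have "(\<lambda>x. \<Prod>p\<in>invs n \<sigma>. complex_of_real (v (x (\<sigma> (fst p))) (x (\<sigma> (snd p))))) \<in> borel_measurable (prod_cube n)"
    by (intro borel_measurable_prod borel_measurable_of_real) simp
  from sqint_bounded_mult[OF sqint_comp_perm[OF assms] this norm_prod_v_le]
  show ?thesis
    by (simp add: perm_op_def[abs_def] case_prod_unfold)
qed

text \<open>The adjoint of \<phi>(\<sigma>) is \<phi>(inv \<sigma>), by the measure preserving
  substitution of \<open>x \<circ> inv \<sigma>\<close> for \<open>x\<close>. The inversions of the
  two permutations correspond by \<open>(j, k) \<mapsto> (\<sigma> k, \<sigma> j)\<close>; the
  reversed order is absorbed by the symmetry of the kernel.\<close>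

lemma perm_op_adjoint:
  assumes \<sigma>: "\<sigma> permutes {..<n}" and f: "f \<in> sqint (prod_cube n)" and g: "g \<in> sqint (prod_cube n)"
  shows "(LINT x|prod_cube n. f x * cnj (perm_op v n \<sigma> g x)) =
    (LINT x|prod_cube n. perm_op v n (inv \<sigma>) f x * cnj (g x))"
proof -
  have inv: "inv \<sigma> permutes {..<n}" by (rule permutes_inv[OF \<sigma>])
  have "(\<lambda>x. f x * cnj (perm_op v n \<sigma> g x)) \<in> borel_measurable (prod_cube n)"
    by (intro borel_measurable_times sqintD[OF f] sqintD[OF sqint_cnj[OF perm_op_sqint[OF \<sigma> g]]])
  from integral_comp_perm[OF inv this]
  have "(LINT x|prod_cube n. f x * cnj (perm_op v n \<sigma> g x)) =
      (LINT x|prod_cube n. f (x \<circ> inv \<sigma>) * cnj (perm_op v n \<sigma> g (x \<circ> inv \<sigma>)))" by simp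
  also have "\<dots> = (LINT x|prod_cube n. perm_op v n (inv \<sigma>) f x * cnj (g x))"
  proof (rule Bochner_Integration.integral_cong[OF refl])
    fix x :: "nat \<Rightarrow> real"
    have i: "inv \<sigma> (\<sigma> j) = j" "\<sigma> (inv \<sigma> j) = j" for j
      using permutes_inverses[OF \<sigma>] by simp_all
    have \<sigma>n: "\<sigma> j < n \<longleftrightarrow> j < n" for j
      using permutes_in_image[OF \<sigma>, of j] by simp
    have inj: "\<sigma> a = \<sigma> b \<longleftrightarrow> a = b" for a b
      by (metis i(1))
    have "bij_betw (\<lambda>(j, k). (\<sigma> k, \<sigma> j)) (invs n \<sigma>) (invs n (inv \<sigma>))"
    proof (rule bij_betw_byWitness[where f' = "\<lambda>(j, k). (inv \<sigma> k, inv \<sigma> j)"])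
      show "(\<lambda>(j, k). (\<sigma> k, \<sigma> j)) ` invs n \<sigma> \<subseteq> invs n (inv \<sigma>)"
        by (auto simp: invs_def i \<sigma>n)
      have n: "inv \<sigma> j < n \<longleftrightarrow> j < n" for j
        using permutes_in_image[OF inv, of j] by simp
      show "(\<lambda>(j, k). (inv \<sigma> k, inv \<sigma> j)) ` invs n (inv \<sigma>) \<subseteq> invs n \<sigma>"
        by (auto simp: invs_def i n)
    qed (auto simp: i)
    from prod.reindex_bij_betw[OF this, of "\<lambda>(a, b). complex_of_real (v (x (inv \<sigma> a)) (x (inv \<sigma> b)))"]
    have "(\<Prod>(a, b)\<in>invs n (inv \<sigma>). complex_of_real (v (x (inv \<sigma> a)) (x (inv \<sigma> b)))) =
        (\<Prod>(j, k)\<in>invs n \<sigma>. complex_of_real (v (x j) (x k)))"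
      by (simp add: case_prod_unfold i v_sym)
    moreover have "x \<circ> inv \<sigma> \<circ> \<sigma> = x"
      by (rule ext) (simp add: i)
    ultimately show "f (x \<circ> inv \<sigma>) * cnj (perm_op v n \<sigma> g (x \<circ> inv \<sigma>)) = perm_op v n (inv \<sigma>) f x * cnj (g x)"
      by (simp add: perm_op_def i case_prod_unfold)
  qed
  finally show ?thesis .
qed

text \<open>This is <f, P(n) g>, with the sum outside the integral so that permutations can be
  reindexed term by term.\<close>

definition sym_inner :: "nat \<Rightarrow> ((nat \<Rightarrow> real) \<Rightarrow> complex) \<Rightarrow> ((nat \<Rightarrow> real) \<Rightarrow> complex) \<Rightarrow> complex" where
  "sym_inner n f g = (\<Sum>\<sigma> | \<sigma> permutes {..<n}. LINT x|prod_cube n. f x * cnj (perm_op v n \<sigma> g x))"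

lemma sym_inner_integrable:
  assumes "\<sigma> permutes {..<n}" "f \<in> sqint (prod_cube n)" "g \<in> sqint (prod_cube n)"
  shows "integrable (prod_cube n) (\<lambda>x. f x * cnj (perm_op v n \<sigma> g x))"
  by (intro sqint_mult_integrable sqint_cnj perm_op_sqint assms)

text \<open>Taking inverses permutes the summation range and exchanges \<phi>(\<sigma>) with its
  adjoint.\<close>

lemma sym_inner_commute:
  assumes f: "f \<in> sqint (prod_cube n)" and g: "g \<in> sqint (prod_cube n)"
  shows "sym_inner n f g = cnj (sym_inner n g f)"
proof -
  have "sym_inner n f g = (\<Sum>\<sigma> | \<sigma> permutes {..<n}. LINT x|prod_cube n. perm_op v n (inv \<sigma>) f x * cnj (g x))"
    unfolding sym_inner_def by (rule sum.cong[OF refl]) (use f g in \<open>simp add: perm_op_adjoint\<close>)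
  also have "\<dots> = (\<Sum>\<sigma> | \<sigma> permutes {..<n}. LINT x|prod_cube n. perm_op v n \<sigma> f x * cnj (g x))"
    by (rule sum_permutations_inverse[symmetric])
  also have "\<dots> = cnj (sym_inner n g f)"
    unfolding sym_inner_def cnj_sum Bochner_Integration.integral_cnj[symmetric]
    by (simp add: mult.commute)
  finally show ?thesis .
qed

lemma sym_inner_add_left:
  assumes "f \<in> sqint (prod_cube n)" "f' \<in> sqint (prod_cube n)" "g \<in> sqint (prod_cube n)"
  shows "sym_inner n (\<lambda>x. f x + f' x) g = sym_inner n f g + sym_inner n f' g"
  unfolding sym_inner_def sum.distrib[symmetric]
  by (rule sum.cong[OF refl])
    (use assms in \<open>simp add: distrib_right Bochner_Integration.integral_add[OF sym_inner_integrable sym_inner_integrable]\<close>)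

lemma sym_inner_minus_left:
  assumes "f \<in> sqint (prod_cube n)" "f' \<in> sqint (prod_cube n)" "g \<in> sqint (prod_cube n)"
  shows "sym_inner n (\<lambda>x. f x - f' x) g = sym_inner n f g - sym_inner n f' g"
  unfolding sym_inner_def sum_subtractf[symmetric]
  by (rule sum.cong[OF refl])
    (use assms in \<open>simp add: left_diff_distrib Bochner_Integration.integral_diff[OF sym_inner_integrable sym_inner_integrable]\<close>)

lemma front_op_measurable:
  assumes k: "k \<le> n" and f: "f \<in> borel_measurable (prod_cube (Suc n))"
  shows "(\<lambda>(z, y). front_op v k y f z) \<in> borel_measurable (prod_cube n \<Otimes>\<^sub>M U)"
proof -
  have "(\<lambda>p. v (fst p j) (snd p)) \<in> borel_measurable (prod_cube n \<Otimes>\<^sub>M U)" if "j < k" for j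
    using that k
    by (intro measurable_v measurable_snd measurable_compose[OF measurable_fst measurable_component_singleton]) simp
  then have "(\<lambda>p. \<Prod>j<k. complex_of_real (v (fst p j) (snd p))) \<in> borel_measurable (prod_cube n \<Otimes>\<^sub>M U)"
    by (intro borel_measurable_prod borel_measurable_of_real) simp
  moreover have "(\<lambda>p. f (ins k (snd p) (fst p))) \<in> borel_measurable (prod_cube n \<Otimes>\<^sub>M U)"
    using measurable_compose[OF measurable_ins[OF k] f] by (simp add: case_prod_unfold)
  ultimately show ?thesis
    unfolding front_op_def case_prod_unfold by (rule borel_measurable_times)
qed

lemma norm_front_op_le: "cmod (front_op v k y f z) \<le> cmod (f (ins k y z))"
  unfolding front_op_def norm_mult
  by (rule mult_left_le_one_le) (simp_all add: norm_prod_v_le)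

text \<open>The contraction of the first coordinate of T(1)...T(k) f with h.\<close>

definition contract :: "(real \<Rightarrow> complex) \<Rightarrow> nat \<Rightarrow> ((nat \<Rightarrow> real) \<Rightarrow> complex) \<Rightarrow> (nat \<Rightarrow> real) \<Rightarrow> complex" where
  "contract h k f z = (LINT y|U. cnj (h y) * front_op v k y f z)"

text \<open>Cauchy-Schwarz in the contracted coordinate for fixed \<open>z\<close>, followed by
  Tonelli, bounds the norm by the product of the norms of \<open>h\<close> and
  \<open>f\<close>.\<close>

lemma contract_sqint:
  assumes k: "k \<le> n" and h: "h \<in> sqint U" and f: "f \<in> sqint (prod_cube (Suc n))"
  shows "contract h k f \<in> sqint (prod_cube n)"
proof -
  note fo = front_op_measurable[OF k sqintD[OF f]]
  have ch: "(\<lambda>y. cnj (h y)) \<in> borel_measurable U"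
    by (rule sqintD[OF sqint_cnj[OF h]])
  have "(\<lambda>(z, y). cnj (h y) * front_op v k y f z) \<in> borel_measurable (prod_cube n \<Otimes>\<^sub>M U)"
    using borel_measurable_times[OF measurable_compose[OF measurable_snd ch] fo]
    by (simp add: case_prod_unfold)
  then have m: "contract h k f \<in> borel_measurable (prod_cube n)"
    unfolding contract_def by (rule U.borel_measurable_lebesgue_integral)
  have le: "ennreal ((cmod (contract h k f z))\<^sup>2) \<le>
      (\<integral>\<^sup>+y. ennreal ((cmod (h y))\<^sup>2) \<partial>U) * (\<integral>\<^sup>+y. ennreal ((cmod (f (ins k y z)))\<^sup>2) \<partial>U)"
    if z: "z \<in> space (prod_cube n)" for z
  proof -
    have "(\<lambda>y. front_op v k y f z) \<in> borel_measurable U"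
      using measurable_compose[OF measurable_Pair1'[OF z] fo] by simp
    from Cauchy_Schwarz_integral[OF ch this]
    have "ennreal ((cmod (contract h k f z))\<^sup>2) \<le>
        (\<integral>\<^sup>+y. ennreal ((cmod (h y))\<^sup>2) \<partial>U) * (\<integral>\<^sup>+y. ennreal ((cmod (front_op v k y f z))\<^sup>2) \<partial>U)"
      by (simp add: contract_def)
    also have "\<dots> \<le> (\<integral>\<^sup>+y. ennreal ((cmod (h y))\<^sup>2) \<partial>U) * (\<integral>\<^sup>+y. ennreal ((cmod (f (ins k y z)))\<^sup>2) \<partial>U)"
      by (intro mult_left_mono nn_integral_mono ennreal_leI power_mono norm_front_op_le) simp_all
    finally show ?thesis .
  qed
  have mf: "(\<lambda>x. ennreal ((cmod (f x))\<^sup>2)) \<in> borel_measurable (prod_cube (Suc n))"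
    using sqintD[OF f] by measurable
  have "(\<integral>\<^sup>+z. ennreal ((cmod (contract h k f z))\<^sup>2) \<partial>prod_cube n) \<le>
      (\<integral>\<^sup>+z. (\<integral>\<^sup>+y. ennreal ((cmod (h y))\<^sup>2) \<partial>U) * (\<integral>\<^sup>+y. ennreal ((cmod (f (ins k y z)))\<^sup>2) \<partial>U) \<partial>prod_cube n)"
    by (rule nn_integral_mono) (rule le)
  also have "\<dots> = (\<integral>\<^sup>+y. ennreal ((cmod (h y))\<^sup>2) \<partial>U) *
      (\<integral>\<^sup>+z. \<integral>\<^sup>+y. ennreal ((cmod (f (ins k y z)))\<^sup>2) \<partial>U \<partial>prod_cube n)"
  proof (rule nn_integral_cmult)
    have "(\<lambda>(z, y). ennreal ((cmod (f (ins k y z)))\<^sup>2)) \<in> borel_measurable (prod_cube n \<Otimes>\<^sub>M U)"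
      using measurable_compose[OF measurable_ins[OF k] mf] by (simp add: case_prod_unfold)
    then show "(\<lambda>z. \<integral>\<^sup>+y. ennreal ((cmod (f (ins k y z)))\<^sup>2) \<partial>U) \<in> borel_measurable (prod_cube n)"
      by (rule U.borel_measurable_nn_integral)
  qed
  also have "\<dots> = (\<integral>\<^sup>+y. ennreal ((cmod (h y))\<^sup>2) \<partial>U) * (\<integral>\<^sup>+x. ennreal ((cmod (f x))\<^sup>2) \<partial>prod_cube (Suc n))"
    by (simp only: nn_integral_ins[OF k mf])
  also have "\<dots> < \<infinity>"
    using h f by (simp add: sqint_iff_nn ennreal_mult_less_top)
  finally show ?thesis
    using m by (simp add: sqint_iff_nn)
qed

text \<open>Fubini at position \<open>k\<close>: with \<open>y\<close> back at its own place,
  \<open>front_op\<close> becomes multiplication by kernels, so the adjoint of the contraction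
  inserts \<open>h\<close> at position \<open>k\<close> and multiplies by these kernels.\<close>

lemma contract_adjoint:
  assumes k: "k \<le> n" and h: "h \<in> sqint U" and f: "f \<in> sqint (prod_cube n)"
    and g: "g \<in> sqint (prod_cube (Suc n))"
  shows "integrable (prod_cube (Suc n))
      (\<lambda>x. h (x k) * f (del n k x) * cnj ((\<Prod>j<k. complex_of_real (v (x j) (x k))) * g x))"
    and "(LINT z|prod_cube n. f z * cnj (contract h k g z)) =
      (LINT x|prod_cube (Suc n). h (x k) * f (del n k x) * cnj ((\<Prod>j<k. complex_of_real (v (x j) (x k))) * g x))"
proof -
  have "(\<lambda>x. v (x j) (x k)) \<in> borel_measurable (prod_cube (Suc n))" if "j < k" for j
    using that k by (intro measurable_v measurable_component_singleton) auto
  then have "(\<lambda>x. \<Prod>j<k. complex_of_real (v (x j) (x k))) \<in> borel_measurable (prod_cube (Suc n))"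
    by (intro borel_measurable_prod borel_measurable_of_real) simp
  from sqint_bounded_mult[OF g this norm_prod_v_le]
  show i: "integrable (prod_cube (Suc n))
      (\<lambda>x. h (x k) * f (del n k x) * cnj ((\<Prod>j<k. complex_of_real (v (x j) (x k))) * g x))"
    by (intro sqint_mult_integrable[OF sqint_tensor[OF k h f]] sqint_cnj)
  show "(LINT z|prod_cube n. f z * cnj (contract h k g z)) =
      (LINT x|prod_cube (Suc n). h (x k) * f (del n k x) * cnj ((\<Prod>j<k. complex_of_real (v (x j) (x k))) * g x))"
    unfolding integral_ins[OF k i]
  proof (rule Bochner_Integration.integral_cong[OF refl])
    fix z assume "z \<in> space (prod_cube n)"
    then have "z \<in> extensional {..<n}" by (rule space_prod_cube_ext)
    then show "f z * cnj (contract h k g z) = (LINT y|U. h (ins k y z k) * f (del n k (ins k y z)) *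
        cnj ((\<Prod>j<k. complex_of_real (v (ins k y z j) (ins k y z k))) * g (ins k y z)))"
      unfolding contract_def Bochner_Integration.integral_cnj[symmetric] integral_mult_right_zero[symmetric]
      by (simp add: front_op_def mult_ac del: Bochner_Integration.integral_cnj integral_mult_right_zero)
  qed
qed

lemma perm_op_contract:
  "perm_op v n \<tau> (contract h k g) z = (LINT y|U. cnj (h y) * perm_op v n \<tau> (front_op v k y g) z)"
  unfolding perm_op_def contract_def integral_mult_right_zero[symmetric] by (simp add: mult_ac)

lemma perm_op_sum: "perm_op v n \<tau> (\<lambda>z. \<Sum>k\<in>K. f k z) z = (\<Sum>k\<in>K. perm_op v n \<tau> (f k) z)"
  by (simp add: perm_op_def sum_distrib_left)

text \<open>For each pair \<open>(\<tau>, k)\<close> the operator of \<open>\<tau>\<close> acts only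
  on the coordinates other than 0, so integrating out coordinate 0 passes through it and leaves a
  contraction; summing over \<open>k\<close> assembles R.\<close>

lemma sym_inner_creation:
  assumes h: "h \<in> sqint U" and f: "f \<in> sqint (prod_cube n)" and g: "g \<in> sqint (prod_cube (Suc n))"
  shows "sym_inner (Suc n) (\<lambda>x. h (x 0) * f (del n 0 x)) g = sym_inner n f (\<lambda>z. \<Sum>k\<le>n. contract h k g z)"
proof -
  let ?f = "\<lambda>x. h (x 0) * f (del n 0 x)"
  have fs: "?f \<in> sqint (prod_cube (Suc n))"
    by (rule sqint_tensor[OF _ h f]) simp
  have step: "(LINT x|prod_cube (Suc n). ?f x * cnj (perm_op v (Suc n) (perm_ext k \<tau>) g x)) =
      (LINT z|prod_cube n. f z * cnj (perm_op v n \<tau> (contract h k g) z))"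
    if "\<tau> permutes {..<n}" "k \<le> n" for \<tau> k
  proof -
    have "integrable (prod_cube (Suc n)) (\<lambda>x. ?f x * cnj (perm_op v (Suc n) (perm_ext k \<tau>) g x))"
      using that by (intro sym_inner_integrable perm_ext_permutes fs g)
    from integral_ins[OF le0 this]
    have "(LINT x|prod_cube (Suc n). ?f x * cnj (perm_op v (Suc n) (perm_ext k \<tau>) g x)) =
        (LINT z|prod_cube n. LINT y|U. ?f (ins 0 y z) * cnj (perm_op v (Suc n) (perm_ext k \<tau>) g (ins 0 y z)))" .
    also have "\<dots> = (LINT z|prod_cube n. f z * cnj (perm_op v n \<tau> (contract h k g) z))"
    proof (rule Bochner_Integration.integral_cong[OF refl])
      fix z assume "z \<in> space (prod_cube n)"
      then have z: "z \<in> extensional {..<n}" by (rule space_prod_cube_ext)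
      then have "ins 0 y z \<in> extensional {..<Suc n}" for y
        by (simp add: extensional_def ins_def)
      then have *: "perm_op v (Suc n) (perm_ext k \<tau>) g (ins 0 y z) = perm_op v n \<tau> (front_op v k y g) z" for y
        using perm_op_perm_ext[OF that, of "ins 0 y z" v g] z by simp
      show "(LINT y|U. ?f (ins 0 y z) * cnj (perm_op v (Suc n) (perm_ext k \<tau>) g (ins 0 y z))) =
          f z * cnj (perm_op v n \<tau> (contract h k g) z)"
        unfolding perm_op_contract Bochner_Integration.integral_cnj[symmetric] integral_mult_right_zero[symmetric] *
        using z by (simp add: mult_ac del: Bochner_Integration.integral_cnj integral_mult_right_zero)
    qed
    finally show ?thesis .
  qed
  have "sym_inner (Suc n) ?f g = (\<Sum>(\<tau>, k)\<in>{\<tau>. \<tau> permutes {..<n}} \<times> {..n}.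
      LINT x|prod_cube (Suc n). ?f x * cnj (perm_op v (Suc n) (perm_ext k \<tau>) g x))"
    unfolding sym_inner_def
    using sum.reindex_bij_betw[OF bij_betw_perm_ext,
        of "\<lambda>\<sigma>. LINT x|prod_cube (Suc n). ?f x * cnj (perm_op v (Suc n) \<sigma> g x)" n]
    by (simp add: case_prod_unfold)
  also have "\<dots> = (\<Sum>(\<tau>, k)\<in>{\<tau>. \<tau> permutes {..<n}} \<times> {..n}.
      LINT z|prod_cube n. f z * cnj (perm_op v n \<tau> (contract h k g) z))"
    by (rule sum.cong[OF refl]) (clarsimp simp: step)
  also have "\<dots> = (\<Sum>\<tau> | \<tau> permutes {..<n}. \<Sum>k\<le>n.
      LINT z|prod_cube n. f z * cnj (perm_op v n \<tau> (contract h k g) z))"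
    by (simp add: sum.cartesian_product)
  also have "\<dots> = sym_inner n f (\<lambda>z. \<Sum>k\<le>n. contract h k g z)"
    unfolding sym_inner_def
  proof (rule sum.cong[OF refl])
    fix \<tau> assume "\<tau> \<in> {\<tau>. \<tau> permutes {..<n}}"
    then have \<tau>: "\<tau> permutes {..<n}" by simp
    have "(LINT z|prod_cube n. f z * cnj (perm_op v n \<tau> (\<lambda>z. \<Sum>k\<le>n. contract h k g z) z)) =
        (LINT z|prod_cube n. (\<Sum>k\<le>n. f z * cnj (perm_op v n \<tau> (contract h k g) z)))"
      by (simp add: perm_op_sum sum_distrib_left)
    also have "\<dots> = (\<Sum>k\<le>n. LINT z|prod_cube n. f z * cnj (perm_op v n \<tau> (contract h k g) z))"
      by (rule Bochner_Integration.integral_sum)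
        (simp add: sym_inner_integrable[OF \<tau> f contract_sqint[OF _ h g]])
    finally show "(\<Sum>k\<le>n. LINT z|prod_cube n. f z * cnj (perm_op v n \<tau> (contract h k g) z)) =
        (LINT z|prod_cube n. f z * cnj (perm_op v n \<tau> (\<lambda>z. \<Sum>k\<le>n. contract h k g z) z))" by simp
  qed
  finally show ?thesis .
qed

end

section \<open>The quotient Fock space\<close>

lemma L2_unit_eq: "L2_unit = sqint U"
  by (simp add: L2_unit_def sqint_def)

lemma L2_cube_eq: "L2_cube n = sqint (completion (prod_cube n))"
  by (simp add: L2_cube_def sqint_def cube_def)

lemma AE_del:
  assumes "k \<le> n" "AE z in prod_cube n. P z"
  shows "AE x in prod_cube (Suc n). P (del n k x)"
proof (rule AE_distrD[OF measurable_del])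
  have "distr (prod_cube (Suc n)) (prod_cube n) (\<lambda>x. \<lambda>j\<in>{..<n}. x (if j < k then j else Suc j)) = prod_cube n"
    by (rule distr_PiM_reindex) (auto simp: inj_on_def split: if_splits)
  then have "distr (prod_cube (Suc n)) (prod_cube n) (del n k) = prod_cube n"
    unfolding del_def .
  then show "AE z in distr (prod_cube (Suc n)) (prod_cube n) (del n k). P z"
    using assms(2) by (simp only:)
qed

text \<open>Fubini's theorem is applied to representatives that are measurable for the uncompleted product.\<close>

definition measurable_fock :: "fock_vec \<Rightarrow> bool" where
  "measurable_fock \<xi> \<longleftrightarrow> (\<forall>n. \<xi> n \<in> sqint (prod_cube n)) \<and> finite {n. \<xi> n \<noteq> (\<lambda>_. 0)}"

definition fock_version :: "fock_vec \<Rightarrow> fock_vec \<Rightarrow> bool" where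
  "fock_version \<xi> \<xi>' \<longleftrightarrow> measurable_fock \<xi>' \<and> (\<forall>n. AE x in prod_cube n. \<xi> n x = \<xi>' n x)"

lemma measurable_fock_sqint: "measurable_fock \<xi> \<Longrightarrow> \<xi> n \<in> sqint (prod_cube n)"
  by (simp add: measurable_fock_def)

lemma measurable_fock_finite: "measurable_fock \<xi> \<Longrightarrow> finite {n. \<xi> n \<noteq> (\<lambda>_. 0)}"
  by (simp add: measurable_fock_def)

lemma fock_version_refl: "measurable_fock \<xi> \<Longrightarrow> fock_version \<xi> \<xi>"
  by (simp add: fock_version_def)

lemma fock_alg_finite: "\<xi> \<in> fock_alg \<Longrightarrow> finite {n. \<xi> n \<noteq> (\<lambda>_. 0)}"
  by (simp add: fock_alg_def)

lemma fock_algI: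
  assumes "fock_version \<xi> \<xi>'" "finite {n. \<xi> n \<noteq> (\<lambda>_. 0)}"
  shows "\<xi> \<in> fock_alg"
proof -
  have "\<xi> n \<in> sqint (completion (prod_cube n))" for n
    by (rule sqint_completionI[of "\<xi>' n"]) (use assms in \<open>simp_all add: fock_version_def measurable_fock_def\<close>)
  with assms(2) show ?thesis by (simp add: fock_alg_def L2_cube_eq)
qed

lemma measurable_fock_alg: "measurable_fock \<xi> \<Longrightarrow> \<xi> \<in> fock_alg"
  by (rule fock_algI[OF fock_version_refl measurable_fock_finite])

lemma fock_alg_version:
  assumes "\<xi> \<in> fock_alg"
  obtains \<xi>' where "fock_version \<xi> \<xi>'"
proof -
  \<comment> \<open>A zero component keeps the literal zero as its version, since the support counts
    components that differ from 0 as functions.\<close>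
  have "\<exists>f'. f' \<in> sqint (prod_cube n) \<and> (AE x in prod_cube n. \<xi> n x = f' x) \<and> (\<xi> n = (\<lambda>_. 0) \<longrightarrow> f' = (\<lambda>_. 0))" for n
  proof (cases "\<xi> n = (\<lambda>_. 0)")
    case True
    then show ?thesis by (intro exI[of _ "\<lambda>_. 0"]) simp
  next
    case False
    have "\<xi> n \<in> sqint (completion (prod_cube n))"
      using assms by (simp add: fock_alg_def L2_cube_eq)
    then obtain f' where "f' \<in> sqint (prod_cube n)" "AE x in prod_cube n. \<xi> n x = f' x"
      by (rule sqint_completion_version)
    with False show ?thesis by (intro exI[of _ f']) simp
  qed
  then have "\<forall>n. \<exists>f'. f' \<in> sqint (prod_cube n) \<and> (AE x in prod_cube n. \<xi> n x = f' x) \<and>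
      (\<xi> n = (\<lambda>_. 0) \<longrightarrow> f' = (\<lambda>_. 0))" by (rule allI)
  from choice[OF this] obtain \<xi>' where "\<forall>n. \<xi>' n \<in> sqint (prod_cube n) \<and>
      (AE x in prod_cube n. \<xi> n x = \<xi>' n x) \<and> (\<xi> n = (\<lambda>_. 0) \<longrightarrow> \<xi>' n = (\<lambda>_. 0))" ..
  then have \<xi>': "\<xi>' n \<in> sqint (prod_cube n)" "AE x in prod_cube n. \<xi> n x = \<xi>' n x"
      "\<xi> n = (\<lambda>_. 0) \<Longrightarrow> \<xi>' n = (\<lambda>_. 0)" for n
    by simp_all
  have "finite {n. \<xi>' n \<noteq> (\<lambda>_. 0)}"
    by (rule finite_subset[OF _ fock_alg_finite[OF assms]]) (use \<xi>'(3) in blast)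
  with \<xi>' have "fock_version \<xi> \<xi>'"
    by (simp add: fock_version_def measurable_fock_def)
  then show ?thesis by (rule that)
qed

lemma fock_version_add:
  assumes "fock_version \<xi> \<xi>'" "fock_version \<eta> \<eta>'"
  shows "fock_version (\<lambda>n x. \<xi> n x + \<eta> n x) (\<lambda>n x. \<xi>' n x + \<eta>' n x)"
proof -
  have "finite {n. (\<lambda>x. \<xi>' n x + \<eta>' n x) \<noteq> (\<lambda>_. 0)}"
    by (rule finite_subset[of _ "{n. \<xi>' n \<noteq> (\<lambda>_. 0)} \<union> {n. \<eta>' n \<noteq> (\<lambda>_. 0)}"])
      (use assms in \<open>auto simp: fock_version_def measurable_fock_def\<close>)
  moreover have "AE x in prod_cube n. \<xi> n x + \<eta> n x = \<xi>' n x + \<eta>' n x" for n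
    by (rule eventually_elim2[of "\<lambda>x. \<xi> n x = \<xi>' n x" _ "\<lambda>x. \<eta> n x = \<eta>' n x"])
      (use assms in \<open>simp_all add: fock_version_def\<close>)
  ultimately show ?thesis
    using assms by (simp add: fock_version_def measurable_fock_def sqint_add)
qed

lemma fock_version_minus:
  assumes "fock_version \<xi> \<xi>'" "fock_version \<eta> \<eta>'"
  shows "fock_version (\<lambda>n x. \<xi> n x - \<eta> n x) (\<lambda>n x. \<xi>' n x - \<eta>' n x)"
proof -
  have "finite {n. (\<lambda>x. \<xi>' n x - \<eta>' n x) \<noteq> (\<lambda>_. 0)}"
    by (rule finite_subset[of _ "{n. \<xi>' n \<noteq> (\<lambda>_. 0)} \<union> {n. \<eta>' n \<noteq> (\<lambda>_. 0)}"])
      (use assms in \<open>auto simp: fock_version_def measurable_fock_def\<close>)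
  moreover have "AE x in prod_cube n. \<xi> n x - \<eta> n x = \<xi>' n x - \<eta>' n x" for n
    by (rule eventually_elim2[of "\<lambda>x. \<xi> n x = \<xi>' n x" _ "\<lambda>x. \<eta> n x = \<eta>' n x"])
      (use assms in \<open>simp_all add: fock_version_def\<close>)
  ultimately show ?thesis
    using assms by (simp add: fock_version_def measurable_fock_def sqint_minus)
qed

lemma fock_support_minus:
  "{n. (\<lambda>x. \<xi> n x - \<eta> n x) \<noteq> (\<lambda>_. 0)} \<subseteq> {n. \<xi> n \<noteq> (\<lambda>_. 0)} \<union> {n. \<eta> n \<noteq> (\<lambda>_. 0)}" for \<xi> \<eta> :: fock_vec
  by auto

lemma fock_support_add:
  "{n. (\<lambda>x. \<xi> n x + \<eta> n x) \<noteq> (\<lambda>_. 0)} \<subseteq> {n. \<xi> n \<noteq> (\<lambda>_. 0)} \<union> {n. \<eta> n \<noteq> (\<lambda>_. 0)}" for \<xi> \<eta> :: fock_vec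
  by auto

lemma fock_alg_minus:
  assumes "\<xi> \<in> fock_alg" "\<eta> \<in> fock_alg"
  shows "(\<lambda>n x. \<xi> n x - \<eta> n x) \<in> fock_alg"
proof -
  obtain \<xi>' \<eta>' where "fock_version \<xi> \<xi>'" "fock_version \<eta> \<eta>'"
    using fock_alg_version[OF assms(1)] fock_alg_version[OF assms(2)] by metis
  from fock_version_minus[OF this] show ?thesis
    by (rule fock_algI) (rule finite_subset[OF fock_support_minus], use assms in \<open>simp add: fock_alg_finite\<close>)
qed

lemma fock_alg_add:
  assumes "\<xi> \<in> fock_alg" "\<eta> \<in> fock_alg"
  shows "(\<lambda>n x. \<xi> n x + \<eta> n x) \<in> fock_alg"
proof -
  obtain \<xi>' \<eta>' where "fock_version \<xi> \<xi>'" "fock_version \<eta> \<eta>'"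
    using fock_alg_version[OF assms(1)] fock_alg_version[OF assms(2)] by metis
  from fock_version_add[OF this] show ?thesis
    by (rule fock_algI) (rule finite_subset[OF fock_support_add], use assms in \<open>simp add: fock_alg_finite\<close>)
qed

lemma fock_creation_0: "fock_creation h \<xi> 0 = (\<lambda>_. 0)"
  by (rule ext) (simp add: fock_creation_def)

lemma fock_creation_Suc: "fock_creation h \<xi> (Suc n) = (\<lambda>x. h (x 0) * \<xi> n (del n 0 x))"
  by (rule ext) (simp add: fock_creation_def del_def)

lemma fock_support_creation:
  "{n. fock_creation h \<xi> n \<noteq> (\<lambda>_. 0)} \<subseteq> Suc ` {n. \<xi> n \<noteq> (\<lambda>_. 0)}"
proof
  fix n assume "n \<in> {n. fock_creation h \<xi> n \<noteq> (\<lambda>_. 0)}"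
  then show "n \<in> Suc ` {n. \<xi> n \<noteq> (\<lambda>_. 0)}"
    by (cases n) (auto simp: fock_creation_0 fock_creation_Suc)
qed

lemma measurable_fock_creation:
  assumes "h \<in> sqint U" "measurable_fock \<xi>"
  shows "measurable_fock (fock_creation h \<xi>)"
proof -
  have "fock_creation h \<xi> n \<in> sqint (prod_cube n)" for n
    using sqint_tensor[OF le0 assms(1) measurable_fock_sqint[OF assms(2)]]
    by (cases n) (simp_all add: fock_creation_0 fock_creation_Suc)
  moreover have "finite {n. fock_creation h \<xi> n \<noteq> (\<lambda>_. 0)}"
    by (rule finite_subset[OF fock_support_creation]) (simp add: measurable_fock_finite[OF assms(2)])
  ultimately show ?thesis by (simp add: measurable_fock_def)
qed

lemma fock_version_creation:
  assumes "h \<in> sqint U" "fock_version \<xi> \<xi>'"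
  shows "fock_version (fock_creation h \<xi>) (fock_creation h \<xi>')"
proof -
  have "AE x in prod_cube n. fock_creation h \<xi> n x = fock_creation h \<xi>' n x" for n
  proof (cases n)
    case (Suc m)
    have "AE z in prod_cube m. \<xi> m z = \<xi>' m z"
      using assms(2) by (simp add: fock_version_def)
    from AE_del[OF le0 this] show ?thesis
      unfolding Suc fock_creation_Suc by (rule eventually_mono) simp
  qed (simp add: fock_creation_0)
  then show ?thesis
    using assms measurable_fock_creation by (simp add: fock_version_def)
qed

lemma fock_creation_alg:
  assumes "h \<in> sqint U" "\<xi> \<in> fock_alg"
  shows "fock_creation h \<xi> \<in> fock_alg"
proof -
  obtain \<xi>' where "fock_version \<xi> \<xi>'"
    using assms(2) by (rule fock_alg_version)
  from fock_version_creation[OF assms(1) this] show ?thesis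
    by (rule fock_algI)
      (rule finite_subset[OF fock_support_creation], simp add: fock_alg_finite[OF assms(2)])
qed

lemma measurable_fock_vacuum: "measurable_fock fock_vacuum"
proof -
  have z: "fock_vacuum n = (\<lambda>_. 0)" if "n \<noteq> 0" for n
    using that by (intro ext) (simp add: fock_vacuum_def)
  have o: "fock_vacuum 0 = (\<lambda>_. 1)"
    by (intro ext) (simp add: fock_vacuum_def)
  interpret prob_space "prod_cube 0" by (intro prob_space_PiM) simp
  have "(\<lambda>_. 1) \<in> sqint (prod_cube 0)"
    by (simp add: sqint_def)
  then have "fock_vacuum n \<in> sqint (prod_cube n)" for n
    using z o by (cases "n = 0") simp_all
  moreover have "finite {n. fock_vacuum n \<noteq> (\<lambda>_. 0)}"
    by (rule finite_subset[of _ "{0}"]) (use z in auto)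
  ultimately show ?thesis by (simp add: measurable_fock_def)
qed

lemma measurable_fock_add:
  assumes "measurable_fock \<xi>" "measurable_fock \<eta>"
  shows "measurable_fock (\<lambda>n x. \<xi> n x + \<eta> n x)"
  using fock_version_add[OF fock_version_refl[OF assms(1)] fock_version_refl[OF assms(2)]]
  by (simp add: fock_version_def)

section \<open>The twisted form in terms of measurable versions\<close>

locale twisted_fock = bounded_kernel +
  fixes w :: "real \<Rightarrow> real \<Rightarrow> real" and h :: "real \<Rightarrow> complex"
  assumes w_sym: "\<And>x y. x \<in> {0..1} \<Longrightarrow> y \<in> {0..1} \<Longrightarrow> w x y = w y x"
    and w_eq_v: "AE p in U \<Otimes>\<^sub>M U. w (fst p) (snd p) = v (fst p) (snd p)"
    and h: "h \<in> sqint U"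
begin

lemma AE_w_eq_v: "AE x in prod_cube n. \<forall>i<n. \<forall>j<n. i \<noteq> j \<longrightarrow> w (x i) (x j) = v (x i) (x j)"
proof -
  have "AE x in prod_cube n. \<forall>i\<in>{..<n}. \<forall>j\<in>{..<n}. i \<noteq> j \<longrightarrow> w (x i) (x j) = v (x i) (x j)"
  proof (intro AE_finite_allI finite_lessThan)
    fix i j assume "i \<in> {..<n}" "j \<in> {..<n}"
    then show "AE x in prod_cube n. i \<noteq> j \<longrightarrow> w (x i) (x j) = v (x i) (x j)"
      using AE_two_components[OF w_eq_v, of i "{..<n}" j] by (cases "i = j") simp_all
  qed
  then show ?thesis by (rule eventually_mono) simp
qed

text \<open>The symmetrizer reads \<open>g\<close> at finitely many rearranged points, and each
  rearrangement preserves null sets.\<close>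

lemma twist_sum_AE:
  assumes "AE x in prod_cube n. g x = g' x"
  shows "AE x in prod_cube n. twist_sum w n g x = (\<Sum>\<sigma> | \<sigma> permutes {..<n}. perm_op v n \<sigma> g' x)"
proof -
  have "AE x in prod_cube n. \<forall>\<sigma>\<in>{\<sigma>. \<sigma> permutes {..<n}}. g (x \<circ> \<sigma>) = g' (x \<circ> \<sigma>)"
    by (intro AE_finite_allI finite_permutations finite_lessThan AE_comp_perm[OF _ assms]) simp
  with AE_w_eq_v[of n] AE_space show ?thesis
  proof eventually_elim
    case (elim x)
    show ?case
      unfolding twist_sum_def
    proof (rule sum.cong[OF refl])
      fix \<sigma> assume "\<sigma> \<in> {\<sigma>. \<sigma> permutes {..<n}}"
      then have \<sigma>: "\<sigma> permutes {..<n}" by simp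
      have lt: "\<sigma> j < n" if "j < n" for j
        using permutes_in_image[OF \<sigma>, of j] that by simp
      have "twist_perm w n \<sigma> g x = perm_op w n \<sigma> g x"
        using elim(2) by (intro twist_perm_eq_perm_op[OF w_sym \<sigma>]) (simp_all add: space_PiM PiE_iff)
      also have "\<dots> = perm_op v n \<sigma> g' x"
      proof -
        have "w (x (\<sigma> (fst p))) (x (\<sigma> (snd p))) = v (x (\<sigma> (fst p))) (x (\<sigma> (snd p)))" if "p \<in> invs n \<sigma>" for p
        proof -
          have "\<sigma> (fst p) < n" "\<sigma> (snd p) < n" "\<sigma> (fst p) \<noteq> \<sigma> (snd p)"
            using that by (auto simp: invs_def intro: lt)
          with elim(1) show ?thesis by simp
        qed
        moreover have "g (x \<circ> \<sigma>) = g' (x \<circ> \<sigma>)"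
          using elim(3) \<sigma> by simp
        ultimately show ?thesis
          by (simp add: perm_op_def case_prod_unfold)
      qed
      finally show "twist_perm w n \<sigma> g x = perm_op v n \<sigma> g' x" .
    qed
  qed
qed

lemma L2_inner_twist_sum:
  assumes f': "f' \<in> sqint (prod_cube n)" "AE x in prod_cube n. f x = f' x"
    and g': "g' \<in> sqint (prod_cube n)" "AE x in prod_cube n. g x = g' x"
  shows "L2_inner n f (twist_sum w n g) = sym_inner n f' g'"
proof -
  let ?s = "\<lambda>x. \<Sum>\<sigma> | \<sigma> permutes {..<n}. perm_op v n \<sigma> g' x"
  have s: "?s \<in> sqint (prod_cube n)"
    by (rule sqint_sum) (simp add: perm_op_sqint[OF _ g'(1)])
  have "L2_inner n f (twist_sum w n g) = (LINT x|prod_cube n. f' x * cnj (?s x))"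
    unfolding L2_inner_def cube_def
  proof (rule integral_completion_AE)
    show "(\<lambda>x. f' x * cnj (?s x)) \<in> borel_measurable (prod_cube n)"
      by (intro borel_measurable_times sqintD[OF f'(1)] sqintD[OF sqint_cnj[OF s]])
    show "AE x in prod_cube n. f x * cnj (twist_sum w n g x) = f' x * cnj (?s x)"
      using f'(2) twist_sum_AE[OF g'(2)] by (rule eventually_elim2) (simp only:)
  qed
  also have "\<dots> = (LINT x|prod_cube n. (\<Sum>\<sigma> | \<sigma> permutes {..<n}. f' x * cnj (perm_op v n \<sigma> g' x)))"
    by (simp add: sum_distrib_left)
  also have "\<dots> = sym_inner n f' g'"
    unfolding sym_inner_def
    by (rule Bochner_Integration.integral_sum) (simp add: sym_inner_integrable[OF _ f'(1) g'(1)])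
  finally show ?thesis .
qed

text \<open>The form sums over the support of its first argument. A finite superset \<open>F\<close>
  lets vectors with different supports share one index set.\<close>

lemma fock_form_eq:
  assumes "fock_version \<xi> \<xi>'" "fock_version \<eta> \<eta>'" "finite F" "{n. \<xi> n \<noteq> (\<lambda>_. 0)} \<subseteq> F"
  shows "fock_form w \<xi> \<eta> = (\<Sum>n\<in>F. sym_inner n (\<xi>' n) (\<eta>' n))"
proof -
  have "fock_form w \<xi> \<eta> = (\<Sum>n\<in>F. L2_inner n (\<xi> n) (twist_sum w n (\<eta> n)))"
    unfolding fock_form_def
    by (rule sum.mono_neutral_left[OF assms(3,4)]) (simp add: L2_inner_def)
  also have "\<dots> = (\<Sum>n\<in>F. sym_inner n (\<xi>' n) (\<eta>' n))"
    using assms(1,2) by (intro sum.cong refl L2_inner_twist_sum) (simp_all add: fock_version_def measurable_fock_def)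
  finally show ?thesis .
qed

lemma fock_form_commute:
  assumes "\<xi> \<in> fock_alg" "\<eta> \<in> fock_alg"
  shows "fock_form w \<xi> \<eta> = cnj (fock_form w \<eta> \<xi>)"
proof -
  obtain \<xi>' \<eta>' where v: "fock_version \<xi> \<xi>'" "fock_version \<eta> \<eta>'"
    using fock_alg_version[OF assms(1)] fock_alg_version[OF assms(2)] by metis
  let ?F = "{n. \<xi> n \<noteq> (\<lambda>_. 0)} \<union> {n. \<eta> n \<noteq> (\<lambda>_. 0)}"
  have F: "finite ?F" using assms by (simp add: fock_alg_finite)
  have "sym_inner n (\<xi>' n) (\<eta>' n) = cnj (sym_inner n (\<eta>' n) (\<xi>' n))" for n
    using v by (intro sym_inner_commute) (simp_all add: fock_version_def measurable_fock_def)
  then show ?thesis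
    using fock_form_eq[OF v F] fock_form_eq[OF v(2,1) F] by simp
qed

lemma fock_form_minus_left:
  assumes "\<xi> \<in> fock_alg" "\<eta> \<in> fock_alg" "\<zeta> \<in> fock_alg"
  shows "fock_form w (\<lambda>n x. \<xi> n x - \<eta> n x) \<zeta> = fock_form w \<xi> \<zeta> - fock_form w \<eta> \<zeta>"
proof -
  obtain \<xi>' \<eta>' \<zeta>' where v: "fock_version \<xi> \<xi>'" "fock_version \<eta> \<eta>'" "fock_version \<zeta> \<zeta>'"
    using fock_alg_version[OF assms(1)] fock_alg_version[OF assms(2)] fock_alg_version[OF assms(3)] by metis
  let ?F = "{n. \<xi> n \<noteq> (\<lambda>_. 0)} \<union> {n. \<eta> n \<noteq> (\<lambda>_. 0)}"
  have F: "finite ?F" using assms by (simp add: fock_alg_finite)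
  have "sym_inner n (\<lambda>x. \<xi>' n x - \<eta>' n x) (\<zeta>' n) = sym_inner n (\<xi>' n) (\<zeta>' n) - sym_inner n (\<eta>' n) (\<zeta>' n)" for n
    using v by (intro sym_inner_minus_left) (simp_all add: fock_version_def measurable_fock_def)
  then show ?thesis
    using fock_form_eq[OF v(1,3) F] fock_form_eq[OF v(2,3) F]
      fock_form_eq[OF fock_version_minus[OF v(1,2)] v(3) F fock_support_minus]
    by (simp add: sum_subtractf)
qed

lemma fock_form_add_left:
  assumes "\<xi> \<in> fock_alg" "\<eta> \<in> fock_alg" "\<zeta> \<in> fock_alg"
  shows "fock_form w (\<lambda>n x. \<xi> n x + \<eta> n x) \<zeta> = fock_form w \<xi> \<zeta> + fock_form w \<eta> \<zeta>"
proof -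
  obtain \<xi>' \<eta>' \<zeta>' where v: "fock_version \<xi> \<xi>'" "fock_version \<eta> \<eta>'" "fock_version \<zeta> \<zeta>'"
    using fock_alg_version[OF assms(1)] fock_alg_version[OF assms(2)] fock_alg_version[OF assms(3)] by metis
  let ?F = "{n. \<xi> n \<noteq> (\<lambda>_. 0)} \<union> {n. \<eta> n \<noteq> (\<lambda>_. 0)}"
  have F: "finite ?F" using assms by (simp add: fock_alg_finite)
  have "sym_inner n (\<lambda>x. \<xi>' n x + \<eta>' n x) (\<zeta>' n) = sym_inner n (\<xi>' n) (\<zeta>' n) + sym_inner n (\<eta>' n) (\<zeta>' n)" for n
    using v by (intro sym_inner_add_left) (simp_all add: fock_version_def measurable_fock_def)
  then show ?thesis
    using fock_form_eq[OF v(1,3) F] fock_form_eq[OF v(2,3) F]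
      fock_form_eq[OF fock_version_add[OF v(1,2)] v(3) F fock_support_add]
    by (simp add: sum.distrib)
qed

lemma fock_rel_iff:
  "(\<xi>, \<eta>) \<in> fock_rel w \<longleftrightarrow> \<xi> \<in> fock_alg \<and> \<eta> \<in> fock_alg \<and>
    (\<forall>\<zeta>\<in>fock_alg. fock_form w \<xi> \<zeta> = fock_form w \<eta> \<zeta>)"
  unfolding fock_rel_def fock_kernel_def
  by (auto simp: fock_form_minus_left fock_alg_minus)

text \<open>The kernel of the form is defined through the first argument; Hermitian symmetry extends
  the invariance to the second.\<close>

lemma fock_rel_form:
  assumes "(\<xi>, \<xi>') \<in> fock_rel w" "(\<eta>, \<eta>') \<in> fock_rel w"
  shows "fock_form w \<xi> \<eta> = fock_form w \<xi>' \<eta>'"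
proof -
  have "fock_form w \<xi> \<eta> = fock_form w \<xi>' \<eta>" using assms by (simp add: fock_rel_iff)
  also have "\<dots> = cnj (fock_form w \<eta> \<xi>')"
    using assms by (intro fock_form_commute) (simp_all add: fock_rel_iff)
  also have "\<dots> = cnj (fock_form w \<eta>' \<xi>')" using assms by (simp add: fock_rel_iff)
  also have "\<dots> = fock_form w \<xi>' \<eta>'"
    using assms by (intro fock_form_commute[symmetric]) (simp_all add: fock_rel_iff)
  finally show ?thesis .
qed

section \<open>Classes, creation and its adjoint on the quotient\<close>

abbreviation cls :: "fock_vec \<Rightarrow> fock_vec set" where "cls \<xi> \<equiv> fock_rel w `` {\<xi>}"

lemma equiv_fock_rel: "equiv fock_alg (fock_rel w)"
  by (rule equivI) (auto simp: refl_on_def sym_def trans_def fock_rel_iff)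

lemma cls_eq_iff:
  "\<xi> \<in> fock_alg \<Longrightarrow> \<eta> \<in> fock_alg \<Longrightarrow>
    cls \<xi> = cls \<eta> \<longleftrightarrow> (\<forall>\<zeta>\<in>fock_alg. fock_form w \<xi> \<zeta> = fock_form w \<eta> \<zeta>)"
  by (subst eq_equiv_class_iff[OF equiv_fock_rel]) (simp_all add: fock_rel_iff)

lemma cls_self: "\<xi> \<in> fock_alg \<Longrightarrow> \<xi> \<in> cls \<xi>"
  by (rule equiv_class_self[OF equiv_fock_rel])

lemma cls_in_space: "\<xi> \<in> fock_alg \<Longrightarrow> cls \<xi> \<in> fock_space w"
  unfolding fock_space_def by (rule quotientI)

lemma fock_inner_cls:
  assumes "\<xi> \<in> fock_alg" "\<eta> \<in> fock_alg"
  shows "fock_inner w (cls \<xi>) (cls \<eta>) = fock_form w \<xi> \<eta>"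
proof -
  have "(\<Union>\<xi>'\<in>cls \<xi>. \<Union>\<eta>'\<in>cls \<eta>. {fock_form w \<xi>' \<eta>'}) = {fock_form w \<xi> \<eta>}"
  proof (rule equalityI)
    show "(\<Union>\<xi>'\<in>cls \<xi>. \<Union>\<eta>'\<in>cls \<eta>. {fock_form w \<xi>' \<eta>'}) \<subseteq> {fock_form w \<xi> \<eta>}"
      using fock_rel_form by auto
    show "{fock_form w \<xi> \<eta>} \<subseteq> (\<Union>\<xi>'\<in>cls \<xi>. \<Union>\<eta>'\<in>cls \<eta>. {fock_form w \<xi>' \<eta>'})"
      using cls_self[OF assms(1)] cls_self[OF assms(2)] by blast
  qed
  then show ?thesis by (simp add: fock_inner_def)
qed

lemma fock_add_cls:
  assumes "\<xi> \<in> fock_alg" "\<eta> \<in> fock_alg"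
  shows "fock_add w (cls \<xi>) (cls \<eta>) = cls (\<lambda>n x. \<xi> n x + \<eta> n x)"
proof -
  have "cls (\<lambda>n x. \<xi>' n x + \<eta>' n x) = cls (\<lambda>n x. \<xi> n x + \<eta> n x)" if "\<xi>' \<in> cls \<xi>" "\<eta>' \<in> cls \<eta>" for \<xi>' \<eta>'
    using that assms
    by (subst cls_eq_iff) (simp_all add: fock_rel_iff fock_alg_add fock_form_add_left)
  then show ?thesis
    using cls_self[OF assms(1)] cls_self[OF assms(2)] unfolding fock_add_def by blast
qed

text \<open>Applied to measurable versions, because it integrates over sections, which may fail to
  be measurable for a vector that is measurable only for the completion.\<close>

definition annihilation :: "fock_vec \<Rightarrow> fock_vec" where
  "annihilation \<eta> n = (\<lambda>z. \<Sum>k\<le>n. contract h k (\<eta> (Suc n)) z)"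

lemma measurable_annihilation:
  assumes "measurable_fock \<eta>"
  shows "measurable_fock (annihilation \<eta>)"
proof -
  have "annihilation \<eta> n \<in> sqint (prod_cube n)" for n
    unfolding annihilation_def
    by (intro sqint_sum contract_sqint h measurable_fock_sqint[OF assms]) simp
  moreover have "annihilation \<eta> n = (\<lambda>_. 0)" if "\<eta> (Suc n) = (\<lambda>_. 0)" for n
    unfolding annihilation_def contract_def that by (simp add: front_op_def)
  then have "{n. annihilation \<eta> n \<noteq> (\<lambda>_. 0)} \<subseteq> Suc -` {n. \<eta> n \<noteq> (\<lambda>_. 0)}"
    by auto
  then have "finite {n. annihilation \<eta> n \<noteq> (\<lambda>_. 0)}"
    using finite_vimageI[OF measurable_fock_finite[OF assms] inj_Suc] finite_subset by blast
  ultimately show ?thesis by (simp add: measurable_fock_def)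
qed

lemma fock_form_creation:
  assumes "\<xi> \<in> fock_alg" "fock_version \<eta> \<eta>'"
  shows "fock_form w (fock_creation h \<xi>) \<eta> = fock_form w \<xi> (annihilation \<eta>')"
proof -
  obtain \<xi>' where v: "fock_version \<xi> \<xi>'"
    using assms(1) by (rule fock_alg_version)
  have s: "measurable_fock \<xi>'" "measurable_fock \<eta>'"
    using v assms(2) by (simp_all add: fock_version_def)
  let ?F = "{n. \<xi> n \<noteq> (\<lambda>_. 0)}"
  have F: "finite ?F" using assms(1) by (rule fock_alg_finite)
  have "fock_form w (fock_creation h \<xi>) \<eta> = (\<Sum>n\<in>Suc ` ?F. sym_inner n (fock_creation h \<xi>' n) (\<eta>' n))"
    using F by (intro fock_form_eq[OF fock_version_creation[OF h v] assms(2)] fock_support_creation) simp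
  also have "\<dots> = (\<Sum>n\<in>?F. sym_inner (Suc n) (fock_creation h \<xi>' (Suc n)) (\<eta>' (Suc n)))"
    by (subst sum.reindex) simp_all
  also have "\<dots> = (\<Sum>n\<in>?F. sym_inner n (\<xi>' n) (annihilation \<eta>' n))"
    unfolding fock_creation_Suc annihilation_def
    by (intro sum.cong refl sym_inner_creation h measurable_fock_sqint s)
  also have "\<dots> = fock_form w \<xi> (annihilation \<eta>')"
    by (rule fock_form_eq[OF v fock_version_refl[OF measurable_annihilation[OF s(2)]] F, symmetric]) simp
  finally show ?thesis .
qed

text \<open>A map with an adjoint preserves the kernel of the form: pairing the created vector with
  \<open>\<zeta>\<close> is pairing the original one with the annihilated version of
  \<open>\<zeta>\<close>, which does not see the choice of representative.\<close>

lemma creation_cls: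
  assumes "\<xi> \<in> fock_alg"
  shows "creation w h (cls \<xi>) = cls (fock_creation h \<xi>)"
proof -
  have "cls (fock_creation h \<xi>') = cls (fock_creation h \<xi>)" if "\<xi>' \<in> cls \<xi>" for \<xi>'
  proof (subst cls_eq_iff)
    have r: "(\<xi>, \<xi>') \<in> fock_rel w" using that by simp
    then have \<xi>': "\<xi>' \<in> fock_alg" by (simp add: fock_rel_iff)
    show "fock_creation h \<xi>' \<in> fock_alg" "fock_creation h \<xi> \<in> fock_alg"
      using \<xi>' assms fock_creation_alg[OF h] by simp_all
    show "\<forall>\<zeta>\<in>fock_alg. fock_form w (fock_creation h \<xi>') \<zeta> = fock_form w (fock_creation h \<xi>) \<zeta>"
    proof
      fix \<zeta> assume "\<zeta> \<in> fock_alg"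
      then obtain \<zeta>' where z: "fock_version \<zeta> \<zeta>'" by (rule fock_alg_version)
      then have "annihilation \<zeta>' \<in> fock_alg"
        by (intro measurable_fock_alg measurable_annihilation) (simp add: fock_version_def)
      then show "fock_form w (fock_creation h \<xi>') \<zeta> = fock_form w (fock_creation h \<xi>) \<zeta>"
        using r fock_form_creation[OF \<xi>' z] fock_form_creation[OF assms z] by (simp add: fock_rel_iff)
    qed
  qed
  then show ?thesis
    using cls_self[OF assms] unfolding creation_def by blast
qed

lemma fock_inner_nondegenerate:
  assumes "X \<in> fock_space w" "Y \<in> fock_space w"
    and "\<And>Z. Z \<in> fock_space w \<Longrightarrow> fock_inner w Z X = fock_inner w Z Y"
  shows "X = Y"
proof -
  obtain \<xi> \<eta> where x: "\<xi> \<in> fock_alg" "X = cls \<xi>" and y: "\<eta> \<in> fock_alg" "Y = cls \<eta>"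
    using assms(1,2) unfolding fock_space_def by (auto elim!: quotientE)
  have "fock_form w \<xi> \<zeta> = fock_form w \<eta> \<zeta>" if z: "\<zeta> \<in> fock_alg" for \<zeta>
    using assms(3)[OF cls_in_space[OF z]] fock_form_commute[OF x(1) z] fock_form_commute[OF y(1) z]
    unfolding x y fock_inner_cls[OF z x(1)] fock_inner_cls[OF z y(1)] by simp
  then show ?thesis
    unfolding x y using x y by (subst cls_eq_iff) simp_all
qed

text \<open>The definite description has to be met by an actual map on all classes. One is built by
  choosing a representative and a version in every class; two solutions agree on the space by
  nondegeneracy and are both \<open>undefined\<close> elsewhere.\<close>

lemma fock_adjoint_cls:
  assumes "measurable_fock \<eta>"
  shows "fock_adjoint w (creation w h) (cls \<eta>) = cls (annihilation \<eta>)"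
proof -
  define P where "P S \<longleftrightarrow> S \<in> fock_space w \<rightarrow>\<^sub>E fock_space w \<and>
    (\<forall>X\<in>fock_space w. \<forall>Y\<in>fock_space w. fock_inner w (creation w h X) Y = fock_inner w X (S Y))" for S
  define S where "S = (\<lambda>Y\<in>fock_space w. cls (annihilation (SOME \<zeta>. \<exists>\<eta>. fock_version \<eta> \<zeta> \<and> \<eta> \<in> fock_alg \<and> Y = cls \<eta>)))"
  have S: "\<exists>\<eta> \<zeta>. fock_version \<eta> \<zeta> \<and> \<eta> \<in> fock_alg \<and> Y = cls \<eta> \<and> S Y = cls (annihilation \<zeta>)"
    if Y: "Y \<in> fock_space w" for Y
  proof -
    obtain \<eta> where e: "\<eta> \<in> fock_alg" "Y = cls \<eta>"
      using Y unfolding fock_space_def by (auto elim!: quotientE)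
    obtain \<zeta> where "fock_version \<eta> \<zeta>" using e(1) by (rule fock_alg_version)
    with e have "\<exists>\<zeta> \<eta>. fock_version \<eta> \<zeta> \<and> \<eta> \<in> fock_alg \<and> Y = cls \<eta>" by metis
    from someI_ex[OF this] Y show ?thesis unfolding S_def by auto
  qed
  have an: "annihilation \<zeta> \<in> fock_alg" if "fock_version \<eta> \<zeta>" for \<eta> \<zeta>
    using that by (intro measurable_fock_alg measurable_annihilation) (simp add: fock_version_def)
  have PS: "P S"
    unfolding P_def
  proof (intro conjI ballI PiE_I)
    fix Y assume "Y \<in> fock_space w"
    from S[OF this] obtain \<eta> \<zeta> where e: "fock_version \<eta> \<zeta>" "\<eta> \<in> fock_alg" "Y = cls \<eta>" "S Y = cls (annihilation \<zeta>)"
      by blast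
    show "S Y \<in> fock_space w"
      unfolding e(4) by (rule cls_in_space[OF an[OF e(1)]])
    fix X assume "X \<in> fock_space w"
    then obtain \<xi> where x: "\<xi> \<in> fock_alg" "X = cls \<xi>"
      unfolding fock_space_def by (auto elim!: quotientE)
    show "fock_inner w (creation w h X) Y = fock_inner w X (S Y)"
      unfolding e(4) unfolding x(2) e(3) creation_cls[OF x(1)] fock_inner_cls[OF fock_creation_alg[OF h x(1)] e(2)]
        fock_inner_cls[OF x(1) an[OF e(1)]]
      by (rule fock_form_creation[OF x(1) e(1)])
  qed (simp add: S_def)
  have uniq: "T = T'" if "P T" "P T'" for T T'
  proof (rule ext)
    fix Y
    show "T Y = T' Y"
    proof (cases "Y \<in> fock_space w")
      case True
      show ?thesis
      proof (rule fock_inner_nondegenerate)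
        show "T Y \<in> fock_space w" "T' Y \<in> fock_space w"
          using that True unfolding P_def by (blast dest: PiE_mem)+
        show "fock_inner w Z (T Y) = fock_inner w Z (T' Y)" if "Z \<in> fock_space w" for Z
          using \<open>P T\<close> \<open>P T'\<close> True that unfolding P_def by metis
      qed
    next
      case False
      have "T Y = undefined" "T' Y = undefined"
        using \<open>P T\<close> \<open>P T'\<close> False unfolding P_def by (blast dest: PiE_arb)+
      then show ?thesis by simp
    qed
  qed
  have "P (THE S. P S)"
    by (rule theI[of P, OF PS]) (rule uniq[OF _ PS])
  then have PA: "P (fock_adjoint w (creation w h))"
    unfolding P_def fock_adjoint_def .
  have e: "\<eta> \<in> fock_alg" "fock_version \<eta> \<eta>"
    using assms by (simp_all add: measurable_fock_alg fock_version_refl)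
  show ?thesis
  proof (rule fock_inner_nondegenerate)
    show "fock_adjoint w (creation w h) (cls \<eta>) \<in> fock_space w"
      using PA cls_in_space[OF e(1)] unfolding P_def by (blast dest: PiE_mem)
    show "cls (annihilation \<eta>) \<in> fock_space w"
      by (rule cls_in_space[OF an[OF e(2)]])
    fix Z assume Z: "Z \<in> fock_space w"
    then obtain \<xi> where x: "\<xi> \<in> fock_alg" "Z = cls \<xi>"
      unfolding fock_space_def by (auto elim!: quotientE)
    have "fock_inner w Z (fock_adjoint w (creation w h) (cls \<eta>)) = fock_inner w (creation w h Z) (cls \<eta>)"
      using PA Z cls_in_space[OF e(1)] unfolding P_def by metis
    also have "\<dots> = fock_inner w Z (cls (annihilation \<eta>))"
      unfolding x(2) creation_cls[OF x(1)] fock_inner_cls[OF fock_creation_alg[OF h x(1)] e(1)]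
        fock_inner_cls[OF x(1) an[OF e(2)]]
      by (rule fock_form_creation[OF x(1) e(2)])
    finally show "fock_inner w Z (fock_adjoint w (creation w h) (cls \<eta>)) = fock_inner w Z (cls (annihilation \<eta>))" .
  qed
qed

section \<open>Powers of the field operator applied to the vacuum\<close>

primrec field_iter :: "nat \<Rightarrow> fock_vec" where
  "field_iter 0 = fock_vacuum"
| "field_iter (Suc q) = (\<lambda>n x. fock_creation h (field_iter q) n x + annihilation (field_iter q) n x)"

text \<open>Each iterate is itself a measurable representative, so annihilation can be repeated
  without choosing new versions.\<close>

lemma measurable_field_iter: "measurable_fock (field_iter q)"
  by (induction q)
    (simp_all add: measurable_fock_vacuum measurable_fock_add measurable_fock_creation[OF h] measurable_annihilation)

lemma field_op_iter: "(field_op w h ^^ q) (vacuum w) = cls (field_iter q)"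
proof (induction q)
  case (Suc q)
  note s = measurable_field_iter[of q]
  show ?case
    unfolding funpow.simps comp_apply Suc.IH field_op_def[of w h "cls _"]
      creation_cls[OF measurable_fock_alg[OF s]] fock_adjoint_cls[OF s] field_iter.simps
    by (rule fock_add_cls[OF measurable_fock_alg[OF measurable_fock_creation[OF h s]]
          measurable_fock_alg[OF measurable_annihilation[OF s]]])
qed (simp add: vacuum_def)

text \<open>Only the component of degree 0 meets the vacuum, and P(0) is the identity.\<close>

lemma vacuum_state_field_op:
  "vacuum_state w (field_op w h ^^ q) = (LINT x|prod_cube 0. field_iter q 0 x)"
proof -
  let ?F = "insert 0 {n. field_iter q n \<noteq> (\<lambda>_. 0)}"
  note s = measurable_field_iter[of q]
  have F: "finite ?F" using measurable_fock_finite[OF s] by simp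
  have z: "sym_inner n f (fock_vacuum n) = 0" if "n \<noteq> 0" for n f
    using that unfolding sym_inner_def by (simp add: perm_op_def fock_vacuum_def)
  have o: "sym_inner 0 f (fock_vacuum 0) = (LINT x|prod_cube 0. f x)" for f
    unfolding sym_inner_def by (simp add: perm_op_def fock_vacuum_def)
  have "vacuum_state w (field_op w h ^^ q) = fock_form w (field_iter q) fock_vacuum"
    unfolding vacuum_state_def field_op_iter unfolding vacuum_def
    by (rule fock_inner_cls[OF measurable_fock_alg[OF s] measurable_fock_alg[OF measurable_fock_vacuum]])
  also have "\<dots> = (\<Sum>n\<in>?F. sym_inner n (field_iter q n) (fock_vacuum n))"
    by (rule fock_form_eq[OF fock_version_refl[OF s] fock_version_refl[OF measurable_fock_vacuum] F]) blast
  also have "\<dots> = (\<Sum>n\<in>{0}. sym_inner n (field_iter q n) (fock_vacuum n))"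
    using F by (intro sum.mono_neutral_right) (auto intro: z)
  finally show ?thesis by (simp add: o)
qed

end

section \<open>Partial matchings\<close>

definition partial_matchings :: "nat \<Rightarrow> nat set set set" where
  "partial_matchings q = {\<pi>. disjoint \<pi> \<and> (\<forall>B\<in>\<pi>. card B = 2 \<and> B \<subseteq> {1..q})}"

text \<open>The labels of the particles still present after step \<open>q\<close>.\<close>

definition singles :: "nat \<Rightarrow> nat set set \<Rightarrow> nat set" where
  "singles q \<pi> = {1..q} - \<Union>\<pi>"

lemma pair_block:
  assumes "card (B :: nat set) = 2"
  obtains a b where "a < b" "B = {a, b}" "Min B = a" "Max B = b"
proof -
  obtain a b where "B = {a, b}" "a \<noteq> b" using assms by (meson card_2_iff)
  then show ?thesis
    using that[of a b] that[of b a] by (cases "a < b") (auto simp: insert_commute)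
qed

lemma partial_matchings_block:
  assumes "\<pi> \<in> partial_matchings q" "B \<in> \<pi>"
  obtains a b where "a < b" "B = {a, b}" "Min B = a" "Max B = b" "a \<in> {1..q}" "b \<in> {1..q}"
proof -
  have "card B = 2" "B \<subseteq> {1..q}"
    using assms by (auto simp: partial_matchings_def)
  from pair_block[OF this(1)] this(2) that show ?thesis by (metis insert_subset)
qed

lemma partial_matchings_mem: "\<pi> \<in> partial_matchings q \<Longrightarrow> B \<in> \<pi> \<Longrightarrow> x \<in> B \<Longrightarrow> x \<in> {1..q}"
  unfolding partial_matchings_def by blast

lemma finite_partial_matchings [simp]: "finite (partial_matchings q)"
  by (rule finite_subset[of _ "Pow (Pow {1..q})"]) (auto simp: partial_matchings_def)

lemma partial_matching_finite: "\<pi> \<in> partial_matchings q \<Longrightarrow> finite \<pi>"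
  by (rule finite_subset[of _ "Pow {1..q}"]) (auto simp: partial_matchings_def)

lemma finite_singles [simp]: "finite (singles q \<pi>)"
  by (simp add: singles_def)

lemma singles_subset: "singles q \<pi> \<subseteq> {1..q}"
  by (auto simp: singles_def)

lemma singles_mem: "s \<in> singles q \<pi> \<Longrightarrow> 1 \<le> s \<and> s \<le> q"
  by (simp add: singles_def)

lemma partial_matchings_0: "partial_matchings 0 = {{}}"
proof -
  have "\<pi> = {}" if "\<pi> \<in> partial_matchings 0" for \<pi>
    using that by (auto simp: partial_matchings_def)
  moreover have "{} \<in> partial_matchings 0"
    by (simp add: partial_matchings_def disjoint_def)
  ultimately show ?thesis by blast
qed

lemma Suc_notin_Union: "\<pi> \<in> partial_matchings q \<Longrightarrow> Suc q \<notin> \<Union>\<pi>"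
  using partial_matchings_mem by fastforce

lemma singles_Suc:
  assumes "\<pi> \<in> partial_matchings q"
  shows "singles (Suc q) \<pi> = insert (Suc q) (singles q \<pi>)"
  using Suc_notin_Union[OF assms] by (auto simp: singles_def atLeastAtMostSuc_conv)

lemma singles_insert:
  assumes "s \<in> singles q \<pi>"
  shows "singles (Suc q) (insert {s, Suc q} \<pi>) = singles q \<pi> - {s}"
  using assms by (auto simp: singles_def)

lemma partial_matchings_insert:
  assumes "\<pi> \<in> partial_matchings q" "s \<in> singles q \<pi>"
  shows "insert {s, Suc q} \<pi> \<in> partial_matchings (Suc q)"
proof -
  have "s \<notin> \<Union>\<pi>" "s \<in> {1..q}" using assms(2) by (auto simp: singles_def)
  then have d: "{s, Suc q} \<inter> B = {}" if "B \<in> \<pi>" for B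
    using that Suc_notin_Union[OF assms(1)] by auto
  then have "disjoint (insert {s, Suc q} \<pi>)"
    using assms(1) by (auto simp: partial_matchings_def disjoint_def)
  moreover have "card {s, Suc q} = 2" "{s, Suc q} \<subseteq> {1..Suc q}"
    using \<open>s \<in> {1..q}\<close> by auto
  moreover have "B \<subseteq> {1..Suc q} \<and> card B = 2" if "B \<in> \<pi>" for B
    using assms(1) that by (fastforce simp: partial_matchings_def)
  ultimately show ?thesis
    unfolding partial_matchings_def by blast
qed

text \<open>The last point stays unmatched, which corresponds to creation, or closes an unmatched
  point \<open>s\<close>, which corresponds to the annihilation of particle
  \<open>s\<close>.\<close>

lemma partial_matchings_Suc:
  "partial_matchings (Suc q) = partial_matchings q \<union>
    (\<lambda>(\<pi>, s). insert {s, Suc q} \<pi>) ` (SIGMA \<pi>:partial_matchings q. singles q \<pi>)" (is "_ = _ \<union> ?I")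
proof (intro equalityI subsetI)
  fix \<rho> assume \<rho>: "\<rho> \<in> partial_matchings (Suc q)"
  show "\<rho> \<in> partial_matchings q \<union> ?I"
  proof (cases "Suc q \<in> \<Union>\<rho>")
    case False
    have "B \<subseteq> {1..q}" if "B \<in> \<rho>" for B
    proof
      fix x assume "x \<in> B"
      then have "x \<in> {1..Suc q}" "x \<noteq> Suc q"
        using partial_matchings_mem[OF \<rho> that] that False by blast+
      then show "x \<in> {1..q}" by simp
    qed
    then show ?thesis
      using \<rho> by (auto simp: partial_matchings_def)
  next
    case True
    then obtain B where B: "B \<in> \<rho>" "Suc q \<in> B" by blast
    obtain a b where ab: "a < b" "B = {a, b}" "a \<in> {1..Suc q}" "b \<in> {1..Suc q}"
      using partial_matchings_block[OF \<rho> B(1)] by metis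
    then have b: "b = Suc q" "a \<in> {1..q}" using B(2) by auto
    have disj: "C \<inter> B = {}" if "C \<in> \<rho>" "C \<noteq> B" for C
      using \<rho> B that by (auto simp: partial_matchings_def disjoint_def)
    have "\<rho> - {B} \<in> partial_matchings q"
    proof -
      have "C \<subseteq> {1..q}" if C: "C \<in> \<rho> - {B}" for C
      proof
        fix x assume "x \<in> C"
        then have "x \<in> {1..Suc q}" "x \<noteq> Suc q"
          using partial_matchings_mem[OF \<rho>, of C x] C disj[of C] B(2) by blast+
        then show "x \<in> {1..q}" by simp
      qed
      then show ?thesis
        using \<rho> by (auto simp: partial_matchings_def disjoint_def)
    qed
    moreover have "a \<in> singles q (\<rho> - {B})"
      using disj b(2) ab(2) by (auto simp: singles_def)
    moreover have "\<rho> = insert {a, Suc q} (\<rho> - {B})"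
      using B(1) ab(2) b(1) by auto
    ultimately show ?thesis
      by (intro UnI2 image_eqI[of _ _ "(\<rho> - {B}, a)"] SigmaI) (simp only: case_prod_conv)
  qed
next
  fix \<rho> assume "\<rho> \<in> partial_matchings q \<union> ?I"
  then show "\<rho> \<in> partial_matchings (Suc q)"
  proof
    assume "\<rho> \<in> partial_matchings q"
    then show ?thesis by (fastforce simp: partial_matchings_def)
  qed (auto simp: partial_matchings_insert)
qed

lemma sum_partial_matchings_Suc:
  fixes F :: "nat set set \<Rightarrow> 'b::comm_monoid_add"
  shows "(\<Sum>\<pi>\<in>partial_matchings (Suc q). F \<pi>) =
    (\<Sum>\<pi>\<in>partial_matchings q. F \<pi>) + (\<Sum>\<pi>\<in>partial_matchings q. \<Sum>s\<in>singles q \<pi>. F (insert {s, Suc q} \<pi>))"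
proof -
  let ?S = "SIGMA \<pi>:partial_matchings q. singles q \<pi>" and ?f = "\<lambda>(\<pi>, s). insert {s, Suc q} \<pi>"
  have inj: "inj_on ?f ?S"
  proof (rule inj_onI)
    fix a b assume a: "a \<in> ?S" and b: "b \<in> ?S" and e: "?f a = ?f b"
    obtain \<pi> s \<rho> t where ab: "a = (\<pi>, s)" "b = (\<rho>, t)" by fastforce
    have m: "\<pi> \<in> partial_matchings q" "\<rho> \<in> partial_matchings q" "s \<in> {1..q}" "t \<in> {1..q}"
      using a b singles_mem unfolding ab by auto
    have e': "insert {s, Suc q} \<pi> = insert {t, Suc q} \<rho>" using e ab by simp
    have n: "B \<notin> \<pi>" "B \<notin> \<rho>" if "Suc q \<in> B" for B
      using Suc_notin_Union[OF m(1)] Suc_notin_Union[OF m(2)] that by auto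
    have "{s, Suc q} \<in> insert {t, Suc q} \<rho>" using e' by blast
    then have "{s, Suc q} = {t, Suc q}" using n(2)[of "{s, Suc q}"] by simp
    then have "s = t" by (auto simp: doubleton_eq_iff)
    moreover have "\<pi> = \<rho>"
      using e' n(1)[of "{t, Suc q}"] n(2)[of "{t, Suc q}"] unfolding \<open>s = t\<close>
      by (simp add: insert_ident)
    ultimately show "a = b" using ab by simp
  qed
  have disj: "partial_matchings q \<inter> ?f ` ?S = {}"
  proof -
    have "insert {s, Suc q} \<pi> \<notin> partial_matchings q" for \<pi> s
      using Suc_notin_Union[of "insert {s, Suc q} \<pi>" q] by blast
    then show ?thesis by auto
  qed
  have "finite ?S" by (intro finite_SigmaI) simp_all
  have "(\<Sum>\<pi>\<in>partial_matchings (Suc q). F \<pi>) = (\<Sum>\<pi>\<in>partial_matchings q. F \<pi>) + (\<Sum>\<pi>\<in>?f ` ?S. F \<pi>)"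
    unfolding partial_matchings_Suc using \<open>finite ?S\<close> disj by (intro sum.union_disjoint) auto
  also have "(\<Sum>\<pi>\<in>?f ` ?S. F \<pi>) = (\<Sum>(\<pi>, s)\<in>?S. F (insert {s, Suc q} \<pi>))"
    by (subst sum.reindex[OF inj]) (simp add: case_prod_unfold)
  also have "\<dots> = (\<Sum>\<pi>\<in>partial_matchings q. \<Sum>s\<in>singles q \<pi>. F (insert {s, Suc q} \<pi>))"
    by (rule sum.Sigma[symmetric]) simp_all
  finally show ?thesis .
qed

lemma pair_partitions_eq: "pair_partitions p = {\<pi> \<in> partial_matchings p. singles p \<pi> = {}}"
proof (intro equalityI subsetI)
  fix \<pi> assume "\<pi> \<in> pair_partitions p"
  then show "\<pi> \<in> {\<pi> \<in> partial_matchings p. singles p \<pi> = {}}"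
    by (auto simp: pair_partitions_def partition_on_def partial_matchings_def singles_def)
next
  fix \<pi> assume "\<pi> \<in> {\<pi> \<in> partial_matchings p. singles p \<pi> = {}}"
  then have \<pi>: "\<pi> \<in> partial_matchings p" and s: "{1..p} \<subseteq> \<Union>\<pi>"
    by (auto simp: singles_def)
  have "\<Union>\<pi> \<subseteq> {1..p}" "{} \<notin> \<pi>" "disjoint \<pi>" "\<forall>B\<in>\<pi>. card B = 2"
    using \<pi> by (auto simp: partial_matchings_def)
  with s show "\<pi> \<in> pair_partitions p"
    by (auto simp: pair_partitions_def partition_on_def)
qed

text \<open>The times at which particles are created. The opener of a block carries the variable of
  the block, its closer carries none.\<close>

definition openers :: "nat \<Rightarrow> nat set set \<Rightarrow> nat set" where
  "openers q \<pi> = Min ` \<pi> \<union> singles q \<pi>"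

lemma openers_subset: "\<pi> \<in> partial_matchings q \<Longrightarrow> openers q \<pi> \<subseteq> {1..q}"
proof -
  have "Min B \<in> {1..q}" if "\<pi> \<in> partial_matchings q" "B \<in> \<pi>" for B
    using partial_matchings_block[OF that] by metis
  then show "openers q \<pi> \<subseteq> {1..q}" if "\<pi> \<in> partial_matchings q"
    using that singles_subset unfolding openers_def by blast
qed

lemma openers_Suc: "\<pi> \<in> partial_matchings q \<Longrightarrow> openers (Suc q) \<pi> = insert (Suc q) (openers q \<pi>)"
  by (simp add: openers_def singles_Suc)

lemma openers_insert:
  assumes "s \<in> singles q \<pi>"
  shows "openers (Suc q) (insert {s, Suc q} \<pi>) = openers q \<pi>"
proof -
  have "s \<le> q" using assms singles_mem by blast
  then have "Min {s, Suc q} = s" by simp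
  with assms show ?thesis by (auto simp: openers_def singles_insert)
qed

lemma inj_on_Min:
  assumes "\<pi> \<in> partial_matchings q"
  shows "inj_on Min \<pi>"
proof (rule inj_onI)
  fix B C assume BC: "B \<in> \<pi>" "C \<in> \<pi>" "Min B = Min C"
  have "Min B \<in> B" "Min C \<in> C"
    using partial_matchings_block[OF assms BC(1)] partial_matchings_block[OF assms BC(2)] by (metis insertI1)+
  then have "B \<inter> C \<noteq> {}" using BC(3) by auto
  then show "B = C" using assms BC by (auto simp: partial_matchings_def disjoint_def)
qed

text \<open>\<open>Suc q\<close> exceeds every point of \<open>u\<close>, so the only interlacing
  left is Min u < s < Max u < Suc q.\<close>

lemma crossing_last:
  assumes \<pi>: "\<pi> \<in> partial_matchings q" and s: "s \<in> singles q \<pi>" and u: "u \<in> \<pi>"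
  shows "crossing {s, Suc q} u \<longleftrightarrow> Min u < s \<and> s < Max u"
    and "crossing u {s, Suc q} \<longleftrightarrow> Min u < s \<and> s < Max u"
proof -
  obtain a b where ab: "a < b" "u = {a, b}" "Min u = a" "Max u = b" "a \<in> {1..q}" "b \<in> {1..q}"
    using partial_matchings_block[OF \<pi> u] .
  have "s \<le> q" using s singles_mem by blast
  have 1: "crossing {s, Suc q} u" if "a < s" "s < b"
    unfolding crossing_def using that ab by (intro exI[of _ a] exI[of _ s] exI[of _ b] exI[of _ "Suc q"]) auto
  have 2: "a < s \<and> s < b" if cr: "crossing {s, Suc q} u"
  proof -
    obtain i k j l where o: "i < k" "k < j" "j < l"
      and c: "{i, j} \<subseteq> {s, Suc q} \<and> {k, l} \<subseteq> {a, b} \<or> {i, j} \<subseteq> {a, b} \<and> {k, l} \<subseteq> {s, Suc q}"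
      using cr unfolding crossing_def ab(2) by (elim exE conjE) (rule that)
    from c show ?thesis
    proof
      assume c: "{i, j} \<subseteq> {s, Suc q} \<and> {k, l} \<subseteq> {a, b}"
      then have "j = Suc q" "l \<le> q"
        using o ab(5,6) \<open>s \<le> q\<close> by auto
      with o(3) show ?thesis by simp
    next
      assume c: "{i, j} \<subseteq> {a, b} \<and> {k, l} \<subseteq> {s, Suc q}"
      then have "i = a \<or> i = b" "j = a \<or> j = b" "k = s \<or> k = Suc q" "l = s \<or> l = Suc q"
        by simp_all
      with o ab(1) \<open>s \<le> q\<close> show ?thesis by linarith
    qed
  qed
  have sym: "crossing u {s, Suc q} \<longleftrightarrow> crossing {s, Suc q} u"
    unfolding crossing_def by blast
  show "crossing {s, Suc q} u \<longleftrightarrow> Min u < s \<and> s < Max u"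
    using 1 2 ab by auto
  then show "crossing u {s, Suc q} \<longleftrightarrow> Min u < s \<and> s < Max u"
    unfolding sym .
qed

lemma crossing_edges_insert:
  assumes \<pi>: "\<pi> \<in> partial_matchings q" and s: "s \<in> singles q \<pi>"
  shows "crossing_edges (insert {s, Suc q} \<pi>) =
    crossing_edges \<pi> \<union> (\<lambda>u. {{s, Suc q}, u}) ` {u \<in> \<pi>. Min u < s \<and> s < Max u}"
proof -
  have n: "{s, Suc q} \<notin> \<pi>" using Suc_notin_Union[OF \<pi>] by auto
  show ?thesis
    unfolding crossing_edges_def
  proof (intro equalityI subsetI)
    fix e assume "e \<in> {{u, v} |u v. u \<in> insert {s, Suc q} \<pi> \<and> v \<in> insert {s, Suc q} \<pi> \<and> u \<noteq> v \<and> crossing u v}"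
    then obtain u v where uv: "e = {u, v}" "u \<in> insert {s, Suc q} \<pi>" "v \<in> insert {s, Suc q} \<pi>" "u \<noteq> v" "crossing u v"
      by blast
    consider "u = {s, Suc q}" "v \<in> \<pi>" | "v = {s, Suc q}" "u \<in> \<pi>" | "u \<in> \<pi>" "v \<in> \<pi>"
      using uv by blast
    then show "e \<in> {{u, v} |u v. u \<in> \<pi> \<and> v \<in> \<pi> \<and> u \<noteq> v \<and> crossing u v} \<union>
        (\<lambda>u. {{s, Suc q}, u}) ` {u \<in> \<pi>. Min u < s \<and> s < Max u}"
    proof cases
      case 1
      then show ?thesis using uv crossing_last(1)[OF \<pi> s, of v] by blast
    next
      case 2
      then show ?thesis using uv crossing_last(2)[OF \<pi> s, of u] by blast
    next
      case 3
      then show ?thesis using uv by blast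
    qed
  next
    fix e assume "e \<in> {{u, v} |u v. u \<in> \<pi> \<and> v \<in> \<pi> \<and> u \<noteq> v \<and> crossing u v} \<union>
        (\<lambda>u. {{s, Suc q}, u}) ` {u \<in> \<pi>. Min u < s \<and> s < Max u}"
    then show "e \<in> {{u, v} |u v. u \<in> insert {s, Suc q} \<pi> \<and> v \<in> insert {s, Suc q} \<pi> \<and> u \<noteq> v \<and> crossing u v}"
    proof
      assume "e \<in> (\<lambda>u. {{s, Suc q}, u}) ` {u \<in> \<pi>. Min u < s \<and> s < Max u}"
      then obtain u where u: "e = {{s, Suc q}, u}" "u \<in> \<pi>" "Min u < s \<and> s < Max u" by blast
      then have "crossing {s, Suc q} u" using crossing_last(1)[OF \<pi> s] by blast
      with u n show ?thesis by blast
    qed blast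
  qed
qed

section \<open>Weights of partial matchings\<close>

lemma edge_weight_pair:
  assumes "w (x u) (x t) = w (x t) (x u)"
  shows "edge_weight w x {u, t} = w (x u) (x t)"
proof -
  have "{w (x u') (x t') |u' t'. {u, t} = {u', t'}} = {w (x u) (x t)}"
    using assms by (auto simp: doubleton_eq_iff)
  then show ?thesis by (simp add: edge_weight_def)
qed

lemma finite_crossing_edges: "finite \<pi> \<Longrightarrow> finite (crossing_edges \<pi>)"
  by (rule finite_subset[of _ "Pow \<pi>"]) (auto simp: crossing_edges_def)

text \<open>The second factor accounts for the crossings of the blocks with the still unmatched points,
  which will be matched to later points.\<close>

definition match_weight :: "(real \<Rightarrow> real \<Rightarrow> real) \<Rightarrow> nat \<Rightarrow> nat set set \<Rightarrow> (nat \<Rightarrow> real) \<Rightarrow> real" where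
  "match_weight v q \<pi> x = (\<Prod>e\<in>crossing_edges \<pi>. edge_weight v (\<lambda>u. x (Min u)) e) *
    (\<Prod>u\<in>\<pi>. \<Prod>s\<in>singles q \<pi>. if Min u < s \<and> s < Max u then v (x (Min u)) (x s) else 1)"

text \<open>The new point lies to the right of every block, so it adds only factors 1.\<close>

lemma match_weight_Suc:
  assumes \<pi>: "\<pi> \<in> partial_matchings q"
  shows "match_weight v (Suc q) \<pi> x = match_weight v q \<pi> x"
proof -
  have n: "Suc q \<notin> singles q \<pi>" using singles_mem by fastforce
  have m: "\<not> Suc q < Max u" if "u \<in> \<pi>" for u
    using partial_matchings_block[OF \<pi> that] by (metis atLeastAtMost_iff le_imp_less_Suc less_asym)
  have "(\<Prod>s\<in>singles (Suc q) \<pi>. if Min u < s \<and> s < Max u then v (x (Min u)) (x s) else 1) =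
      (\<Prod>s\<in>singles q \<pi>. if Min u < s \<and> s < Max u then v (x (Min u)) (x s) else 1)" if "u \<in> \<pi>" for u
    unfolding singles_Suc[OF \<pi>] prod.insert[OF finite_singles n] using m[OF that] by simp
  then show ?thesis by (simp add: match_weight_def)
qed

lemma match_weight_cong:
  assumes \<pi>: "\<pi> \<in> partial_matchings q" and "\<And>i. i \<in> {1..q} \<Longrightarrow> x i = y i"
  shows "match_weight v q \<pi> x = match_weight v q \<pi> y"
proof -
  have m: "x (Min u) = y (Min u)" if "u \<in> \<pi>" for u
    using partial_matchings_block[OF \<pi> that] assms(2) by metis
  have "edge_weight v (\<lambda>u. x (Min u)) e = edge_weight v (\<lambda>u. y (Min u)) e" if "e \<in> crossing_edges \<pi>" for e
  proof -
    have "e \<subseteq> \<pi>" using that by (auto simp: crossing_edges_def)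
    have "{v (x (Min a)) (x (Min b)) |a b. e = {a, b}} = {v (y (Min a)) (y (Min b)) |a b. e = {a, b}}"
    proof (intro Collect_cong ex_cong1)
      fix r a b
      show "(r = v (x (Min a)) (x (Min b)) \<and> e = {a, b}) = (r = v (y (Min a)) (y (Min b)) \<and> e = {a, b})"
      proof (cases "e = {a, b}")
        case True
        then have "a \<in> \<pi>" "b \<in> \<pi>" using \<open>e \<subseteq> \<pi>\<close> by auto
        then show ?thesis by (simp add: m)
      qed simp
    qed
    then show ?thesis by (simp add: edge_weight_def)
  qed
  moreover have "x s = y s" if "s \<in> singles q \<pi>" for s
    using that singles_subset assms(2) by blast
  ultimately show ?thesis
    unfolding match_weight_def using m by (intro arg_cong2[where f="(*)"] prod.cong refl) simp_all
qed

text \<open>When \<open>s\<close> is matched, its factors with the blocks of \<open>\<pi>\<close>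
  move from the second product to the crossings with the block \<open>{s, Suc q}\<close>. New are
  the pairs of that block with the unmatched \<open>t > s\<close>, all of which lie below
  \<open>Suc q\<close>: these are the particles in front of \<open>s\<close>.\<close>

lemma match_weight_insert:
  assumes \<pi>: "\<pi> \<in> partial_matchings q" and s: "s \<in> singles q \<pi>" and sym: "\<And>a b. v a b = v b a"
  shows "match_weight v (Suc q) (insert {s, Suc q} \<pi>) x =
    match_weight v q \<pi> x * (\<Prod>t\<in>{t \<in> singles q \<pi>. s < t}. v (x t) (x s))"
proof -
  let ?b = "{s, Suc q}" and ?S = "singles q \<pi>" and ?X = "\<lambda>u. x (Min u)"
  let ?c = "\<lambda>u t. Min u < t \<and> t < Max u"
  let ?g = "\<lambda>u t. if ?c u t then v (x (Min u)) (x t) else 1"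
  have sq: "s \<le> q" using s singles_mem by blast
  then have mb: "Min ?b = s" "Max ?b = Suc q" by auto
  have n: "?b \<notin> \<pi>" using Suc_notin_Union[OF \<pi>] by auto
  note fin = partial_matching_finite[OF \<pi>]
  have "(\<Prod>e\<in>crossing_edges (insert ?b \<pi>). edge_weight v ?X e) =
      (\<Prod>e\<in>crossing_edges \<pi>. edge_weight v ?X e) * (\<Prod>e\<in>(\<lambda>u. {?b, u}) ` {u \<in> \<pi>. ?c u s}. edge_weight v ?X e)"
    unfolding crossing_edges_insert[OF \<pi> s]
  proof (rule prod.union_disjoint)
    show "crossing_edges \<pi> \<inter> (\<lambda>u. {?b, u}) ` {u \<in> \<pi>. ?c u s} = {}"
    proof -
      have "e \<subseteq> \<pi>" if "e \<in> crossing_edges \<pi>" for e using that by (auto simp: crossing_edges_def)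
      with n show ?thesis by blast
    qed
  qed (use fin finite_crossing_edges[OF fin] in simp_all)
  also have "(\<Prod>e\<in>(\<lambda>u. {?b, u}) ` {u \<in> \<pi>. ?c u s}. edge_weight v ?X e) =
      (\<Prod>u\<in>{u \<in> \<pi>. ?c u s}. edge_weight v ?X {?b, u})"
  proof (subst prod.reindex)
    show "inj_on (\<lambda>u. {?b, u}) {u \<in> \<pi>. ?c u s}"
      by (rule inj_onI) (auto simp: doubleton_eq_iff)
  qed simp
  also have "\<dots> = (\<Prod>u\<in>{u \<in> \<pi>. ?c u s}. v (x (Min u)) (x s))"
    by (rule prod.cong[OF refl]) (use sym mb in \<open>simp add: edge_weight_pair[of v ?X, OF sym]\<close>)
  also have "\<dots> = (\<Prod>u\<in>\<pi>. ?g u s)"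
    using fin by (subst prod.inter_filter) simp_all
  finally have 1: "(\<Prod>e\<in>crossing_edges (insert ?b \<pi>). edge_weight v ?X e) =
      (\<Prod>e\<in>crossing_edges \<pi>. edge_weight v ?X e) * (\<Prod>u\<in>\<pi>. ?g u s)" .
  have "(\<Prod>u\<in>insert ?b \<pi>. \<Prod>t\<in>?S - {s}. ?g u t) =
      (\<Prod>t\<in>?S - {s}. ?g ?b t) * (\<Prod>u\<in>\<pi>. \<Prod>t\<in>?S - {s}. ?g u t)"
    using fin n by (rule prod.insert)
  also have "(\<Prod>t\<in>?S - {s}. ?g ?b t) = (\<Prod>t\<in>{t \<in> ?S. s < t}. v (x t) (x s))"
  proof -
    have "(\<Prod>t\<in>?S - {s}. ?g ?b t) = (\<Prod>t\<in>?S - {s}. if s < t then v (x t) (x s) else 1)"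
    proof (rule prod.cong[OF refl])
      fix t assume "t \<in> ?S - {s}"
      then have "t < Suc q" using singles_mem[of t q \<pi>] by simp
      then show "?g ?b t = (if s < t then v (x t) (x s) else 1)"
        unfolding mb using sym by simp
    qed
    also have "\<dots> = (\<Prod>t\<in>{t \<in> ?S - {s}. s < t}. v (x t) (x s))"
      by (subst prod.inter_filter) simp_all
    also have "{t \<in> ?S - {s}. s < t} = {t \<in> ?S. s < t}" by auto
    finally show ?thesis .
  qed
  finally have 2: "(\<Prod>u\<in>insert ?b \<pi>. \<Prod>t\<in>?S - {s}. ?g u t) =
      (\<Prod>t\<in>{t \<in> ?S. s < t}. v (x t) (x s)) * (\<Prod>u\<in>\<pi>. \<Prod>t\<in>?S - {s}. ?g u t)" .
  have 3: "(\<Prod>u\<in>\<pi>. \<Prod>t\<in>?S. ?g u t) = (\<Prod>u\<in>\<pi>. ?g u s) * (\<Prod>u\<in>\<pi>. \<Prod>t\<in>?S - {s}. ?g u t)"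
    unfolding prod.distrib[symmetric] by (rule prod.cong[OF refl], rule prod.remove[OF finite_singles s])
  show ?thesis
    unfolding match_weight_def singles_insert[OF s] 1 2 3 by (simp only: mult_ac)
qed

text \<open>The newest label comes first, since creation inserts the new coordinate at position 0.\<close>

definition desc_list :: "nat set \<Rightarrow> nat list" where
  "desc_list S = rev (sorted_list_of_set S)"

lemma desc_list_unique:
  assumes "sorted_wrt (>) L" "set L = S"
  shows "desc_list S = L"
proof -
  have "sorted_wrt (<) (rev L)"
    using assms(1) by (simp add: sorted_wrt_rev)
  moreover have "finite S" using assms(2) by auto
  ultimately have "sorted_list_of_set S = rev L"
    using assms(2) by (intro strict_sorted_equal) simp_all
  then show ?thesis by (simp add: desc_list_def)
qed

lemma set_desc_list [simp]: "finite S \<Longrightarrow> set (desc_list S) = S"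
  by (simp add: desc_list_def)

lemma length_desc_list [simp]: "length (desc_list S) = card S"
  by (simp add: desc_list_def)

lemma sorted_desc_list: "sorted_wrt (>) (desc_list S)"
  by (simp add: desc_list_def sorted_wrt_rev)

lemma distinct_desc_list: "distinct (desc_list S)"
  by (simp add: desc_list_def)

lemma desc_list_Suc:
  assumes "S \<subseteq> {1..q}"
  shows "desc_list (insert (Suc q) S) = Suc q # desc_list S"
proof -
  have "finite S" using assms finite_subset by blast
  then show ?thesis
    using assms by (intro desc_list_unique) (auto simp: sorted_desc_list)
qed

lemma desc_list_remove:
  assumes "finite S" "k < card S"
  shows "desc_list (S - {desc_list S ! k}) = take k (desc_list S) @ drop (Suc k) (desc_list S)"
proof (rule desc_list_unique)
  let ?L = "desc_list S"
  have L: "?L = take k ?L @ ?L ! k # drop (Suc k) ?L"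
    using assms by (intro id_take_nth_drop) simp
  have "sorted_wrt (>) (take k ?L @ ?L ! k # drop (Suc k) ?L)"
    using sorted_desc_list[of S] L by simp
  then show "sorted_wrt (>) (take k ?L @ drop (Suc k) ?L)"
    by (simp add: sorted_wrt_append)
  have "distinct (take k ?L @ ?L ! k # drop (Suc k) ?L)"
    using distinct_desc_list[of S] L by simp
  moreover have "S = set (take k ?L @ ?L ! k # drop (Suc k) ?L)"
    using set_desc_list[OF assms(1)] L by simp
  ultimately show "set (take k ?L @ drop (Suc k) ?L) = S - {?L ! k}"
    by auto
qed

text \<open>Turns positions in the tensor product into the order of creation: the \<open>k\<close>
  entries in front of position \<open>k\<close> are exactly the particles created later.\<close>

lemma desc_list_take:
  assumes "finite S" "k < card S"
  shows "bij_betw ((!) (desc_list S)) {..<k} {t \<in> S. desc_list S ! k < t}"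
proof -
  let ?L = "desc_list S"
  have dec: "?L ! j < ?L ! i" if "i < j" "j < card S" for i j
    using sorted_wrt_nth_less[OF sorted_desc_list that(1), of S] that by simp
  show ?thesis
  proof (rule bij_betw_imageI)
    show "inj_on ((!) ?L) {..<k}"
      using assms distinct_desc_list[of S] by (auto simp: inj_on_def nth_eq_iff_index_eq)
    show "(!) ?L ` {..<k} = {t \<in> S. ?L ! k < t}"
    proof (intro equalityI subsetI)
      fix t assume "t \<in> (!) ?L ` {..<k}"
      then obtain j where j: "j < k" "t = ?L ! j" by blast
      then have "?L ! j \<in> set ?L" using assms by (intro nth_mem) simp
      then show "t \<in> {t \<in> S. ?L ! k < t}"
        using j dec[OF j(1) assms(2)] assms(1) by simp
    next
      fix t assume t: "t \<in> {t \<in> S. ?L ! k < t}"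
      then have "t \<in> set ?L" using assms(1) by simp
      then obtain j where j: "j < card S" "?L ! j = t" by (auto simp: in_set_conv_nth)
      have "j < k"
      proof (rule ccontr)
        assume "\<not> j < k"
        then consider "j = k" | "k < j" by linarith
        then show False using dec[of k j] j t by cases auto
      qed
      with j show "t \<in> (!) ?L ` {..<k}" by blast
    qed
  qed
qed

text \<open>Passes from variables labelled by creation times to coordinates labelled by positions in
  the tensor product.\<close>

definition select :: "nat list \<Rightarrow> (nat \<Rightarrow> real) \<Rightarrow> nat \<Rightarrow> real" where
  "select L x = (\<lambda>i\<in>{..<length L}. x (L ! i))"

lemma select_remove:
  assumes "k \<le> n" "length L = Suc n"
  shows "select (take k L @ drop (Suc k) L) x = del n k (select L x)"
proof (rule ext)
  fix i
  show "select (take k L @ drop (Suc k) L) x i = del n k (select L x) i"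
    using assms by (simp add: select_def del_def nth_append min_def)
qed

lemma select_Cons: "select (t # L) x = ins 0 (x t) (select L x)"
proof (rule ext)
  fix i
  show "select (t # L) x i = ins 0 (x t) (select L x) i"
    by (cases i) (simp_all add: select_def ins_def)
qed

section \<open>Moments as sums over partial matchings\<close>

text \<open>One variable for every time, openers and closers alike, so that all matchings of
  \<open>{1..q}\<close> share one measure space. The variables of closers are dummies that integrate
  to total mass 1.\<close>

abbreviation label_cube :: "nat \<Rightarrow> (nat \<Rightarrow> real) measure" where
  "label_cube q \<equiv> Pi\<^sub>M {1..q} (\<lambda>_. U)"

lemma label_cube_Suc: "label_cube (Suc q) = Pi\<^sub>M (insert (Suc q) {1..q}) (\<lambda>_. U)"
  by (simp add: atLeastAtMostSuc_conv)

lemma measurable_select: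
  assumes "set L \<subseteq> {1..q}"
  shows "select L \<in> label_cube q \<rightarrow>\<^sub>M prod_cube (length L)"
  unfolding select_def
proof (rule measurable_restrict)
  fix i assume "i \<in> {..<length L}"
  then have "L ! i \<in> {1..q}" using assms nth_mem by blast
  then show "(\<lambda>x. x (L ! i)) \<in> label_cube q \<rightarrow>\<^sub>M U"
    by (rule measurable_component_singleton)
qed

lemma select_cong: "(\<And>t. t \<in> set L \<Longrightarrow> x t = y t) \<Longrightarrow> select L x = select L y"
  by (auto simp: select_def fun_eq_iff)

lemma prod_del:
  fixes f :: "nat \<Rightarrow> complex"
  assumes "k \<le> n"
  shows "(\<Prod>i<Suc n. f i) = f k * (\<Prod>i<n. f (if i < k then i else Suc i))"
proof -
  have "bij_betw (\<lambda>i. if i < k then i else Suc i) {..<n} ({..<Suc n} - {k})"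
    by (rule bij_betw_byWitness[where f' = "\<lambda>i. if i < k then i else i - 1"]) (use assms in \<open>auto split: if_splits\<close>)
  from prod.reindex_bij_betw[OF this, of f] show ?thesis
    using assms by (subst prod.remove[of _ k]) simp_all
qed

lemma ins_0_Suc: "ins 0 y z (Suc i) = z i"
  by (simp add: ins_def)

lemma sqint_cmult: "f \<in> sqint M \<Longrightarrow> (\<lambda>x. c * f x) \<in> sqint M"
  using borel_measurable_times[OF borel_measurable_const[of c M] sqintD[of f M]]
  by (simp add: sqint_def norm_mult power_mult_distrib)

lemma measurable_complex_of_real:
  assumes "f \<in> borel_measurable M"
  shows "(\<lambda>x. complex_of_real (f x)) \<in> borel_measurable M"
  using assms by measurable

lemma integral_const_U: "(LINT y|U. c) = (c :: complex)"
  unfolding lebesgue_integral_const U.prob_space by simp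

section \<open>Bounds and integrability of the weights\<close>

context twisted_fock
begin

lemma v_edge_weight: "edge_weight v x {a, b} = v (x a) (x b)"
  by (rule edge_weight_pair) (rule v_sym)

lemma edge_measurable:
  assumes "\<And>u. u \<in> \<pi> \<Longrightarrow> (\<lambda>x. f x u) \<in> M \<rightarrow>\<^sub>M U"
  shows "(\<lambda>x. \<Prod>e\<in>crossing_edges \<pi>. edge_weight v (f x) e) \<in> borel_measurable M"
proof (rule borel_measurable_prod)
  fix e assume "e \<in> crossing_edges \<pi>"
  then obtain a b where "e = {a, b}" "a \<in> \<pi>" "b \<in> \<pi>" by (auto simp: crossing_edges_def)
  then show "(\<lambda>x. edge_weight v (f x) e) \<in> borel_measurable M"
    using assms by (simp add: v_edge_weight measurable_v)
qed

lemma abs_edge_prod_le: "\<bar>\<Prod>e\<in>crossing_edges \<pi>. edge_weight v x e\<bar> \<le> 1"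
  unfolding abs_prod
proof (rule prod_le_1)
  fix e assume "e \<in> crossing_edges \<pi>"
  then obtain a b where "e = {a, b}" by (auto simp: crossing_edges_def)
  then show "0 \<le> \<bar>edge_weight v x e\<bar> \<and> \<bar>edge_weight v x e\<bar> \<le> 1"
    by (simp add: v_edge_weight v_bound)
qed

lemma measurable_match_weight:
  assumes "\<pi> \<in> partial_matchings q"
  shows "match_weight v q \<pi> \<in> borel_measurable (label_cube q)"
proof -
  have m: "(\<lambda>x. x (Min u)) \<in> label_cube q \<rightarrow>\<^sub>M U" if "u \<in> \<pi>" for u
    using partial_matchings_block[OF assms that] by (metis measurable_component_singleton)
  have "(\<lambda>x. if Min u < s \<and> s < Max u then v (x (Min u)) (x s) else 1) \<in> borel_measurable (label_cube q)"
    if "u \<in> \<pi>" "s \<in> singles q \<pi>" for u s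
  proof -
    have "s \<in> {1..q}" using that singles_subset by blast
    then have "(\<lambda>x. v (x (Min u)) (x s)) \<in> borel_measurable (label_cube q)"
      by (intro measurable_v m that(1) measurable_component_singleton)
    then show ?thesis by (cases "Min u < s \<and> s < Max u") simp_all
  qed
  then have "(\<lambda>x. \<Prod>u\<in>\<pi>. \<Prod>s\<in>singles q \<pi>. if Min u < s \<and> s < Max u then v (x (Min u)) (x s) else 1)
      \<in> borel_measurable (label_cube q)"
    by (intro borel_measurable_prod)
  then show ?thesis
    unfolding match_weight_def by (intro borel_measurable_times edge_measurable m)
qed

lemma abs_match_weight_le: "\<bar>match_weight v q \<pi> x\<bar> \<le> 1"
proof -
  have "\<bar>\<Prod>u\<in>\<pi>. \<Prod>s\<in>singles q \<pi>. if Min u < s \<and> s < Max u then v (x (Min u)) (x s) else 1\<bar> \<le> 1"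
    unfolding abs_prod by (intro prod_le_1 conjI prod_nonneg) (simp_all add: v_bound)
  then show ?thesis
    unfolding match_weight_def abs_mult using abs_edge_prod_le by (intro mult_le_one) simp_all
qed

text \<open>Unmatched openers also carry |h|^2: the component of the vector contributes h there, and
  the test function its conjugate.\<close>

definition hist_weight :: "nat \<Rightarrow> nat set set \<Rightarrow> (nat \<Rightarrow> real) \<Rightarrow> real" where
  "hist_weight q \<pi> x = (\<Prod>t\<in>openers q \<pi>. (cmod (h (x t)))\<^sup>2) * match_weight v q \<pi> x"

lemma h_norm2_integrable: "integrable U (\<lambda>y. (cmod (h y))\<^sup>2)"
  using h by (simp add: sqint_def)

lemma h_norm2_measurable: "(\<lambda>y. (cmod (h y))\<^sup>2) \<in> borel_measurable U"
  using h_norm2_integrable by (rule borel_measurable_integrable)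

lemma openers_prod_integrable:
  assumes "\<pi> \<in> partial_matchings q"
  shows "integrable (label_cube q) (\<lambda>x. \<Prod>t\<in>openers q \<pi>. (cmod (h (x t)))\<^sup>2)"
proof -
  have "(\<Prod>t\<in>openers q \<pi>. (cmod (h (x t)))\<^sup>2) =
      (\<Prod>t\<in>{1..q}. if t \<in> openers q \<pi> then (cmod (h (x t)))\<^sup>2 else 1)" for x
    using openers_subset[OF assms] by (intro prod.mono_neutral_cong_left) auto
  moreover have "integrable (label_cube q) (\<lambda>x. \<Prod>t\<in>{1..q}. (\<lambda>y. if t \<in> openers q \<pi> then (cmod (h y))\<^sup>2 else 1) (x t))"
  proof (rule PU.product_integrable_prod)
    show "integrable U (\<lambda>y. if t \<in> openers q \<pi> then (cmod (h y))\<^sup>2 else 1)" for t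
      by (cases "t \<in> openers q \<pi>") (simp_all add: h_norm2_integrable)
  qed simp
  ultimately show ?thesis by simp
qed

lemma hist_weight_measurable:
  assumes "\<pi> \<in> partial_matchings q"
  shows "hist_weight q \<pi> \<in> borel_measurable (label_cube q)"
  unfolding hist_weight_def
  by (intro borel_measurable_times measurable_match_weight assms
      borel_measurable_integrable[OF openers_prod_integrable[OF assms]])

lemma hist_integrable:
  assumes \<pi>: "\<pi> \<in> partial_matchings q" and b: "b \<in> borel_measurable (label_cube q)" "\<And>x. cmod (b x) \<le> C"
  shows "integrable (label_cube q) (\<lambda>x. complex_of_real (hist_weight q \<pi> x) * b x)"
proof (rule Bochner_Integration.integrable_bound)
  show "integrable (label_cube q) (\<lambda>x. (\<Prod>t\<in>openers q \<pi>. (cmod (h (x t)))\<^sup>2) * C)"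
    by (intro integrable_mult_left openers_prod_integrable \<pi>)
  show "(\<lambda>x. complex_of_real (hist_weight q \<pi> x) * b x) \<in> borel_measurable (label_cube q)"
    by (intro borel_measurable_times measurable_complex_of_real hist_weight_measurable \<pi> b)
  show "AE x in label_cube q. norm (complex_of_real (hist_weight q \<pi> x) * b x) \<le>
      norm ((\<Prod>t\<in>openers q \<pi>. (cmod (h (x t)))\<^sup>2) * C)"
  proof (rule AE_I2)
    fix x
    let ?P = "\<Prod>t\<in>openers q \<pi>. (cmod (h (x t)))\<^sup>2"
    have P: "0 \<le> ?P" by (rule prod_nonneg) simp
    have C: "0 \<le> C" using b(2)[of x] norm_ge_zero order_trans by blast
    have "norm (complex_of_real (hist_weight q \<pi> x) * b x) = ?P * \<bar>match_weight v q \<pi> x\<bar> * cmod (b x)"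
      unfolding hist_weight_def norm_mult norm_of_real abs_mult abs_of_nonneg[OF P] ..
    also have "\<dots> \<le> ?P * 1 * C"
      by (intro mult_mono mult_left_mono abs_match_weight_le b(2) P mult_nonneg_nonneg) simp_all
    finally show "norm (complex_of_real (hist_weight q \<pi> x) * b x) \<le> norm (?P * C)"
      using P C by (simp add: abs_mult)
  qed
qed

abbreviation hist_term :: "nat \<Rightarrow> nat set set \<Rightarrow> ((nat \<Rightarrow> real) \<Rightarrow> complex) \<Rightarrow> complex" where
  "hist_term q \<pi> g \<equiv> (LINT x|label_cube q. complex_of_real (hist_weight q \<pi> x) * g (select (desc_list (singles q \<pi>)) x))"

lemma hist_term_integrable:
  assumes \<pi>: "\<pi> \<in> partial_matchings q" and n: "card (singles q \<pi>) = n"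
    and g: "g \<in> borel_measurable (prod_cube n)" "\<And>z. cmod (g z) \<le> C"
  shows "integrable (label_cube q) (\<lambda>x. complex_of_real (hist_weight q \<pi> x) * g (select (desc_list (singles q \<pi>)) x))"
proof (rule hist_integrable[OF \<pi>])
  have "select (desc_list (singles q \<pi>)) \<in> label_cube q \<rightarrow>\<^sub>M prod_cube n"
    using measurable_select[of "desc_list (singles q \<pi>)" q] n singles_subset by simp
  from measurable_compose[OF this g(1)]
  show "(\<lambda>x. g (select (desc_list (singles q \<pi>)) x)) \<in> borel_measurable (label_cube q)" .
qed (rule g(2))

lemma label_cube_integral_Suc:
  fixes f :: "(nat \<Rightarrow> real) \<Rightarrow> complex"
  assumes "integrable (label_cube (Suc q)) f"
  shows "(LINT x|label_cube (Suc q). f x) = (LINT x|label_cube q. LINT y|U. f (x(Suc q := y)))"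
  using assms unfolding label_cube_Suc by (intro PU.product_integral_insert) simp_all

section \<open>Recursion of the weights in time\<close>

lemma hist_weight_Suc:
  assumes \<pi>: "\<pi> \<in> partial_matchings q"
  shows "hist_weight (Suc q) \<pi> (x(Suc q := y)) = (cmod (h y))\<^sup>2 * hist_weight q \<pi> x"
proof -
  have n: "Suc q \<notin> openers q \<pi>" and fin: "finite (openers q \<pi>)"
    using openers_subset[OF \<pi>] finite_subset by fastforce+
  have "(\<Prod>t\<in>openers q \<pi>. (cmod (h ((x(Suc q := y)) t)))\<^sup>2) = (\<Prod>t\<in>openers q \<pi>. (cmod (h (x t)))\<^sup>2)"
    using n by (intro prod.cong) auto
  moreover have "match_weight v q \<pi> (x(Suc q := y)) = match_weight v q \<pi> x"
    by (rule match_weight_cong[OF \<pi>]) simp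
  ultimately show ?thesis
    unfolding hist_weight_def openers_Suc[OF \<pi>] prod.insert[OF fin n] match_weight_Suc[OF \<pi>]
    by simp
qed

lemma hist_weight_insert:
  assumes \<pi>: "\<pi> \<in> partial_matchings q" and s: "s \<in> singles q \<pi>"
  shows "hist_weight (Suc q) (insert {s, Suc q} \<pi>) (x(Suc q := y)) =
    hist_weight q \<pi> x * (\<Prod>t\<in>{t \<in> singles q \<pi>. s < t}. v (x t) (x s))"
proof -
  let ?x = "x(Suc q := y)"
  have n: "Suc q \<notin> openers q \<pi>"
    using openers_subset[OF \<pi>] by fastforce
  have "(\<Prod>t\<in>openers q \<pi>. (cmod (h (?x t)))\<^sup>2) = (\<Prod>t\<in>openers q \<pi>. (cmod (h (x t)))\<^sup>2)"
    using n by (intro prod.cong) auto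
  moreover have "match_weight v q \<pi> ?x = match_weight v q \<pi> x"
    by (rule match_weight_cong[OF \<pi>]) simp
  moreover have "(\<Prod>t\<in>{t \<in> singles q \<pi>. s < t}. v (?x t) (?x s)) = (\<Prod>t\<in>{t \<in> singles q \<pi>. s < t}. v (x t) (x s))"
  proof (rule prod.cong[OF refl])
    fix t assume "t \<in> {t \<in> singles q \<pi>. s < t}"
    then have "t \<noteq> Suc q" "s \<noteq> Suc q" using singles_mem[of t q \<pi>] by auto
    then show "v (?x t) (?x s) = v (x t) (x s)" by simp
  qed
  ultimately show ?thesis
    unfolding hist_weight_def openers_insert[OF s] match_weight_insert[where v = v, OF \<pi> s v_sym]
    by simp
qed

text \<open>The transpose of creation on the bounded factor of a test function; |h|^2 is the created
  h times the conjugate factor at the front coordinate.\<close>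

definition push_single :: "((nat \<Rightarrow> real) \<Rightarrow> complex) \<Rightarrow> (nat \<Rightarrow> real) \<Rightarrow> complex" where
  "push_single g z = (LINT y|U. complex_of_real ((cmod (h y))\<^sup>2) * g (ins 0 y z))"

text \<open>The transpose of \<open>contract h k\<close> on the bounded factor: the kernels stay
  here, while the conjugate of \<open>h (x k)\<close> joins the product in the test
  function.\<close>

definition pull_single :: "nat \<Rightarrow> nat \<Rightarrow> ((nat \<Rightarrow> real) \<Rightarrow> complex) \<Rightarrow> (nat \<Rightarrow> real) \<Rightarrow> complex" where
  "pull_single n k g x = (\<Prod>j<k. complex_of_real (v (x j) (x k))) * g (del n k x)"

lemma push_single_measurable:
  assumes "g \<in> borel_measurable (prod_cube (Suc n))"
  shows "push_single g \<in> borel_measurable (prod_cube n)"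
proof -
  have "(\<lambda>p. complex_of_real ((cmod (h (snd p)))\<^sup>2) * g (ins 0 (snd p) (fst p))) \<in> borel_measurable (prod_cube n \<Otimes>\<^sub>M U)"
  proof (rule borel_measurable_times)
    show "(\<lambda>p. complex_of_real ((cmod (h (snd p)))\<^sup>2)) \<in> borel_measurable (prod_cube n \<Otimes>\<^sub>M U)"
      by (rule measurable_compose[OF measurable_snd measurable_complex_of_real[OF h_norm2_measurable]])
    show "(\<lambda>p. g (ins 0 (snd p) (fst p))) \<in> borel_measurable (prod_cube n \<Otimes>\<^sub>M U)"
      using measurable_compose[OF measurable_ins[OF le0] assms] unfolding case_prod_unfold .
  qed
  then have "(\<lambda>(z, y). complex_of_real ((cmod (h y))\<^sup>2) * g (ins 0 y z)) \<in> borel_measurable (prod_cube n \<Otimes>\<^sub>M U)"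
    by (simp add: case_prod_unfold)
  then show ?thesis
    unfolding push_single_def by (rule U.borel_measurable_lebesgue_integral)
qed

lemma push_single_bounded:
  assumes "\<And>z. cmod (g z) \<le> C"
  shows "cmod (push_single g z) \<le> (LINT y|U. (cmod (h y))\<^sup>2 * C)"
proof -
  have C: "0 \<le> C" using assms norm_ge_zero order_trans by blast
  have "cmod (push_single g z) \<le> (LINT y|U. cmod (complex_of_real ((cmod (h y))\<^sup>2) * g (ins 0 y z)))"
    unfolding push_single_def by (rule integral_norm_bound)
  also have "\<dots> \<le> (LINT y|U. (cmod (h y))\<^sup>2 * C)"
  proof (rule integral_mono')
    show "integrable U (\<lambda>y. (cmod (h y))\<^sup>2 * C)"
      by (intro integrable_mult_left h_norm2_integrable)
    show "cmod (complex_of_real ((cmod (h y))\<^sup>2) * g (ins 0 y z)) \<le> (cmod (h y))\<^sup>2 * C" for y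
      unfolding norm_mult norm_of_real abs_power2 by (rule mult_left_mono[OF assms]) simp
  qed (use C in simp)
  finally show ?thesis .
qed

lemma pull_single_measurable:
  assumes "k \<le> n" "g \<in> borel_measurable (prod_cube n)"
  shows "pull_single n k g \<in> borel_measurable (prod_cube (Suc n))"
proof -
  have "(\<lambda>x. v (x j) (x k)) \<in> borel_measurable (prod_cube (Suc n))" if "j < k" for j
    using that assms(1) by (intro measurable_v measurable_component_singleton) auto
  then have "(\<lambda>x. \<Prod>j<k. complex_of_real (v (x j) (x k))) \<in> borel_measurable (prod_cube (Suc n))"
    by (intro borel_measurable_prod borel_measurable_of_real) simp
  then show ?thesis
    unfolding pull_single_def
    by (intro borel_measurable_times measurable_compose[OF measurable_del assms(2)])
qed

lemma pull_single_bounded: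
  assumes "\<And>z. cmod (g z) \<le> C"
  shows "cmod (pull_single n k g x) \<le> C"
proof -
  have "cmod (pull_single n k g x) \<le> 1 * C"
    unfolding pull_single_def norm_mult by (intro mult_mono norm_prod_v_le assms) simp_all
  then show ?thesis by simp
qed

text \<open>The new label is the largest, so its variable sits at position 0, and integrating it out
  is \<open>push_single\<close>.\<close>

lemma hist_term_push:
  assumes \<pi>: "\<pi> \<in> partial_matchings q" and n: "card (singles q \<pi>) = n"
    and g: "g \<in> borel_measurable (prod_cube (Suc n))" "\<And>z. cmod (g z) \<le> C"
  shows "hist_term (Suc q) \<pi> g = hist_term q \<pi> (push_single g)"
proof -
  let ?L = "desc_list (singles q \<pi>)"
  have \<pi>': "\<pi> \<in> partial_matchings (Suc q)"
    using \<pi> unfolding partial_matchings_Suc by blast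
  have ns: "Suc q \<notin> singles q \<pi>" using singles_mem by fastforce
  have card: "card (singles (Suc q) \<pi>) = Suc n"
    unfolding singles_Suc[OF \<pi>] using n ns by simp
  have L: "desc_list (singles (Suc q) \<pi>) = Suc q # ?L"
    unfolding singles_Suc[OF \<pi>] by (rule desc_list_Suc[OF singles_subset])
  have sel: "select (desc_list (singles (Suc q) \<pi>)) (x(Suc q := y)) = ins 0 y (select ?L x)" for x y
  proof -
    have "select ?L (x(Suc q := y)) = select ?L x"
      by (rule select_cong) (use ns in auto)
    then show ?thesis unfolding L select_Cons by simp
  qed
  have "hist_term (Suc q) \<pi> g = (LINT x|label_cube q. LINT y|U.
      complex_of_real (hist_weight (Suc q) \<pi> (x(Suc q := y))) * g (select (desc_list (singles (Suc q) \<pi>)) (x(Suc q := y))))"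
    by (rule label_cube_integral_Suc[OF hist_term_integrable[OF \<pi>' card g]])
  also have "\<dots> = hist_term q \<pi> (push_single g)"
  proof (rule Bochner_Integration.integral_cong[OF refl])
    fix x
    show "(LINT y|U. complex_of_real (hist_weight (Suc q) \<pi> (x(Suc q := y))) *
          g (select (desc_list (singles (Suc q) \<pi>)) (x(Suc q := y)))) =
        complex_of_real (hist_weight q \<pi> x) * push_single g (select ?L x)"
      unfolding sel hist_weight_Suc[OF \<pi>] push_single_def integral_mult_right_zero[symmetric]
      by (simp add: mult_ac del: integral_mult_right_zero)
  qed
  finally show ?thesis .
qed

text \<open>Matching the label at position \<open>k\<close> produces the kernels with the larger
  unmatched labels, which are the \<open>k\<close> coordinates in front of it.\<close>

lemma hist_term_pull:
  assumes \<pi>: "\<pi> \<in> partial_matchings q" and n: "card (singles q \<pi>) = Suc n" and k: "k \<le> n"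
    and g: "g \<in> borel_measurable (prod_cube n)" "\<And>z. cmod (g z) \<le> C"
  shows "hist_term (Suc q) (insert {desc_list (singles q \<pi>) ! k, Suc q} \<pi>) g = hist_term q \<pi> (pull_single n k g)"
proof -
  let ?S = "singles q \<pi>" and ?L = "desc_list (singles q \<pi>)"
  let ?s = "?L ! k"
  let ?\<rho> = "insert {?s, Suc q} \<pi>"
  have "?s \<in> set ?L" using n k by (intro nth_mem) simp
  then have s: "?s \<in> ?S" by simp
  have \<rho>: "?\<rho> \<in> partial_matchings (Suc q)" by (rule partial_matchings_insert[OF \<pi> s])
  have card: "card (singles (Suc q) ?\<rho>) = n"
    unfolding singles_insert[OF s] using s n by simp
  have ns: "Suc q \<notin> ?S" using singles_mem by fastforce
  have L: "desc_list (singles (Suc q) ?\<rho>) = take k ?L @ drop (Suc k) ?L"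
    unfolding singles_insert[OF s] using n k by (intro desc_list_remove) simp_all
  have sel: "select (desc_list (singles (Suc q) ?\<rho>)) (x(Suc q := y)) = del n k (select ?L x)" for x y
  proof -
    have "select ?L (x(Suc q := y)) = select ?L x"
      by (rule select_cong) (use ns in auto)
    then show ?thesis unfolding L using n k by (subst select_remove) simp_all
  qed
  have vv: "(\<Prod>t\<in>{t \<in> ?S. ?s < t}. v (x t) (x ?s)) = (\<Prod>j<k. v (select ?L x j) (select ?L x k))" for x
    using prod.reindex_bij_betw[OF desc_list_take[of ?S k], of "\<lambda>t. v (x t) (x ?s)"] n k
    by (simp add: select_def)
  have "hist_term (Suc q) ?\<rho> g = (LINT x|label_cube q. LINT y|U.
      complex_of_real (hist_weight (Suc q) ?\<rho> (x(Suc q := y))) * g (select (desc_list (singles (Suc q) ?\<rho>)) (x(Suc q := y))))"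
    by (rule label_cube_integral_Suc[OF hist_term_integrable[OF \<rho> card g]])
  \<comment> \<open>The variable \<open>y\<close> of the closer no longer occurs, so its integral is
    that of a constant.\<close>
  also have "\<dots> = hist_term q \<pi> (pull_single n k g)"
    unfolding sel hist_weight_insert[OF \<pi> s] vv pull_single_def integral_const_U
    by (simp add: mult.assoc)
  finally show ?thesis .
qed

section \<open>Testing vectors against the conjugate tensor power of h\<close>

lemma h_prod_sqint: "(\<lambda>z. \<Prod>i<n. cnj (h (z i))) \<in> sqint (prod_cube n)"
proof (induction n)
  case 0
  interpret prob_space "prod_cube 0" by (intro prob_space_PiM) simp
  show ?case by (simp add: sqint_def)
next
  case (Suc n)
  have "(\<lambda>x. cnj (h (x 0)) * (\<Prod>i<n. cnj (h (del n 0 x i)))) \<in> sqint (prod_cube (Suc n))"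
    by (rule sqint_tensor[OF le0 sqint_cnj[OF h] Suc.IH])
  then show ?case
    unfolding prod_del[OF le0] by (simp add: del_def)
qed

lemma test_sqint:
  assumes g: "g \<in> borel_measurable (prod_cube n)" "\<And>z. cmod (g z) \<le> C"
  shows "(\<lambda>z. (\<Prod>i<n. cnj (h (z i))) * g z) \<in> sqint (prod_cube n)"
proof (rule sqint_dominated[OF sqint_cmult[OF h_prod_sqint, of "complex_of_real C"]])
  show "(\<lambda>z. (\<Prod>i<n. cnj (h (z i))) * g z) \<in> borel_measurable (prod_cube n)"
    by (intro borel_measurable_times sqintD[OF h_prod_sqint] g)
  show "cmod ((\<Prod>i<n. cnj (h (z i))) * g z) \<le> cmod (complex_of_real C * (\<Prod>i<n. cnj (h (z i))))" for z
  proof -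
    have "cmod (g z) \<le> \<bar>C\<bar>" using g(2)[of z] by simp
    then show ?thesis unfolding norm_mult norm_of_real by (subst mult.commute) (rule mult_right_mono, simp_all)
  qed
qed

lemma creation_test:
  assumes f: "f \<in> sqint (prod_cube n)" and g: "g \<in> borel_measurable (prod_cube (Suc n))" "\<And>z. cmod (g z) \<le> C"
  shows "(LINT x|prod_cube (Suc n). h (x 0) * f (del n 0 x) * ((\<Prod>i<Suc n. cnj (h (x i))) * g x)) =
    (LINT z|prod_cube n. f z * ((\<Prod>i<n. cnj (h (z i))) * push_single g z))"
proof -
  have "integrable (prod_cube (Suc n)) (\<lambda>x. h (x 0) * f (del n 0 x) * ((\<Prod>i<Suc n. cnj (h (x i))) * g x))"
    by (intro sqint_mult_integrable sqint_tensor[OF le0 h f] test_sqint[OF g])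
  from integral_ins[OF le0 this]
  have "(LINT x|prod_cube (Suc n). h (x 0) * f (del n 0 x) * ((\<Prod>i<Suc n. cnj (h (x i))) * g x)) =
      (LINT z|prod_cube n. LINT y|U. h (ins 0 y z 0) * f (del n 0 (ins 0 y z)) *
        ((\<Prod>i<Suc n. cnj (h (ins 0 y z i))) * g (ins 0 y z)))" .
  also have "\<dots> = (LINT z|prod_cube n. f z * ((\<Prod>i<n. cnj (h (z i))) * push_single g z))"
  proof (rule Bochner_Integration.integral_cong[OF refl])
    fix z assume "z \<in> space (prod_cube n)"
    then have z: "z \<in> extensional {..<n}" by (rule space_prod_cube_ext)
    have "h (ins 0 y z 0) * f (del n 0 (ins 0 y z)) * ((\<Prod>i<Suc n. cnj (h (ins 0 y z i))) * g (ins 0 y z)) =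
        f z * ((\<Prod>i<n. cnj (h (z i))) * (complex_of_real ((cmod (h y))\<^sup>2) * g (ins 0 y z)))" for y
      unfolding prod_del[OF le0] complex_norm_square using z by (simp add: ins_0_Suc mult_ac)
    then show "(LINT y|U. h (ins 0 y z 0) * f (del n 0 (ins 0 y z)) *
        ((\<Prod>i<Suc n. cnj (h (ins 0 y z i))) * g (ins 0 y z))) =
        f z * ((\<Prod>i<n. cnj (h (z i))) * push_single g z)"
      unfolding push_single_def integral_mult_right_zero[symmetric] by (simp only:)
  qed
  finally show ?thesis .
qed

text \<open>The contraction supplies the conjugate of \<open>h (x k)\<close>, the one factor by
  which the product over n + 1 coordinates exceeds the product over the coordinates kept by
  \<open>del\<close>.\<close>

lemma contract_test:
  assumes k: "k \<le> n" and f: "f \<in> sqint (prod_cube (Suc n))"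
    and g: "g \<in> borel_measurable (prod_cube n)" "\<And>z. cmod (g z) \<le> C"
  shows "(LINT z|prod_cube n. contract h k f z * ((\<Prod>i<n. cnj (h (z i))) * g z)) =
    (LINT x|prod_cube (Suc n). f x * ((\<Prod>i<Suc n. cnj (h (x i))) * pull_single n k g x))"
proof -
  let ?G = "\<lambda>z. (\<Prod>i<n. cnj (h (z i))) * g z"
  \<comment> \<open>Two conjugations convert the bilinear pairing into the sesquilinear one of
    \<open>contract_adjoint\<close>.\<close>
  have "(LINT z|prod_cube n. contract h k f z * ?G z) = cnj (LINT z|prod_cube n. cnj (?G z) * cnj (contract h k f z))"
    unfolding Bochner_Integration.integral_cnj[symmetric] by (simp add: mult_ac)
  also have "\<dots> = cnj (LINT x|prod_cube (Suc n). h (x k) * cnj (?G (del n k x)) *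
      cnj ((\<Prod>j<k. complex_of_real (v (x j) (x k))) * f x))"
    by (subst contract_adjoint(2)[OF k h sqint_cnj[OF test_sqint[OF g]] f]) (rule refl)
  also have "\<dots> = (LINT x|prod_cube (Suc n). f x * ((\<Prod>i<Suc n. cnj (h (x i))) * pull_single n k g x))"
    unfolding Bochner_Integration.integral_cnj[symmetric]
  proof (rule Bochner_Integration.integral_cong[OF refl])
    fix x
    show "cnj (h (x k) * cnj (?G (del n k x)) * cnj ((\<Prod>j<k. complex_of_real (v (x j) (x k))) * f x)) =
        f x * ((\<Prod>i<Suc n. cnj (h (x i))) * pull_single n k g x)"
      unfolding prod_del[OF k] pull_single_def by (simp add: del_def mult_ac)
  qed
  finally show ?thesis .
qed

section \<open>The induction over time\<close>

definition moment_sum :: "nat \<Rightarrow> nat \<Rightarrow> ((nat \<Rightarrow> real) \<Rightarrow> complex) \<Rightarrow> complex" where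
  "moment_sum q n g = (\<Sum>\<pi>\<in>partial_matchings q. if card (singles q \<pi>) = n then hist_term q \<pi> g else 0)"

text \<open>Splitting by the last point gives the same recursion as for the tested components. The
  unmatched points are enumerated by their positions \<open>k\<close>, and \<open>n\<close> of them
  remain after an annihilation exactly when there were \<open>Suc n\<close> before.\<close>

lemma moment_sum_Suc:
  assumes g: "g \<in> borel_measurable (prod_cube n)" "\<And>z. cmod (g z) \<le> C"
  shows "moment_sum (Suc q) n g = (case n of 0 \<Rightarrow> 0 | Suc m \<Rightarrow> moment_sum q m (push_single g)) +
    (\<Sum>k\<le>n. moment_sum q (Suc n) (pull_single n k g))"
proof -
  let ?F = "\<lambda>\<pi>. if card (singles (Suc q) \<pi>) = n then hist_term (Suc q) \<pi> g else 0"
  have card_Suc: "card (singles (Suc q) \<pi>) = Suc (card (singles q \<pi>))" if "\<pi> \<in> partial_matchings q" for \<pi>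
  proof -
    have "Suc q \<notin> singles q \<pi>" using singles_mem by fastforce
    then show ?thesis unfolding singles_Suc[OF that] by simp
  qed
  have 1: "(\<Sum>\<pi>\<in>partial_matchings q. ?F \<pi>) = (case n of 0 \<Rightarrow> 0 | Suc m \<Rightarrow> moment_sum q m (push_single g))"
  proof (cases n)
    case 0
    then show ?thesis by (simp add: card_Suc)
  next
    case (Suc m)
    have "(\<Sum>\<pi>\<in>partial_matchings q. ?F \<pi>) = moment_sum q m (push_single g)"
      unfolding moment_sum_def
    proof (rule sum.cong[OF refl])
      fix \<pi> assume \<pi>: "\<pi> \<in> partial_matchings q"
      have g': "g \<in> borel_measurable (prod_cube (Suc m))" using g(1) Suc by simp
      show "?F \<pi> = (if card (singles q \<pi>) = m then hist_term q \<pi> (push_single g) else 0)"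
        using hist_term_push[OF \<pi> _ g' g(2)] unfolding Suc card_Suc[OF \<pi>] by simp
    qed
    then show ?thesis by (simp add: Suc)
  qed
  have 2: "(\<Sum>\<pi>\<in>partial_matchings q. \<Sum>s\<in>singles q \<pi>. ?F (insert {s, Suc q} \<pi>)) =
      (\<Sum>k\<le>n. moment_sum q (Suc n) (pull_single n k g))"
  proof -
    have "(\<Sum>s\<in>singles q \<pi>. ?F (insert {s, Suc q} \<pi>)) =
        (\<Sum>k\<le>n. if card (singles q \<pi>) = Suc n then hist_term q \<pi> (pull_single n k g) else 0)"
      if \<pi>: "\<pi> \<in> partial_matchings q" for \<pi>
    proof (cases "card (singles q \<pi>) = Suc n")
      case True
      let ?L = "desc_list (singles q \<pi>)"
      have "bij_betw ((!) ?L) {..<Suc n} (singles q \<pi>)"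
        using True by (intro bij_betw_nth distinct_desc_list) simp_all
      from sum.reindex_bij_betw[OF this, of "\<lambda>s. ?F (insert {s, Suc q} \<pi>)", symmetric]
      have "(\<Sum>s\<in>singles q \<pi>. ?F (insert {s, Suc q} \<pi>)) = (\<Sum>k<Suc n. ?F (insert {?L ! k, Suc q} \<pi>))" .
      also have "\<dots> = (\<Sum>k<Suc n. hist_term q \<pi> (pull_single n k g))"
      proof (rule sum.cong[OF refl])
        fix k assume k: "k \<in> {..<Suc n}"
        then have "?L ! k \<in> set ?L" using True by (intro nth_mem) simp
        then have "?L ! k \<in> singles q \<pi>" by simp
        then have "card (singles (Suc q) (insert {?L ! k, Suc q} \<pi>)) = n"
          using True by (simp add: singles_insert)
        then show "?F (insert {?L ! k, Suc q} \<pi>) = hist_term q \<pi> (pull_single n k g)"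
          using hist_term_pull[OF \<pi> True _ g, of k] k by simp
      qed
      finally show ?thesis using True by (simp add: lessThan_Suc_atMost)
    next
      case False
      have "card (singles (Suc q) (insert {s, Suc q} \<pi>)) \<noteq> n" if s: "s \<in> singles q \<pi>" for s
      proof -
        have "card (singles q \<pi>) = Suc (card (singles q \<pi> - {s}))"
          using s by (intro card.remove) simp_all
        with False show ?thesis by (simp add: singles_insert[OF s])
      qed
      then show ?thesis using False by simp
    qed
    then have "(\<Sum>\<pi>\<in>partial_matchings q. \<Sum>s\<in>singles q \<pi>. ?F (insert {s, Suc q} \<pi>)) =
        (\<Sum>\<pi>\<in>partial_matchings q. \<Sum>k\<le>n. if card (singles q \<pi>) = Suc n then hist_term q \<pi> (pull_single n k g) else 0)"
      by (rule sum.cong[OF refl])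
    also have "\<dots> = (\<Sum>k\<le>n. moment_sum q (Suc n) (pull_single n k g))"
      unfolding moment_sum_def by (rule sum.swap)
    finally show ?thesis .
  qed
  show ?thesis
    unfolding moment_sum_def[of "Suc q"] sum_partial_matchings_Suc 1 2 ..
qed

text \<open>The moments use n = 0 and g = 1, but the recursion moves \<open>n\<close> in both
  directions and changes \<open>g\<close> together with its bound, so all three are kept
  general.\<close>

lemma field_iter_moment:
  assumes g: "g \<in> borel_measurable (prod_cube n)" "\<And>z. cmod (g z) \<le> C"
  shows "(LINT z|prod_cube n. field_iter q n z * ((\<Prod>i<n. cnj (h (z i))) * g z)) = moment_sum q n g"
  using g
proof (induction q arbitrary: n g C)
  case 0
  have e: "label_cube 0 = prod_cube 0" by simp
  show ?case
  proof (cases "n = 0")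
    case True
    \<comment> \<open>\<open>select []\<close> fixes the only point of the zero-dimensional cube but
      moves all other functions, so the equality is restricted to the space.\<close>
    have "g (select [] x) = g x" if "x \<in> space (prod_cube 0)" for x
      using that by (simp add: select_def space_PiM)
    then have "(LINT z|prod_cube 0. g z) = (LINT z|prod_cube 0. g (select [] z))"
      by (intro Bochner_Integration.integral_cong) simp_all
    then show ?thesis
      using True
      by (simp add: moment_sum_def partial_matchings_0 singles_def fock_vacuum_def hist_weight_def openers_def
          match_weight_def crossing_edges_def desc_list_def)
  next
    case False
    then show ?thesis
      by (simp add: moment_sum_def partial_matchings_0 singles_def fock_vacuum_def)
  qed
next
  case (Suc q)
  note g = Suc.prems
  let ?G = "\<lambda>z. (\<Prod>i<n. cnj (h (z i))) * g z"
  have G: "?G \<in> sqint (prod_cube n)" by (rule test_sqint[OF g])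
  note s = measurable_field_iter[of q]
  have c: "fock_creation h (field_iter q) n \<in> sqint (prod_cube n)"
    by (rule measurable_fock_sqint[OF measurable_fock_creation[OF h s]])
  have a: "contract h k (field_iter q (Suc n)) \<in> sqint (prod_cube n)" if "k \<le> n" for k
    by (rule contract_sqint[OF that h measurable_fock_sqint[OF s]])
  have cr: "(LINT z|prod_cube n. fock_creation h (field_iter q) n z * ?G z) =
      (case n of 0 \<Rightarrow> 0 | Suc m \<Rightarrow> moment_sum q m (push_single g))"
  proof (cases n)
    case 0
    then show ?thesis by (simp add: fock_creation_0)
  next
    case (Suc m)
    have g': "g \<in> borel_measurable (prod_cube (Suc m))" using g(1) Suc by simp
    show ?thesis
      unfolding Suc fock_creation_Suc nat.case creation_test[OF measurable_fock_sqint[OF s] g' g(2)]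
      by (rule Suc.IH[OF push_single_measurable[OF g'] push_single_bounded[OF g(2)]])
  qed
  have an: "(LINT z|prod_cube n. contract h k (field_iter q (Suc n)) z * ?G z) =
      moment_sum q (Suc n) (pull_single n k g)" if "k \<le> n" for k
    unfolding contract_test[OF that measurable_fock_sqint[OF s] g]
    by (rule Suc.IH[OF pull_single_measurable[OF that g(1)] pull_single_bounded[OF g(2)]])
  have "(LINT z|prod_cube n. field_iter (Suc q) n z * ?G z) =
      (LINT z|prod_cube n. fock_creation h (field_iter q) n z * ?G z +
        (\<Sum>k\<le>n. contract h k (field_iter q (Suc n)) z * ?G z))"
    by (simp add: annihilation_def distrib_right sum_distrib_right)
  also have "\<dots> = (LINT z|prod_cube n. fock_creation h (field_iter q) n z * ?G z) +
      (\<Sum>k\<le>n. LINT z|prod_cube n. contract h k (field_iter q (Suc n)) z * ?G z)"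
  proof -
    have "integrable (prod_cube n) (\<lambda>z. \<Sum>k\<le>n. contract h k (field_iter q (Suc n)) z * ?G z)"
      by (rule Bochner_Integration.integrable_sum) (simp add: sqint_mult_integrable[OF a G])
    moreover have "(LINT z|prod_cube n. (\<Sum>k\<le>n. contract h k (field_iter q (Suc n)) z * ?G z)) =
        (\<Sum>k\<le>n. LINT z|prod_cube n. contract h k (field_iter q (Suc n)) z * ?G z)"
      by (rule Bochner_Integration.integral_sum) (simp add: sqint_mult_integrable[OF a G])
    ultimately show ?thesis
      using Bochner_Integration.integral_add[OF sqint_mult_integrable[OF c G]] by simp
  qed
  also have "\<dots> = moment_sum (Suc q) n g"
    unfolding cr moment_sum_Suc[OF g] by (simp add: an)
  finally show ?case .
qed

end

section \<open>From complete matchings to the pairing formula\<close>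

context twisted_fock
begin

lemma edge_weight_AE:
  assumes \<pi>: "finite \<pi>"
  shows "AE x in Pi\<^sub>M \<pi> (\<lambda>_. U). \<forall>e\<in>crossing_edges \<pi>. edge_weight w x e = edge_weight v x e"
proof (intro AE_finite_allI finite_crossing_edges[OF \<pi>])
  fix e assume "e \<in> crossing_edges \<pi>"
  then obtain a b where e: "e = {a, b}" "a \<in> \<pi>" "b \<in> \<pi>" "a \<noteq> b"
    by (auto simp: crossing_edges_def)
  from AE_two_components[OF w_eq_v e(2,3,4)] AE_space
  show "AE x in Pi\<^sub>M \<pi> (\<lambda>_. U). edge_weight w x e = edge_weight v x e"
  proof eventually_elim
    case (elim x)
    have "x a \<in> {0..1}" "x b \<in> {0..1}"
      using elim(2) e(2,3) by (simp_all add: space_PiM PiE_iff)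
    then show ?case
      unfolding e(1) v_edge_weight using elim(1) w_sym[of "x a" "x b"]
      by (simp add: edge_weight_pair[of w x a b])
  qed
qed

lemma hist_weight_pair_partition:
  assumes "\<pi> \<in> partial_matchings q" "singles q \<pi> = {}"
  shows "hist_weight q \<pi> x = (\<Prod>u\<in>\<pi>. (cmod (h (x (Min u))))\<^sup>2) *
    (\<Prod>e\<in>crossing_edges \<pi>. edge_weight v (\<lambda>u. x (Min u)) e)"
proof -
  have "(\<Prod>t\<in>openers q \<pi>. (cmod (h (x t)))\<^sup>2) = (\<Prod>u\<in>\<pi>. (cmod (h (x (Min u))))\<^sup>2)"
    unfolding openers_def assms(2) Un_empty_right by (rule prod.reindex_cong[OF inj_on_Min[OF assms(1)]]) simp_all
  then show ?thesis
    by (simp add: hist_weight_def match_weight_def assms(2))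
qed

text \<open>Giving each block the variable of its opener pushes the label cube forward to the cube
  over the blocks; the closers integrate out.\<close>

lemma integral_pairing:
  assumes \<pi>: "\<pi> \<in> partial_matchings q" and s: "singles q \<pi> = {}"
  shows "(LINT x|cube \<pi>. (\<Prod>u\<in>\<pi>. (cmod (h (x u)))\<^sup>2) * (\<Prod>e\<in>crossing_edges \<pi>. edge_weight w x e)) =
    (LINT x|label_cube q. hist_weight q \<pi> x)"
proof -
  let ?F = "\<lambda>x. (\<Prod>u\<in>\<pi>. (cmod (h (x u)))\<^sup>2) * (\<Prod>e\<in>crossing_edges \<pi>. edge_weight v x e)"
  let ?T = "\<lambda>x. \<lambda>u\<in>\<pi>. x (Min u)"
  note fin = partial_matching_finite[OF \<pi>]
  have Min: "Min u \<in> {1..q}" if "u \<in> \<pi>" for u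
    using partial_matchings_block[OF \<pi> that] by metis
  have F: "?F \<in> borel_measurable (Pi\<^sub>M \<pi> (\<lambda>_. U))"
    by (intro borel_measurable_times borel_measurable_prod edge_measurable
        measurable_compose[OF _ h_norm2_measurable] measurable_component_singleton)
  have T: "?T \<in> label_cube q \<rightarrow>\<^sub>M Pi\<^sub>M \<pi> (\<lambda>_. U)"
    by (intro measurable_restrict measurable_component_singleton Min)
  have "distr (label_cube q) (Pi\<^sub>M \<pi> (\<lambda>_. U)) ?T = Pi\<^sub>M \<pi> (\<lambda>_. U)"
    using Min by (intro distr_PiM_reindex inj_on_Min[OF \<pi>]) simp_all
  then have "(LINT x|Pi\<^sub>M \<pi> (\<lambda>_. U). ?F x) = (LINT x|label_cube q. ?F (?T x))"
    using integral_distr[OF T F] by simp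
  also have "\<dots> = (LINT x|label_cube q. hist_weight q \<pi> x)"
  proof (rule Bochner_Integration.integral_cong[OF refl])
    fix x
    have "edge_weight v (?T x) e = edge_weight v (\<lambda>u. x (Min u)) e" if e: "e \<in> crossing_edges \<pi>" for e
    proof -
      obtain a b where "e = {a, b}" "a \<in> \<pi>" "b \<in> \<pi>"
        using e by (auto simp: crossing_edges_def)
      then show ?thesis by (simp add: v_edge_weight)
    qed
    then show "?F (?T x) = hist_weight q \<pi> x"
      unfolding hist_weight_pair_partition[OF \<pi> s] by simp
  qed
  moreover have "(LINT x|cube \<pi>. (\<Prod>u\<in>\<pi>. (cmod (h (x u)))\<^sup>2) * (\<Prod>e\<in>crossing_edges \<pi>. edge_weight w x e)) =
      (LINT x|Pi\<^sub>M \<pi> (\<lambda>_. U). ?F x)"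
    unfolding cube_def
    by (rule integral_completion_AE[OF F]) (rule eventually_mono[OF edge_weight_AE[OF fin]], simp)
  ultimately show ?thesis by simp
qed

lemma vacuum_state_moment:
  "vacuum_state w (field_op w h ^^ q) = complex_of_real (pairing_moment w h q)"
proof -
  have "vacuum_state w (field_op w h ^^ q) = moment_sum q 0 (\<lambda>_. 1)"
    using field_iter_moment[of "\<lambda>_. 1" 0 1 q] by (simp add: vacuum_state_field_op)
  also have "\<dots> = (\<Sum>\<pi>\<in>partial_matchings q. if singles q \<pi> = {} then
      complex_of_real (LINT x|label_cube q. hist_weight q \<pi> x) else 0)"
    unfolding moment_sum_def by (rule sum.cong[OF refl]) simp
  also have "\<dots> = (\<Sum>\<pi>\<in>pair_partitions q. complex_of_real (LINT x|label_cube q. hist_weight q \<pi> x))"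
    unfolding pair_partitions_eq by (rule sum.inter_filter[symmetric]) simp
  also have "\<dots> = complex_of_real (pairing_moment w h q)"
    unfolding pairing_moment_def of_real_sum
  proof (rule sum.cong[OF refl])
    fix \<pi> assume "\<pi> \<in> pair_partitions q"
    then have "\<pi> \<in> partial_matchings q" "singles q \<pi> = {}"
      by (simp_all add: pair_partitions_eq)
    from integral_pairing[OF this]
    show "complex_of_real (LINT x|label_cube q. hist_weight q \<pi> x) =
        complex_of_real (LINT x|cube \<pi>. (\<Prod>u\<in>\<pi>. (cmod (h (x u)))\<^sup>2) * (\<Prod>e\<in>crossing_edges \<pi>. edge_weight w x e))"
      by (simp only:)
  qed
  finally show ?thesis .
qed

lemma has_law_field_op:
  assumes "is_mu w h M"
  shows "has_law w (field_op w h) M"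
proof -
  have M: "real_distribution M" "integrable M (\<lambda>t. t ^ p)" "(LINT t|M. t ^ p) = pairing_moment w h p" if "p \<ge> 1" for p
    using assms that by (auto simp: is_mu_def)
  interpret real_distribution M using M(1)[OF order_refl] .
  have P0: "measure (prod_cube 0) (space (prod_cube 0)) = 1"
    by (rule prob_space.prob_space) (intro prob_space_PiM prob_space_U)
  have "integrable M (\<lambda>t. t ^ p) \<and> vacuum_state w (field_op w h ^^ p) = complex_of_real (LINT t|M. t ^ p)" for p
  proof (cases "p = 0")
    case True
    \<comment> \<open>\<open>is_mu\<close> prescribes the moments from p = 1 on, whereas
      \<open>has_law\<close> includes p = 0, where both sides are 1 because the vacuum and the
      measure are normalised.\<close>
    have "vacuum_state w (field_op w h ^^ 0) = 1"
      unfolding vacuum_state_field_op field_iter.simps fock_vacuum_def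
      unfolding if_P[OF refl] lebesgue_integral_const P0 by simp
    then show ?thesis using True prob_space by simp
  next
    case False
    then show ?thesis using M(2,3)[of p] by (simp add: vacuum_state_moment)
  qed
  then show ?thesis
    unfolding has_law_def using real_distribution_axioms by blast
qed

end

theorem theorem2p1:
  fixes w :: "real \<Rightarrow> real \<Rightarrow> real" and h :: "real \<Rightarrow> complex"
  assumes "twist_kernel w" and "h \<in> L2_unit"
  shows "(\<forall>p\<ge>1. vacuum_state w (field_op w h ^^ p) = complex_of_real (pairing_moment w h p)) \<and>
         (\<forall>\<mu>. is_mu w h \<mu> \<longrightarrow> has_law w (field_op w h) \<mu>) \<and>
         (\<forall>\<mu>. is_mu w (\<lambda>_. 1) \<mu> \<longrightarrow> has_law w (field_op w (\<lambda>_. 1)) \<mu>)"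
proof -
  obtain v where v: "bounded_kernel v" "AE p in U \<Otimes>\<^sub>M U. w (fst p) (snd p) = v (fst p) (snd p)"
    using assms(1) by (rule twist_kernel_version)
  have sym: "w x y = w y x" if "x \<in> {0..1}" "y \<in> {0..1}" for x y
    using assms(1) that unfolding twist_kernel_def by blast
  \<comment> \<open>The version \<open>v\<close> depends on \<open>w\<close> alone, so it serves
    both \<open>h\<close> and the constant function 1.\<close>
  have F: "twisted_fock v w g" if "g \<in> sqint U" for g
    using v sym that by (intro twisted_fock.intro twisted_fock_axioms.intro)
  have h: "h \<in> sqint U" using assms(2) by (simp add: L2_unit_eq)
  have one: "(\<lambda>_. 1) \<in> sqint U" by (simp add: sqint_def)
  show ?thesis
    using twisted_fock.vacuum_state_moment[OF F[OF h]] twisted_fock.has_law_field_op[OF F[OF h]]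
      twisted_fock.has_law_field_op[OF F[OF one]] by blast
qed

end
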